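(* Let $N\geq 3$. There is a constant $K_N>0$, depending only on $N$, such that for any domain $\Omega\subsetneq\mathbb{R}^N$ and any $u\in C_0^\infty(\Omega)$ $$ \int_\Omega \left( |\nabla u|^2 - \frac{|u|^2}{4D_\Omega^2} \right) dx \geq K_N \left( \int_\Omega |u|^{\frac{2N}{N-2}} \,dx \right)^{\frac{N-2}{N}} . $$
   Context: A domain is a nonempty connected open set; $\Omega^c=\mathbb{R}^N\setminus\Omega$. $C_0^\infty(\Omega)$ denotes the smooth (complex-valued) functions with compact support in $\Omega$. For $x\in\Omega$ and $e\in\mathbb{S}^{N-1}$ (the unit sphere in $\mathbb{R}^N$, with surface measure $de$ and total measure $|\mathbb{S}^{N-1}|$) set $$d_e(x) := \inf\{ |t| : t\in\mathbb{R},\ x+te \in\Omega^c \},$$ with $\inf\emptyset=+\infty$ and $(+\infty)^{-2}=0$. The weight $D_\Omega$ is $$D_\Omega(x) := \left( N |\mathbb{S}^{N-1}|^{-1} \int_{\mathbb{S}^{N-1}} d_e(x)^{-2} \,de \right)^{-\frac12},$$ i.e. $D_\Omega(x)^{-2}= N |\mathbb{S}^{N-1}|^{-1} \int_{\mathbb{S}^{N-1}} d_e(x)^{-2} \,de$. *)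

theory Defs
  imports "HOL-Analysis.Analysis"
begin

definition is_domain :: "(real ^ 'n) set \<Rightarrow> bool" where
  "is_domain \<Omega> \<longleftrightarrow> \<Omega> \<noteq> {} \<and> open \<Omega> \<and> connected \<Omega>"


section \<open>Smooth functions, test functions, gradient\<close>

text \<open>Class $C^k$ on the whole space: all directional derivatives up to order $k$ exist and
  are continuous.\<close>

fun C_k :: "nat \<Rightarrow> ((real ^ 'n) \<Rightarrow> complex) \<Rightarrow> bool" where
  "C_k 0 u \<longleftrightarrow> continuous_on UNIV u"
| "C_k (Suc k) u \<longleftrightarrow>
     (\<forall>x. u differentiable (at x)) \<and> (\<forall>v. C_k k (\<lambda>x. frechet_derivative u (at x) v))"

text \<open>Functions in $C_0^\infty(\Omega)$ are represented by their extension by zero, which is smooth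
  on the whole space since the support is a compact subset of the open set $\Omega$.\<close>

definition test_functions :: "(real ^ 'n) set \<Rightarrow> ((real ^ 'n) \<Rightarrow> complex) set" where
  "test_functions \<Omega> = {u. (\<forall>k. C_k k u) \<and>
     compact (closure {x. u x \<noteq> 0}) \<and> closure {x. u x \<noteq> 0} \<subseteq> \<Omega>}"

text \<open>The vector of partial derivatives; its norm is the Hermitian norm, so that
  $|\nabla u|^2 = \sum_i |\partial_i u|^2$.\<close>

definition gradient :: "((real ^ 'n) \<Rightarrow> complex) \<Rightarrow> real ^ 'n \<Rightarrow> complex ^ 'n" where
  "gradient u x = (\<chi> i. frechet_derivative u (at x) (axis i 1))"

lemma norm_gradient_sq: "(norm (gradient u x))\<^sup>2 =
    (\<Sum>i\<in>UNIV. (cmod (frechet_derivative u (at x) (axis i 1)))\<^sup>2)"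
  by (simp add: gradient_def norm_vec_def L2_set_def sum_nonneg)


section \<open>Surface measure on the unit sphere\<close>

text \<open>The surface measure is obtained from Lebesgue measure by polar coordinates: the surface
  area of $A$ is $N$ times the volume of the cone $\{r e : 0 < r < 1, e \in A\}$.\<close>

definition surface_measure :: "(real ^ 'n) measure" where
  "surface_measure = scale_measure (of_nat CARD('n))
     (distr (restrict_space lborel (ball 0 1 - {0})) (restrict_space borel (sphere 0 1)) sgn)"

lemma space_surface_measure: "space (surface_measure :: (real ^ 'n) measure) = sphere 0 1"
  by (simp add: surface_measure_def space_scale_measure space_restrict_space)

lemma emeasure_surface_measure:
  fixes A :: "(real ^ 'n) set"
  assumes "A \<in> sets borel" "A \<subseteq> sphere 0 1"
  shows "emeasure surface_measure A =
    of_nat CARD('n) * emeasure lborel {x \<in> ball 0 1 - {0}. sgn x \<in> A}"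
proof -
  let ?R = "restrict_space lborel (ball 0 1 - {0}) :: (real ^ 'n) measure"
  have m: "sgn \<in> ?R \<rightarrow>\<^sub>M restrict_space borel (sphere 0 1)"
    by (intro measurable_restrict_space2 measurable_restrict_space1)
      (auto simp: space_restrict_space norm_sgn)
  have A: "A \<in> sets (restrict_space borel (sphere 0 1))"
    using assms by (auto simp: sets_restrict_space_iff)
  have pre: "sgn -` A \<inter> space ?R = {x \<in> ball 0 1 - {0}. sgn x \<in> A}"
    by (auto simp: space_restrict_space)
  have "emeasure ?R {x \<in> ball 0 1 - {0}. sgn x \<in> A} =
      emeasure lborel {x \<in> ball 0 1 - {0}. sgn x \<in> A}"
    by (rule emeasure_restrict_space) auto
  then show ?thesis
    using emeasure_distr[OF m A] pre by (simp only: surface_measure_def emeasure_scale_measure)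
qed


section \<open>Directional distance and the weight\<close>

text \<open>In \<^typ>\<open>ennreal\<close>, \<open>Inf {} = \<infinity>\<close> and \<open>inverse \<infinity> = 0\<close>.\<close>

definition dir_dist :: "(real ^ 'n) set \<Rightarrow> real ^ 'n \<Rightarrow> real ^ 'n \<Rightarrow> ennreal" where
  "dir_dist \<Omega> e x = Inf {ennreal \<bar>t\<bar> | t::real. x + t *\<^sub>R e \<in> - \<Omega>}"

definition ennsqrt :: "ennreal \<Rightarrow> ennreal" where
  "ennsqrt a = (if a = \<infinity> then \<infinity> else ennreal (sqrt (enn2real a)))"

text \<open>The weight takes values in \<open>[0, \<infinity>]\<close>: it is infinite where almost every line through \<open>x\<close>
  stays in \<open>\<Omega>\<close>, e.g. when \<open>\<Omega>\<close> is a punctured space.\<close>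

definition D_weight :: "(real ^ 'n) set \<Rightarrow> real ^ 'n \<Rightarrow> ennreal" where
  "D_weight \<Omega> x = inverse (ennsqrt
     (of_nat CARD('n) * inverse (emeasure surface_measure (sphere 0 1 :: (real ^ 'n) set)) *
       (\<integral>\<^sup>+ e. inverse ((dir_dist \<Omega> e x)\<^sup>2) \<partial>surface_measure)))"

lemma ennsqrt_power2: "(ennsqrt a)\<^sup>2 = a"
  by (cases a) (auto simp: ennsqrt_def ennreal_power ennreal_top_eq_mult_iff power2_eq_square
      ennreal_mult[symmetric])

lemma inverse_D_weight_power2:
  fixes \<Omega> :: "(real ^ 'n) set"
  shows "inverse ((D_weight \<Omega> x)\<^sup>2) =
    of_nat CARD('n) * inverse (emeasure surface_measure (sphere 0 1 :: (real ^ 'n) set)) *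
       (\<integral>\<^sup>+ e. inverse ((dir_dist \<Omega> e x)\<^sup>2) \<partial>surface_measure)"
proof -
  have "inverse (inverse a) = a" for a :: ennreal
  proof (cases a)
    case (real r)
    then show ?thesis
      by (cases "r = 0") (auto simp: inverse_ennreal)
  qed simp
  then show ?thesis
    by (simp add: D_weight_def ennreal_inverse_power[symmetric] ennsqrt_power2)
qed

end

theory Submission
  imports Defs
begin

text \<open>
  For a unit vector \<open>e\<close> let \<open>E\<^sub>e\<close> be the integral of
  \<open>|\<partial>\<^sub>e u|\<^sup>2 - |u|\<^sup>2 / (4 d\<^sub>e\<^sup>2)\<close>. The weight is designed so that the left-hand side of the
  theorem is \<open>N\<close> times the mean of \<open>E\<^sub>e\<close> over the sphere (\<open>energy_eq_average\<close>): the mean of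
  \<open>|\<partial>\<^sub>e u|\<^sup>2\<close> is \<open>|\<nabla>u|\<^sup>2 / N\<close> because the surface measure is invariant under rotations. Each
  \<open>E\<^sub>e\<close> is an integral, over the lines parallel to \<open>e\<close>, of one-dimensional Hardy energies.

  In one dimension the substitution \<open>u = \<surd>\<rho> v\<close>, with \<open>\<rho>\<close> the distance to an end point, turns the
  Hardy energy into \<open>\<integral> \<rho> |v'|\<^sup>2\<close> plus a nonnegative boundary term. Integrating the derivative of
  \<open>|v|\<^sup>s\<close> then gives more than positivity, namely the pointwise bound
  \<open>|u(t)|\<^sup>s \<le> (3 s + 2) (energy)\<^sup>1\<^sup>/\<^sup>2 (\<integral> |u|\<^sup>2\<^sup>s\<^sup>-\<^sup>2)\<^sup>1\<^sup>/\<^sup>2\<close> (\<open>half_interval_hardy_sobolev\<close>,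
  \<open>open_set_hardy_sobolev\<close>). This replaces the trivial bound of \<open>|u|\<^sup>s\<close> by \<open>s \<integral> |u|\<^sup>s\<^sup>-\<^sup>1 |u'|\<close> in
  the Gagliardo--Nirenberg proof of the Sobolev inequality: for \<open>N\<close> independent directions
  \<open>e\<^sub>1, \<dots>, e\<^sub>N\<close>, the Loomis--Whitney inequality (\<open>loomis_whitney\<close>) applied to the product of the
  bounds along the lines in these directions, with \<open>s = 2 (N - 1) / (N - 2)\<close>, yields
  \<open>(\<integral> |u|\<^sup>q)\<^sup>(\<^sup>N\<^sup>-\<^sup>2\<^sup>)\<^sup>/\<^sup>N \<le> C max\<^sub>i E\<^sub>e\<^sub>i\<close> for \<open>q = 2 N / (N - 2) = 2 s - 2\<close>
  (\<open>frame_sobolev\<close>), where \<open>C\<close> is uniform for directions close to the coordinate axes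
  (\<open>near_axes_sobolev\<close>).

  It remains to choose the directions. Since all \<open>E\<^sub>e\<close> are nonnegative (\<open>hardy_energy_nonneg\<close>), Markov's inequality gives
  in each small cap around a coordinate axis a direction at which \<open>E\<^sub>e\<close> is bounded by a constant
  multiple of the mean.
\<close>

section \<open>The one-dimensional inequality\<close>

text \<open>At a zero of \<open>f\<close> the derivative exists and is \<open>0\<close> because \<open>p > 1\<close>; the formula agrees
  because of its factor \<open>f t \<bullet> f'\<close>.\<close>
lemma norm_powr_has_real_derivative:
  fixes f :: "real \<Rightarrow> 'a::real_inner"
  assumes p: "p > 1" and f: "(f has_vector_derivative f') (at t within S)"
  shows "((\<lambda>t. norm (f t) powr p) has_real_derivative
           p * norm (f t) powr (p - 2) * (f t \<bullet> f')) (at t within S)"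
proof (cases "f t = 0")
  case False
  have "((\<lambda>t. norm (f t)) has_derivative (\<lambda>h. sgn (f t) \<bullet> (h *\<^sub>R f'))) (at t within S)"
    using has_derivative_compose[OF f[unfolded has_vector_derivative_def]
        has_derivative_norm[OF False]]
    by (simp add: o_def inner_commute)
  then have "((\<lambda>t. norm (f t)) has_real_derivative (sgn (f t) \<bullet> f')) (at t within S)"
    by (simp add: has_field_derivative_def mult_commute_abs)
  then have "((\<lambda>t. norm (f t) powr p) has_real_derivative
      p * norm (f t) powr (p - 1) * (sgn (f t) \<bullet> f')) (at t within S)"
    using False by (auto intro!: derivative_eq_intros simp: powr_diff field_simps)
  moreover have "norm (f t) powr (p - 1) = norm (f t) powr (p - 2) * norm (f t)"
    using False by (simp add: powr_diff field_simps powr_numeral power2_eq_square)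
  ultimately show ?thesis
    using False by (simp add: sgn_div_norm field_simps)
next
  case True
  have q: "((\<lambda>s. (f s - f t) /\<^sub>R (s - t)) \<longlongrightarrow> f') (at t within S)"
  proof -
    have "((\<lambda>s. (f s - f t - (s - t) *\<^sub>R f') /\<^sub>R norm (s - t)) \<longlongrightarrow> 0) (at t within S)"
      using f by (simp add: has_vector_derivative_def has_derivative_within divide_inverse algebra_simps)
    then have "((\<lambda>s. norm ((f s - f t) /\<^sub>R (s - t) - f')) \<longlongrightarrow> 0) (at t within S)"
    proof (rule Lim_transform_eventually[OF tendsto_norm_zero])
      have "norm ((f s - f t - (s - t) *\<^sub>R f') /\<^sub>R norm (s - t)) = norm ((f s - f t) /\<^sub>R (s - t) - f')"
        if "s \<noteq> t" for s
      proof -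
        have "(f s - f t) /\<^sub>R (s - t) - f' = (f s - f t - (s - t) *\<^sub>R f') /\<^sub>R (s - t)"
          using that by (simp add: scaleR_diff_right)
        then show ?thesis by simp
      qed
      then show "\<forall>\<^sub>F s in at t within S. norm ((f s - f t - (s - t) *\<^sub>R f') /\<^sub>R norm (s - t))
          = norm ((f s - f t) /\<^sub>R (s - t) - f')"
        by (auto simp: eventually_at intro!: exI[of _ 1])
    qed
    then show ?thesis
      using Lim_null tendsto_norm_zero_iff by blast
  qed
  have "continuous (at t within S) f"
    using f has_vector_derivative_continuous by blast
  then have "((\<lambda>s. norm (f s)) \<longlongrightarrow> 0) (at t within S)"
    using True by (simp add: continuous_within tendsto_norm_zero)
  then have "((\<lambda>s. norm (f s) powr (p - 1)) \<longlongrightarrow> 0 powr (p - 1)) (at t within S)"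
    using p by (intro tendsto_powr') auto
  then have "((\<lambda>s. norm (f s) powr (p - 1) * norm ((f s - f t) /\<^sub>R (s - t))) \<longlongrightarrow> 0 * norm f')
      (at t within S)"
    using q by (intro tendsto_mult tendsto_norm) (auto)
  moreover have "(\<lambda>s. norm (f s) powr (p - 1) * norm ((f s - f t) /\<^sub>R (s - t))) =
      (\<lambda>s. \<bar>(norm (f s) powr p - norm (f t) powr p) / (s - t)\<bar>)"
  proof
    show "norm (f s) powr (p - 1) * norm ((f s - f t) /\<^sub>R (s - t))
        = \<bar>(norm (f s) powr p - norm (f t) powr p) / (s - t)\<bar>" for s
      using True by (cases "f s = 0") (auto simp: powr_diff abs_mult divide_inverse)
  qed
  ultimately have "((\<lambda>s. \<bar>(norm (f s) powr p - norm (f t) powr p) / (s - t)\<bar>) \<longlongrightarrow> 0) (at t within S)"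
    by simp
  then have "((\<lambda>s. (norm (f s) powr p - norm (f t) powr p) / (s - t)) \<longlongrightarrow> 0) (at t within S)"
    using tendsto_rabs_zero_iff by blast
  then show ?thesis
    using True by (simp add: has_field_derivative_iff)
qed

lemma integral_Cauchy_Schwarz:
  fixes f g :: "real \<Rightarrow> real"
  assumes f: "continuous_on {a..b} f" and g: "continuous_on {a..b} g"
  shows "integral {a..b} (\<lambda>t. f t * g t) \<le>
    sqrt (integral {a..b} (\<lambda>t. (f t)\<^sup>2)) * sqrt (integral {a..b} (\<lambda>t. (g t)\<^sup>2))"
proof -
  define F G P where "F = integral {a..b} (\<lambda>t. (f t)\<^sup>2)" and "G = integral {a..b} (\<lambda>t. (g t)\<^sup>2)"
    and "P = integral {a..b} (\<lambda>t. f t * g t)"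
  have i: "(\<lambda>t. (f t)\<^sup>2) integrable_on {a..b}" "(\<lambda>t. (g t)\<^sup>2) integrable_on {a..b}"
    "(\<lambda>t. f t * g t) integrable_on {a..b}"
    by (intro integrable_continuous_real continuous_intros f g)+
  have quad: "0 \<le> F - 2 * c * P + c\<^sup>2 * G" for c
  proof -
    have "((\<lambda>t. (f t)\<^sup>2 - 2 * c * (f t * g t) + c\<^sup>2 * (g t)\<^sup>2) has_integral
        F - 2 * c * P + c\<^sup>2 * G) {a..b}"
      unfolding F_def G_def P_def
      by (intro has_integral_add has_integral_diff has_integral_mult_right integrable_integral i)
    then have h: "((\<lambda>t. (f t - c * g t)\<^sup>2) has_integral F - 2 * c * P + c\<^sup>2 * G) {a..b}"
      by (simp add: power2_eq_square algebra_simps)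
    show ?thesis
      by (rule has_integral_nonneg[OF h]) simp
  qed
  have G0: "G \<ge> 0"
    unfolding G_def by (intro integral_nonneg i) auto
  have F0: "F \<ge> 0"
    unfolding F_def by (intro integral_nonneg i) auto
  have "P\<^sup>2 \<le> F * G"
  proof (cases "G = 0")
    case True
    have "P = 0"
    proof (rule ccontr)
      assume "P \<noteq> 0"
      then show False
        using quad[of "(F + 1) / (2 * P)"] True F0 by (simp add: field_simps)
    qed
    then show ?thesis using True by simp
  next
    case False
    then show ?thesis
      using quad[of "P / G"] G0 by (simp add: field_simps power2_eq_square)
  qed
  then have "P \<le> sqrt (F * G)"
    by (rule real_le_rsqrt)
  then show ?thesis
    by (simp add: F_def G_def P_def real_sqrt_mult)
qed

text \<open>The end point \<open>a\<close> carries the Hardy weight, while \<open>u\<close> need not vanish at the other end \<open>m\<close>;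
  this is what makes the two halves of an interval independent of each other. With
  \<open>\<rho> t = t - a\<close> and \<open>z = u' - u / (2 \<rho>)\<close>, which is \<open>\<surd>\<rho>\<close> times the derivative of \<open>u / \<surd>\<rho>\<close>, the
  energy splits as \<open>h = \<integral> |z|\<^sup>2 + |u m|\<^sup>2 / (2 (m - a))\<close>. For \<open>r \<ge> t\<close> the weight
  \<open>\<rho> r powr (- s / 2)\<close> is largest at \<open>t\<close>, so integrating the derivative of
  \<open>|u|\<^sup>s \<rho> powr (- s / 2)\<close> from \<open>t\<close> to \<open>m\<close> and multiplying by
  \<open>\<rho> t powr (s / 2)\<close> costs at most \<open>s \<integral> |u|\<^sup>s\<^sup>-\<^sup>1 |z|\<close>.
  The value at \<open>m\<close> is controlled separately through \<open>\<rho> |u|\<^sup>s\<close>, whose derivative has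
  no factor \<open>1 / \<rho>\<close>, and an \<open>L\<^sup>2\<close> bound on \<open>u\<close>.\<close>

lemma half_interval_hardy_sobolev:
  fixes u u' :: "real \<Rightarrow> 'a::real_inner"
  assumes s: "s \<ge> 2" and a: "a < \<alpha>" "\<alpha> \<le> m"
    and u: "\<And>t. t \<in> {\<alpha>..m} \<Longrightarrow> (u has_vector_derivative u' t) (at t within {\<alpha>..m})"
    and u': "continuous_on {\<alpha>..m} u'" and ua: "u \<alpha> = 0"
  defines "h \<equiv> integral {\<alpha>..m} (\<lambda>t. (norm (u' t))\<^sup>2 - (norm (u t))\<^sup>2 / (4 * (t - a)\<^sup>2))"
    and "Q \<equiv> integral {\<alpha>..m} (\<lambda>t. norm (u t) powr (2 * s - 2))"
  shows "h \<ge> 0" and "t \<in> {\<alpha>..m} \<Longrightarrow> norm (u t) powr s \<le> (3 * s + 2) * (sqrt h * sqrt Q)"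
proof -
  let ?I = "{\<alpha>..m}"
  define \<rho> where "\<rho> t = t - a" for t
  define L where "L = m - a"
  define z where "z t = u' t - (1 / (2 * \<rho> t)) *\<^sub>R u t" for t
  define Z where "Z = integral ?I (\<lambda>t. (norm (z t))\<^sup>2)"
  have rho: "\<rho> t > 0" "\<rho> t \<le> L" if "t \<in> ?I" for t
    using that a by (auto simp: \<rho>_def L_def)
  have L: "L > 0" using a by (simp add: L_def)
  have uc: "continuous_on ?I u"
    using u continuous_on_vector_derivative by blast
  have rc: "continuous_on ?I \<rho>"
    unfolding \<rho>_def by (intro continuous_intros)
  have r0: "\<rho> t \<noteq> 0" if "t \<in> ?I" for t using rho[OF that] by simp
  have zc: "continuous_on ?I z"
    unfolding z_def using r0 by (intro continuous_intros uc u' rc) auto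
  have upc: "continuous_on ?I (\<lambda>t. norm (u t) powr p)" if "p > 0" for p
    using that by (intro continuous_on_powr' continuous_intros uc) auto
  note ci = uc u' rc zc upc
  have u'_eq: "u' t = z t + (1 / (2 * \<rho> t)) *\<^sub>R u t" for t
    by (simp add: z_def)
  have du: "((\<lambda>t. (norm (u t))\<^sup>2) has_real_derivative 2 * (u t \<bullet> u' t)) (at t within ?I)"
    if "t \<in> ?I" for t
  proof -
    have "((\<lambda>t. u t \<bullet> u t) has_derivative (\<lambda>h. u t \<bullet> (h *\<^sub>R u' t) + (h *\<^sub>R u' t) \<bullet> u t)) (at t within ?I)"
      using u[OF that] unfolding has_vector_derivative_def by (intro has_derivative_inner)
    then show ?thesis
      by (simp add: has_field_derivative_def power2_norm_eq_inner inner_commute mult_commute_abs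
          algebra_simps)
  qed
  have dus: "((\<lambda>t. norm (u t) powr s) has_real_derivative
      s * norm (u t) powr (s - 2) * (u t \<bullet> u' t)) (at t within ?I)" if "t \<in> ?I" for t
    using u[OF that] s by (intro norm_powr_has_real_derivative) auto
  have drho: "(\<rho> has_real_derivative 1) (at t within ?I)" for t
    unfolding \<rho>_def by (auto intro!: derivative_eq_intros)
  have Z0: "Z \<ge> 0"
    unfolding Z_def by (intro integral_nonneg integrable_continuous_real continuous_intros ci) auto
  have Q0: "Q \<ge> 0"
    unfolding Q_def using s by (intro integral_nonneg integrable_continuous_real continuous_intros ci) auto
  \<comment> \<open>Completing the square: the energy density exceeds \<open>|z|\<^sup>2\<close> by the derivative of
    \<open>|u|\<^sup>2 / (2 \<rho>)\<close>, which contributes only at \<open>m\<close>.\<close>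
  have hZ: "h = Z + (norm (u m))\<^sup>2 / (2 * L)"
  proof -
    have "((\<lambda>t. 2 * (u t \<bullet> u' t) / (2 * \<rho> t) - (norm (u t))\<^sup>2 / (2 * (\<rho> t)\<^sup>2)) has_integral
       (norm (u m))\<^sup>2 / (2 * \<rho> m) - (norm (u \<alpha>))\<^sup>2 / (2 * \<rho> \<alpha>)) ?I"
    proof (rule fundamental_theorem_of_calculus[OF a(2)])
      fix t assume t: "t \<in> ?I"
      show "((\<lambda>t. (norm (u t))\<^sup>2 / (2 * \<rho> t)) has_vector_derivative
          2 * (u t \<bullet> u' t) / (2 * \<rho> t) - (norm (u t))\<^sup>2 / (2 * (\<rho> t)\<^sup>2)) (at t within ?I)"
        unfolding has_real_derivative_iff_has_vector_derivative[symmetric]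
        using r0[OF t]
        by - (rule derivative_eq_intros du drho t refl | simp add: field_simps power2_eq_square)+
    qed
    then have "((\<lambda>t. (norm (z t))\<^sup>2 + (2 * (u t \<bullet> u' t) / (2 * \<rho> t) - (norm (u t))\<^sup>2 / (2 * (\<rho> t)\<^sup>2)))
        has_integral Z + ((norm (u m))\<^sup>2 / (2 * \<rho> m) - (norm (u \<alpha>))\<^sup>2 / (2 * \<rho> \<alpha>))) ?I"
      unfolding Z_def
      by (intro has_integral_add integrable_integral integrable_continuous_real continuous_intros ci)
    then have "((\<lambda>t. (norm (u' t))\<^sup>2 - (norm (u t))\<^sup>2 / (4 * (t - a)\<^sup>2))
        has_integral Z + ((norm (u m))\<^sup>2 / (2 * \<rho> m) - (norm (u \<alpha>))\<^sup>2 / (2 * \<rho> \<alpha>))) ?I"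
    proof (rule has_integral_eq[rotated])
      fix t assume t: "t \<in> ?I"
      have zz: "(norm (z t))\<^sup>2 = (norm (u' t))\<^sup>2 - (u t \<bullet> u' t) / \<rho> t + (norm (u t))\<^sup>2 / (4 * (\<rho> t)\<^sup>2)"
        using r0[OF t] unfolding z_def power2_norm_eq_inner
        by (simp add: inner_diff_left inner_diff_right inner_commute field_simps power2_eq_square)
      show "(norm (z t))\<^sup>2 + (2 * (u t \<bullet> u' t) / (2 * \<rho> t) - (norm (u t))\<^sup>2 / (2 * (\<rho> t)\<^sup>2))
          = (norm (u' t))\<^sup>2 - (norm (u t))\<^sup>2 / (4 * (t - a)\<^sup>2)"
        unfolding \<rho>_def[symmetric] zz using r0[OF t] by (simp add: field_simps power2_eq_square)
    qed
    then show ?thesis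
      unfolding h_def using ua by (simp add: integral_unique \<rho>_def L_def)
  qed
  show h0: "h \<ge> 0"
    using hZ Z0 L by simp
  have Zh: "Z \<le> h" and mh: "(norm (u m))\<^sup>2 \<le> 2 * L * (h - Z)"
    using hZ L by simp_all
  \<comment> \<open>The derivative of \<open>\<rho> |u|\<^sup>2\<close> is \<open>2 |u|\<^sup>2\<close> plus a term that is absorbed by one copy of
    \<open>|u|\<^sup>2\<close> and by \<open>L\<^sup>2 |z|\<^sup>2\<close>; the boundary value is part of \<open>h\<close>.\<close>
  define U where "U = integral ?I (\<lambda>t. (norm (u t))\<^sup>2)"
  have U0: "U \<ge> 0"
    unfolding U_def by (intro integral_nonneg integrable_continuous_real continuous_intros ci) auto
  have U: "U \<le> 2 * L\<^sup>2 * h"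
  proof -
    have "((\<lambda>t. 2 * (norm (u t))\<^sup>2 + 2 * \<rho> t * (u t \<bullet> z t)) has_integral
       \<rho> m * (norm (u m))\<^sup>2 - \<rho> \<alpha> * (norm (u \<alpha>))\<^sup>2) ?I"
    proof (rule fundamental_theorem_of_calculus[OF a(2)])
      fix t assume t: "t \<in> ?I"
      have "((\<lambda>t. \<rho> t * (norm (u t))\<^sup>2) has_real_derivative
          (norm (u t))\<^sup>2 + \<rho> t * (2 * (u t \<bullet> u' t))) (at t within ?I)"
        by (rule derivative_eq_intros du drho t refl | simp)+
      moreover have "(norm (u t))\<^sup>2 + \<rho> t * (2 * (u t \<bullet> u' t)) =
          2 * (norm (u t))\<^sup>2 + 2 * \<rho> t * (u t \<bullet> z t)"
        using r0[OF t] by (simp add: z_def inner_diff_right power2_norm_eq_inner field_simps)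
      ultimately show "((\<lambda>t. \<rho> t * (norm (u t))\<^sup>2) has_vector_derivative
          2 * (norm (u t))\<^sup>2 + 2 * \<rho> t * (u t \<bullet> z t)) (at t within ?I)"
        by (simp add: has_real_derivative_iff_has_vector_derivative)
    qed
    then have *: "((\<lambda>t. 2 * (norm (u t))\<^sup>2 + 2 * \<rho> t * (u t \<bullet> z t)) has_integral L * (norm (u m))\<^sup>2) ?I"
      using ua by (simp add: \<rho>_def L_def)
    have **: "((\<lambda>t. (norm (u t))\<^sup>2 - L\<^sup>2 * (norm (z t))\<^sup>2) has_integral U - L\<^sup>2 * Z) ?I"
      unfolding U_def Z_def
      by (intro has_integral_diff has_integral_mult_right integrable_integral
          integrable_continuous_real continuous_intros ci)
    have "U - L\<^sup>2 * Z \<le> L * (norm (u m))\<^sup>2"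
    proof (rule has_integral_le[OF ** *])
      fix t assume t: "t \<in> ?I"
      have "- (u t \<bullet> z t) \<le> norm (u t) * norm (z t)"
        using Cauchy_Schwarz_ineq2[of "u t" "z t"] by linarith
      then have "\<rho> t * - (u t \<bullet> z t) \<le> L * (norm (u t) * norm (z t))"
        using rho[OF t] L by (intro order_trans[OF mult_left_mono[of _ _ "\<rho> t"] mult_right_mono]) auto
      moreover have "0 \<le> (norm (u t) - L * norm (z t))\<^sup>2" by simp
      ultimately show "(norm (u t))\<^sup>2 - L\<^sup>2 * (norm (z t))\<^sup>2 \<le> 2 * (norm (u t))\<^sup>2 + 2 * \<rho> t * (u t \<bullet> z t)"
        by (simp add: power2_eq_square algebra_simps)
    qed
    also have "\<dots> \<le> L * (2 * L * (h - Z))"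
      using mh L by (intro mult_left_mono) auto
    finally have "U \<le> 2 * L\<^sup>2 * h - L\<^sup>2 * Z"
      by (simp add: power2_eq_square algebra_simps)
    moreover have "L\<^sup>2 * Z \<ge> 0" using Z0 by simp
    ultimately show ?thesis by linarith
  qed
  have Qeq: "integral ?I (\<lambda>t. (norm (u t) powr (s - 1))\<^sup>2) = Q"
  proof -
    have "(norm (u t) powr (s - 1))\<^sup>2 = norm (u t) powr (2 * s - 2)" for t
      by (cases "u t = 0") (simp_all add: power2_eq_square powr_add[symmetric])
    then show ?thesis by (simp add: Q_def)
  qed
  have CS1: "integral ?I (\<lambda>t. norm (u t) powr (s - 1) * norm (z t)) \<le> sqrt Q * sqrt Z"
    unfolding Qeq[symmetric] Z_def using s
    by (intro integral_Cauchy_Schwarz continuous_intros ci) auto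
  have CS2: "integral ?I (\<lambda>t. norm (u t) powr s) \<le> sqrt Q * sqrt U"
  proof -
    have "norm (u t) powr (s - 1) * norm (u t) = norm (u t) powr s" for t
      by (cases "u t = 0") (auto simp: powr_diff)
    moreover have "integral ?I (\<lambda>t. norm (u t) powr (s - 1) * norm (u t)) \<le> sqrt Q * sqrt U"
      unfolding Qeq[symmetric] U_def using s
      by (intro integral_Cauchy_Schwarz continuous_intros ci) auto
    ultimately show ?thesis by simp
  qed
  have inner_bd: "\<bar>norm (u t) powr (s - 2) * (u t \<bullet> z t)\<bar> \<le> norm (u t) powr (s - 1) * norm (z t)" for t
  proof (cases "u t = 0")
    case False
    have "\<bar>norm (u t) powr (s - 2) * (u t \<bullet> z t)\<bar> \<le> norm (u t) powr (s - 2) * (norm (u t) * norm (z t))"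
      using Cauchy_Schwarz_ineq2[of "u t" "z t"] by (simp add: abs_mult mult_left_mono)
    also have "norm (u t) powr (s - 2) * (norm (u t) * norm (z t)) = norm (u t) powr (s - 1) * norm (z t)"
      using False by (simp add: powr_diff field_simps power2_eq_square)
    finally show ?thesis .
  qed simp
  \<comment> \<open>The factor \<open>\<rho>\<close> cancels the \<open>1 / \<rho>\<close> in \<open>u' = z + u / (2 \<rho>)\<close>. The remaining term
    \<open>(1 + s / 2) |u|\<^sup>s\<close> is bounded by Cauchy--Schwarz and the \<open>L\<^sup>2\<close> bound, which brings a factor \<open>L\<close>
    that matches \<open>\<rho> m = L\<close> on the left.\<close>
  have um: "norm (u m) powr s \<le> (2 * s + 2) * (sqrt h * sqrt Q)"
  proof -
    have uu: "norm (u t) powr (s - 2) * (norm (u t))\<^sup>2 = norm (u t) powr s" for t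
      by (cases "u t = 0") (auto simp: powr_diff)
    have *: "((\<lambda>t. (1 + s / 2) * norm (u t) powr s + s * \<rho> t * (norm (u t) powr (s - 2) * (u t \<bullet> z t)))
        has_integral \<rho> m * norm (u m) powr s - \<rho> \<alpha> * norm (u \<alpha>) powr s) ?I"
    proof (rule fundamental_theorem_of_calculus[OF a(2)])
      fix t assume t: "t \<in> ?I"
      have "((\<lambda>t. \<rho> t * norm (u t) powr s) has_real_derivative
          norm (u t) powr s + \<rho> t * (s * norm (u t) powr (s - 2) * (u t \<bullet> u' t))) (at t within ?I)"
        by (rule derivative_eq_intros dus drho t refl | simp)+
      moreover have "norm (u t) powr s + \<rho> t * (s * norm (u t) powr (s - 2) * (u t \<bullet> u' t)) =
          norm (u t) powr s + s / 2 * (norm (u t) powr (s - 2) * (norm (u t))\<^sup>2)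
          + s * \<rho> t * (norm (u t) powr (s - 2) * (u t \<bullet> z t))"
        using r0[OF t] by (simp add: u'_eq inner_add_right power2_norm_eq_inner field_simps)
      ultimately show "((\<lambda>t. \<rho> t * norm (u t) powr s) has_vector_derivative
          (1 + s / 2) * norm (u t) powr s + s * \<rho> t * (norm (u t) powr (s - 2) * (u t \<bullet> z t)))
          (at t within ?I)"
        unfolding uu by (simp add: has_real_derivative_iff_has_vector_derivative algebra_simps)
    qed
    have **: "((\<lambda>t. (1 + s / 2) * norm (u t) powr s + s * L * (norm (u t) powr (s - 1) * norm (z t)))
        has_integral (1 + s / 2) * integral ?I (\<lambda>t. norm (u t) powr s)
          + s * L * integral ?I (\<lambda>t. norm (u t) powr (s - 1) * norm (z t))) ?I"
      using s by (intro has_integral_add has_integral_mult_right integrable_integral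
          integrable_continuous_real continuous_intros ci) auto
    have "L * norm (u m) powr s \<le> (1 + s / 2) * integral ?I (\<lambda>t. norm (u t) powr s)
          + s * L * integral ?I (\<lambda>t. norm (u t) powr (s - 1) * norm (z t))"
    proof -
      have "\<rho> m * norm (u m) powr s - \<rho> \<alpha> * norm (u \<alpha>) powr s = L * norm (u m) powr s"
        using ua by (simp add: \<rho>_def L_def)
      moreover have "\<rho> m * norm (u m) powr s - \<rho> \<alpha> * norm (u \<alpha>) powr s \<le>
         (1 + s / 2) * integral ?I (\<lambda>t. norm (u t) powr s)
          + s * L * integral ?I (\<lambda>t. norm (u t) powr (s - 1) * norm (z t))"
      proof (rule has_integral_le[OF * **])
        fix t assume t: "t \<in> ?I"
        have "norm (u t) powr (s - 2) * (u t \<bullet> z t) \<le> norm (u t) powr (s - 1) * norm (z t)"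
          using inner_bd[of t] by linarith
        then have "s * \<rho> t * (norm (u t) powr (s - 2) * (u t \<bullet> z t)) \<le>
            s * L * (norm (u t) powr (s - 1) * norm (z t))"
          using rho[OF t] s
          by (intro order_trans[OF mult_left_mono[of _ _ "s * \<rho> t"] mult_right_mono]) auto
        then show "(1 + s / 2) * norm (u t) powr s + s * \<rho> t * (norm (u t) powr (s - 2) * (u t \<bullet> z t))
          \<le> (1 + s / 2) * norm (u t) powr s + s * L * (norm (u t) powr (s - 1) * norm (z t))"
          by simp
      qed
      ultimately show ?thesis by simp
    qed
    also have "\<dots> \<le> (1 + s / 2) * (sqrt Q * (2 * L * sqrt h)) + s * L * (sqrt Q * sqrt h)"
    proof (intro add_mono mult_left_mono)
      have "sqrt U \<le> sqrt ((2 * L)\<^sup>2 * h)"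
        using U h0 L by (intro real_sqrt_le_mono) (auto intro: order_trans simp: power2_eq_square)
      also have "\<dots> = 2 * L * sqrt h"
        using L by (simp add: real_sqrt_mult)
      finally show "integral ?I (\<lambda>t. norm (u t) powr s) \<le> sqrt Q * (2 * L * sqrt h)"
        using CS2 Q0 by (meson mult_left_mono order_trans real_sqrt_ge_zero)
      show "integral ?I (\<lambda>t. norm (u t) powr (s - 1) * norm (z t)) \<le> sqrt Q * sqrt h"
        using CS1 Q0 Zh by (meson mult_left_mono order_trans real_sqrt_ge_zero real_sqrt_le_mono)
    qed (use s L in auto)
    finally have "L * norm (u m) powr s \<le> L * ((2 * s + 2) * (sqrt h * sqrt Q))"
      by (simp add: algebra_simps)
    then show ?thesis using L by simp
  qed
  \<comment> \<open>Transport of the bound from \<open>m\<close> to \<open>t\<close> by the function \<open>|u|\<^sup>s \<rho> powr (- s / 2)\<close>, whose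
    derivative is a multiple of \<open>u \<bullet> z\<close>.\<close>
  show "norm (u t) powr s \<le> (3 * s + 2) * (sqrt h * sqrt Q)" if t: "t \<in> ?I"
  proof -
    define \<phi> where "\<phi> r = norm (u r) powr s * \<rho> r powr (- s / 2)" for r
    have tm: "t \<le> m" using t by simp
    have sub: "{t..m} \<subseteq> ?I" using t by auto
    have *: "((\<lambda>r. s * \<rho> r powr (- s / 2) * (norm (u r) powr (s - 2) * (u r \<bullet> z r))) has_integral
        \<phi> m - \<phi> t) {t..m}"
    proof (rule fundamental_theorem_of_calculus[OF tm])
      fix r assume r: "r \<in> {t..m}"
      then have r': "r \<in> ?I" using sub by auto
      have d: "((\<lambda>r. \<rho> r powr (- s / 2)) has_real_derivative - s / 2 * \<rho> r powr (- s / 2 - 1)) (at r within ?I)"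
        using rho[OF r'] by (auto intro!: derivative_eq_intros drho simp: powr_diff field_simps)
      have rr: "\<rho> r powr (- s / 2 - 1) = \<rho> r powr (- s / 2) / \<rho> r"
        using rho[OF r'] by (simp add: powr_diff)
      have uu: "norm (u r) powr s = norm (u r) powr (s - 2) * (u r \<bullet> u r)"
        by (cases "u r = 0") (auto simp: powr_diff power2_norm_eq_inner[symmetric])
      have "(\<phi> has_real_derivative
          s * norm (u r) powr (s - 2) * (u r \<bullet> u' r) * \<rho> r powr (- s / 2)
          + norm (u r) powr s * (- s / 2 * \<rho> r powr (- s / 2 - 1))) (at r within ?I)"
        unfolding \<phi>_def by (rule derivative_eq_intros dus d r' refl)+ (simp add: algebra_simps)
      moreover have "s * norm (u r) powr (s - 2) * (u r \<bullet> u' r) * \<rho> r powr (- s / 2)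
          + norm (u r) powr s * (- s / 2 * \<rho> r powr (- s / 2 - 1)) =
          s * \<rho> r powr (- s / 2) * (norm (u r) powr (s - 2) * (u r \<bullet> z r))"
        unfolding rr uu z_def using r0[OF r'] by (simp add: inner_diff_right algebra_simps)
      ultimately have "(\<phi> has_real_derivative
          s * \<rho> r powr (- s / 2) * (norm (u r) powr (s - 2) * (u r \<bullet> z r))) (at r within ?I)" by simp
      then show "(\<phi> has_vector_derivative
          s * \<rho> r powr (- s / 2) * (norm (u r) powr (s - 2) * (u r \<bullet> z r))) (at r within {t..m})"
        using has_vector_derivative_within_subset[OF _ sub] has_real_derivative_iff_has_vector_derivative
        by blast
    qed
    have gi: "(\<lambda>t. norm (u t) powr (s - 1) * norm (z t)) integrable_on ?I"
      using s by (intro integrable_continuous_real continuous_intros ci) auto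
    have gi': "(\<lambda>t. norm (u t) powr (s - 1) * norm (z t)) integrable_on {t..m}"
      using integrable_subinterval_real[OF gi sub] .
    have **: "((\<lambda>r. - (s * \<rho> t powr (- s / 2) * (norm (u r) powr (s - 1) * norm (z r)))) has_integral
        - (s * \<rho> t powr (- s / 2) * integral {t..m} (\<lambda>t. norm (u t) powr (s - 1) * norm (z t)))) {t..m}"
      by (intro has_integral_neg has_integral_mult_right integrable_integral gi')
    have "- (s * \<rho> t powr (- s / 2) * integral {t..m} (\<lambda>t. norm (u t) powr (s - 1) * norm (z t)))
        \<le> \<phi> m - \<phi> t"
    proof (rule has_integral_le[OF ** *])
      fix r assume r: "r \<in> {t..m}"
      have "\<rho> r powr (- s / 2) \<le> \<rho> t powr (- s / 2)"
        using rho[OF t] r s by (intro powr_mono2') (auto simp: \<rho>_def)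
      then have "s * \<rho> r powr (- s / 2) * - (norm (u r) powr (s - 2) * (u r \<bullet> z r)) \<le>
         s * \<rho> t powr (- s / 2) * (norm (u r) powr (s - 1) * norm (z r))"
        using inner_bd[of r] s
        by (intro order_trans[OF mult_left_mono mult_right_mono]) auto
      then show "- (s * \<rho> t powr (- s / 2) * (norm (u r) powr (s - 1) * norm (z r))) \<le>
          s * \<rho> r powr (- s / 2) * (norm (u r) powr (s - 2) * (u r \<bullet> z r))"
        by simp
    qed
    moreover have "integral {t..m} (\<lambda>t. norm (u t) powr (s - 1) * norm (z t)) \<le> sqrt Q * sqrt h"
    proof -
      have "integral {t..m} (\<lambda>t. norm (u t) powr (s - 1) * norm (z t)) \<le>
          integral ?I (\<lambda>t. norm (u t) powr (s - 1) * norm (z t))"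
        by (intro integral_subset_le sub gi gi') auto
      then show ?thesis
        using CS1 Q0 Zh by (meson mult_left_mono order_trans real_sqrt_ge_zero real_sqrt_le_mono)
    qed
    then have "s * \<rho> t powr (- s / 2) * integral {t..m} (\<lambda>t. norm (u t) powr (s - 1) * norm (z t))
        \<le> s * \<rho> t powr (- s / 2) * (sqrt Q * sqrt h)"
      using s by (intro mult_left_mono) auto
    ultimately have "\<phi> t \<le> \<phi> m + s * \<rho> t powr (- s / 2) * (sqrt Q * sqrt h)"
      by linarith
    then have "\<rho> t powr (s / 2) * \<phi> t \<le>
        \<rho> t powr (s / 2) * (\<phi> m + s * \<rho> t powr (- s / 2) * (sqrt Q * sqrt h))"
      by (intro mult_left_mono) auto
    moreover have "\<rho> t powr (s / 2) * \<phi> t = norm (u t) powr s"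
      using rho[OF t] by (simp add: \<phi>_def powr_minus field_simps)
    moreover have "\<rho> t powr (s / 2) * (\<phi> m + s * \<rho> t powr (- s / 2) * (sqrt Q * sqrt h)) =
        \<rho> t powr (s / 2) * \<phi> m + s * (sqrt Q * sqrt h)"
      using rho[OF t] by (simp add: powr_minus field_simps)
    moreover have "\<rho> t powr (s / 2) * \<phi> m \<le> norm (u m) powr s"
    proof -
      have "\<rho> t powr (s / 2) * \<phi> m \<le> L powr (s / 2) * \<phi> m"
        using rho[OF t] s by (intro mult_right_mono powr_mono2) (auto simp: \<phi>_def)
      also have "\<dots> = norm (u m) powr s"
        using L by (simp add: \<phi>_def \<rho>_def L_def[symmetric] powr_minus field_simps)
      finally show ?thesis .
    qed
    ultimately have "norm (u t) powr s \<le> norm (u m) powr s + s * (sqrt Q * sqrt h)"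
      by linarith
    also have "\<dots> \<le> (2 * s + 2) * (sqrt h * sqrt Q) + s * (sqrt h * sqrt Q)"
      using um by (simp add: mult.commute)
    also have "\<dots> = (3 * s + 2) * (sqrt h * sqrt Q)"
      by (simp add: algebra_simps)
    finally show ?thesis .
  qed
qed

text \<open>On \<open>(a, b)\<close> the distance to the boundary is \<open>t - a\<close> up to the midpoint and \<open>b - t\<close> after it,
  so the two halves are instances of the previous lemma, the second one after reflection. The
  density \<open>G\<close> is an arbitrary integrable majorant because directional weights need not be
  continuous.\<close>
lemma interval_hardy_sobolev:
  fixes u u' :: "real \<Rightarrow> 'a::real_inner" and a b \<alpha> \<beta> :: real
  defines "m \<equiv> (a + b) / 2"
  assumes s: "s \<ge> 2" and ab: "a < \<alpha>" "\<alpha> \<le> m" "m \<le> \<beta>" "\<beta> < b"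
    and u: "\<And>t. (u has_vector_derivative u' t) (at t)"
    and u': "continuous_on UNIV u'" and u0: "u \<alpha> = 0" "u \<beta> = 0"
    and G: "G integrable_on {\<alpha>..\<beta>}"
    and Gl: "\<And>t. t \<in> {\<alpha>..m} \<Longrightarrow> (norm (u' t))\<^sup>2 - (norm (u t))\<^sup>2 / (4 * (t - a)\<^sup>2) \<le> G t"
    and Gr: "\<And>t. t \<in> {m..\<beta>} \<Longrightarrow> (norm (u' t))\<^sup>2 - (norm (u t))\<^sup>2 / (4 * (b - t)\<^sup>2) \<le> G t"
  defines "e \<equiv> integral {\<alpha>..\<beta>} G" and "Q \<equiv> integral {\<alpha>..\<beta>} (\<lambda>t. norm (u t) powr (2 * s - 2))"
  shows "e \<ge> 0" and "t \<in> {\<alpha>..\<beta>} \<Longrightarrow> norm (u t) powr s \<le> (3 * s + 2) * (sqrt e * sqrt Q)"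
proof -
  have uc: "continuous_on S u" for S
    using u by (meson continuous_at_imp_continuous_on has_vector_derivative_continuous)
  have uc': "continuous_on S u'" for S
    using u' continuous_on_subset by blast
  have Qi: "(\<lambda>t. norm (u t) powr (2 * s - 2)) integrable_on {c..d}" for c d
    using s by (intro integrable_continuous_real continuous_on_powr' continuous_intros uc) auto
  define hl where "hl = integral {\<alpha>..m} (\<lambda>t. (norm (u' t))\<^sup>2 - (norm (u t))\<^sup>2 / (4 * (t - a)\<^sup>2))"
  define hr where "hr = integral {m..\<beta>} (\<lambda>t. (norm (u' t))\<^sup>2 - (norm (u t))\<^sup>2 / (4 * (b - t)\<^sup>2))"
  have left: "hl \<ge> 0" "t \<in> {\<alpha>..m} \<Longrightarrow> norm (u t) powr s \<le>
      (3 * s + 2) * (sqrt hl * sqrt (integral {\<alpha>..m} (\<lambda>t. norm (u t) powr (2 * s - 2))))" for t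
    unfolding hl_def
    using half_interval_hardy_sobolev[OF s ab(1,2) has_vector_derivative_at_within[OF u] uc' u0(1)]
    by blast+
  have r1: "-b < -\<beta>" "-\<beta> \<le> -m" using ab by auto
  have r2: "((\<lambda>t. u (- t)) has_vector_derivative - u' (- t)) (at t within S)" for t S
  proof -
    have "((\<lambda>t. u (- t)) has_vector_derivative (-1) *\<^sub>R u' (- t)) (at t)"
    proof -
      have "((\<lambda>t::real. - t) has_vector_derivative - 1) (at t)"
        unfolding has_real_derivative_iff_has_vector_derivative[symmetric]
        by (auto intro!: derivative_eq_intros)
      from vector_diff_chain_at[OF this u] show ?thesis by (simp add: o_def)
    qed
    then show ?thesis by (simp add: has_vector_derivative_at_within)
  qed
  have r3: "continuous_on S (\<lambda>t. - u' (- t))" for S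
    by (intro continuous_intros continuous_on_compose2[OF u']) auto
  have hr_eq: "integral {-\<beta>..-m} (\<lambda>t. (norm (- u' (- t)))\<^sup>2 - (norm (u (- t)))\<^sup>2 / (4 * (t - (- b))\<^sup>2)) = hr"
    unfolding hr_def
    using Henstock_Kurzweil_Integration.integral_reflect_real[of \<beta> m
        "\<lambda>t. (norm (u' t))\<^sup>2 - (norm (u t))\<^sup>2 / (4 * (b - t)\<^sup>2)"]
    by (simp add: add.commute)
  have qr_eq: "integral {-\<beta>..-m} (\<lambda>t. norm (u (- t)) powr (2 * s - 2)) =
      integral {m..\<beta>} (\<lambda>t. norm (u t) powr (2 * s - 2))"
    using Henstock_Kurzweil_Integration.integral_reflect_real[of \<beta> m
        "\<lambda>t. norm (u t) powr (2 * s - 2)"] by simp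
  note right' = half_interval_hardy_sobolev[where u="\<lambda>t. u (- t)" and u'="\<lambda>t. - u' (- t)",
      OF s r1 r2 r3, unfolded hr_eq qr_eq, simplified, OF u0(2)]
  have right: "hr \<ge> 0" "t \<in> {m..\<beta>} \<Longrightarrow> norm (u t) powr s \<le>
      (3 * s + 2) * (sqrt hr * sqrt (integral {m..\<beta>} (\<lambda>t. norm (u t) powr (2 * s - 2))))" for t
    using right'(1) right'(2)[of "- t"] by auto
  have Gi: "G integrable_on {\<alpha>..m}" "G integrable_on {m..\<beta>}"
    using ab by (auto intro: integrable_subinterval_real[OF G])
  have e: "e = integral {\<alpha>..m} G + integral {m..\<beta>} G"
    unfolding e_def using Henstock_Kurzweil_Integration.integral_combine[OF ab(2,3) G] by simp
  have "hl \<le> integral {\<alpha>..m} G"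
    unfolding hl_def using ab
    by (intro integral_le Gi Gl integrable_continuous_real continuous_intros uc uc') auto
  moreover have "hr \<le> integral {m..\<beta>} G"
    unfolding hr_def using ab
    by (intro integral_le Gi Gr integrable_continuous_real continuous_intros uc uc') auto
  ultimately have he: "hl \<le> e" "hr \<le> e" and e0: "e \<ge> 0"
    using left(1) right(1) e by linarith+
  show "e \<ge> 0" by fact
  have q: "integral {\<alpha>..m} (\<lambda>t. norm (u t) powr (2 * s - 2)) \<le> Q"
    "integral {m..\<beta>} (\<lambda>t. norm (u t) powr (2 * s - 2)) \<le> Q"
    unfolding Q_def using ab by (auto intro!: integral_subset_le Qi)
  have q0: "integral {c..d} (\<lambda>t. norm (u t) powr (2 * s - 2)) \<ge> 0" for c d
    by (intro integral_nonneg Qi) auto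
  have mono: "(3 * s + 2) * (sqrt h * sqrt R) \<le> (3 * s + 2) * (sqrt e * sqrt Q)"
    if "h \<le> e" "R \<le> Q" "0 \<le> h" "0 \<le> R" for h R
    using that s e0 by (intro mult_left_mono mult_mono) auto
  show "norm (u t) powr s \<le> (3 * s + 2) * (sqrt e * sqrt Q)" if "t \<in> {\<alpha>..\<beta>}"
  proof (cases "t \<le> m")
    case True
    then show ?thesis
      using left(2)[of t] that mono[OF he(1) q(1) left(1) q0] by (meson atLeastAtMost_iff order_trans)
  next
    case False
    then show ?thesis
      using right(2)[of t] that mono[OF he(2) q(2) right(1) q0]
      by (meson atLeastAtMost_iff order_trans linear)
  qed
qed

lemma open_real_component:
  fixes U :: "real set"
  assumes U: "open U" "bounded U" and t: "t \<in> U"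
  obtains a b where "a < t" "t < b" "a \<notin> U" "b \<notin> U" "{a<..<b} \<subseteq> U"
proof -
  obtain M where M: "\<And>x. x \<in> U \<Longrightarrow> \<bar>x\<bar> \<le> M"
    using U(2) by (auto simp: bounded_iff)
  define A where "A = {..t} - U"
  define B where "B = {t..} - U"
  have cl: "closed A" "closed B"
    unfolding A_def B_def using U(1) by (auto intro!: closed_Diff)
  have Ane: "- (M + 1) \<in> A"
    using M[of "- (M+1)"] M[OF t] by (auto simp: A_def)
  have Bne: "M + 1 \<in> B"
    using M[of "M+1"] M[OF t] by (auto simp: B_def)
  have bd: "bdd_above A" "bdd_below B"
    by (auto simp: A_def B_def bdd_above_def bdd_below_def)
  define a where "a = Sup A"
  define b where "b = Inf B"
  have aA: "a \<in> A" unfolding a_def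
    using cl(1) bd(1) Ane by (intro closed_contains_Sup) auto
  have bB: "b \<in> B" unfolding b_def
    using cl(2) bd(2) Bne by (intro closed_contains_Inf) auto
  have "x \<in> U" if "a < x" "x < b" for x
  proof (rule ccontr)
    assume "x \<notin> U"
    then have "x \<in> A \<or> x \<in> B" by (auto simp: A_def B_def)
    then show False
      using that cSup_upper[OF _ bd(1), of x] cInf_lower[OF _ bd(2), of x]
      by (auto simp: a_def b_def)
  qed
  moreover have "a < t" "t < b"
    using aA bB t by (auto simp: A_def B_def order_less_le)
  ultimately show ?thesis
    using aA bB by (intro that[of a b]) (auto simp: A_def B_def)
qed

text \<open>The weight is only required to be at most the inverse squared distance to the complement.
  Hence \<open>U\<close> may be cut down to a bounded set around \<open>K\<close>: this decreases the distances, and the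
  hypothesis on \<open>W\<close> becomes weaker. By compactness \<open>K\<close> is then covered by finitely many components,
  which are bounded intervals. The total energy is the sum of their energies, which are
  nonnegative, and therefore bounds the energy of the component that contains \<open>t\<close>.\<close>
lemma open_set_hardy_sobolev:
  fixes u u' :: "real \<Rightarrow> 'a::euclidean_space"
  assumes s: "s \<ge> 2" and U: "open U" and K: "compact K" "K \<subseteq> U"
    and u0: "\<And>t. t \<notin> K \<Longrightarrow> u t = 0"
    and u: "\<And>t. (u has_vector_derivative u' t) (at t)"
    and u': "continuous_on UNIV u'"
    and W: "W \<in> borel_measurable borel" "\<And>t. W t \<ge> 0"
    and W_le: "\<And>t \<delta>. t \<in> K \<Longrightarrow> \<delta> > 0 \<Longrightarrow> ball t \<delta> \<subseteq> U \<Longrightarrow> W t \<le> 1 / \<delta>\<^sup>2"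
  defines "G \<equiv> \<lambda>t. (norm (u' t))\<^sup>2 - (norm (u t))\<^sup>2 * W t / 4"
  shows "integrable lborel G" and "(\<integral>t. G t \<partial>lborel) \<ge> 0"
    and "norm (u t) powr s \<le> (3 * s + 2) *
      (sqrt (\<integral>t. G t \<partial>lborel) * sqrt (\<integral>t. norm (u t) powr (2 * s - 2) \<partial>lborel))"
proof -
  have uc: "continuous_on S u" for S
    using u by (meson continuous_at_imp_continuous_on has_vector_derivative_continuous)
  have u'0: "u' t = 0" if "t \<notin> K" for t
  proof -
    have "open (- K)" using K(1) by (simp add: compact_imp_closed open_Compl)
    then have "(u has_vector_derivative 0) (at t)"
      using that u0
      by (intro has_vector_derivative_transform_within_open[of "\<lambda>_. 0" 0 t "- K" u]) auto
    then show ?thesis using u vector_derivative_unique_at by blast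
  qed
  have G0: "G t = 0" if "t \<notin> K" for t
    using that u0 u'0 by (simp add: G_def)
  have [measurable]: "u \<in> borel_measurable borel" "u' \<in> borel_measurable borel"
    using uc[of UNIV] u' by (auto intro: borel_measurable_continuous_onI)
  note W(1)[measurable]
  have Gm[measurable]: "G \<in> borel_measurable borel"
    unfolding G_def by measurable
  have Kfin: "emeasure lborel K < \<infinity>" "K \<in> sets lborel"
    using emeasure_bounded_finite[OF compact_imp_bounded[OF K(1)]] borel_compact[OF K(1)] by simp_all
  show Gint: "integrable lborel G"
  proof -
    obtain \<delta> where \<delta>: "\<delta> > 0" "\<And>x. x \<in> K \<Longrightarrow> ball x \<delta> \<subseteq> U"
    proof -
      obtain \<delta> where "\<delta> > 0" "(\<Union>x\<in>K. ball x \<delta>) \<subseteq> U"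
        using compact_subset_open_imp_ball_epsilon_subset[OF K(1) U K(2)] by blast
      then show ?thesis using that by blast
    qed
    obtain B where B: "\<And>t. t \<in> K \<Longrightarrow> norm (u t) \<le> B"
      using compact_imp_bounded[OF compact_continuous_image[OF uc K(1)]] by (auto simp: bounded_iff)
    obtain B' where B': "\<And>t. t \<in> K \<Longrightarrow> norm (u' t) \<le> B'"
      using compact_imp_bounded[OF compact_continuous_image[OF continuous_on_subset[OF u'] K(1)]]
      by (auto simp: bounded_iff)
    show ?thesis
    proof (rule integrableI_bounded_set[of K _ _ "B'\<^sup>2 + B\<^sup>2 * (1 / \<delta>\<^sup>2) / 4"])
      show "AE x in lborel. x \<in> K \<longrightarrow> norm (G x) \<le> B'\<^sup>2 + B\<^sup>2 * (1 / \<delta>\<^sup>2) / 4"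
      proof (intro AE_I2 impI)
        fix x assume x: "x \<in> K"
        have "norm (G x) \<le> (norm (u' x))\<^sup>2 + (norm (u x))\<^sup>2 * W x / 4"
          unfolding G_def using W(2)[of x] by (simp add: abs_le_iff)
        also have "\<dots> \<le> B'\<^sup>2 + B\<^sup>2 * (1 / \<delta>\<^sup>2) / 4"
          using W(2)[of x] W_le[OF x \<delta>(1) \<delta>(2)[OF x]] B[OF x] B'[OF x]
          by (intro add_mono divide_right_mono mult_mono power_mono) auto
        finally show "norm (G x) \<le> B'\<^sup>2 + B\<^sup>2 * (1 / \<delta>\<^sup>2) / 4" .
      qed
    qed (use Kfin G0 in auto)
  qed
  have Qint: "integrable lborel (\<lambda>t. norm (u t) powr (2 * s - 2))"
  proof -
    obtain B where B: "\<And>t. t \<in> K \<Longrightarrow> norm (norm (u t) powr (2 * s - 2)) \<le> B"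
    proof -
      have "continuous_on K (\<lambda>t. norm (u t) powr (2 * s - 2))"
        using s by (intro continuous_on_powr' continuous_intros uc) auto
      from compact_imp_bounded[OF compact_continuous_image[OF this K(1)]] show ?thesis
        using that by (auto simp: bounded_iff)
    qed
    show ?thesis
      by (rule integrableI_bounded_set[of K _ _ B]) (use Kfin B u0 in auto)
  qed
  obtain M where M: "M > 0" "\<And>x. x \<in> K \<Longrightarrow> \<bar>x\<bar> < M"
    using compact_imp_bounded[OF K(1)] bounded_pos_less[of K] by auto
  define V where "V = U \<inter> {-M<..<M}"
  have V: "open V" "bounded V" "K \<subseteq> V" "V \<subseteq> U"
    using U K(2) M(2) by (auto simp: V_def abs_less_iff intro: bounded_subset[OF bounded_Ioo] minus_less_iff)
      (use M(2) in force)
  \<comment> \<open>The components of \<open>V\<close>, as pairs of end points.\<close>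
  define J where "J = {p :: real \<times> real. fst p < snd p \<and> fst p \<notin> V \<and> snd p \<notin> V \<and> {fst p<..<snd p} \<subseteq> V}"
  have disj: "{a<..<b} \<inter> {a'<..<b'} = {}"
    if "(a, b) \<in> J" "(a', b') \<in> J" "(a, b) \<noteq> (a', b')" for a b a' b'
  proof (rule ccontr)
    assume "{a<..<b} \<inter> {a'<..<b'} \<noteq> {}"
    then obtain x where "x \<in> {a<..<b}" "x \<in> {a'<..<b'}" by blast
    then have x: "a < x" "x < b" "a' < x" "x < b'" by auto
    have "\<not> (a' < a \<and> a < b')" "\<not> (a < a' \<and> a' < b)" "\<not> (a' < b \<and> b < b')" "\<not> (a < b' \<and> b' < b)"
      using that(1,2) by (auto simp: J_def subset_iff)
    then show False using x that(3) by auto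
  qed
  obtain F where F: "finite F" "F \<subseteq> J" "K \<subseteq> (\<Union>p\<in>F. {fst p<..<snd p})"
  proof (rule compactE_image[OF K(1), of J "\<lambda>p. {fst p<..<snd p}"])
    show "K \<subseteq> (\<Union>p\<in>J. {fst p<..<snd p})"
    proof
      fix t assume "t \<in> K"
      then have "t \<in> V" using V by auto
      from open_real_component[OF V(1,2) this] obtain a b
        where "a < t" "t < b" "a \<notin> V" "b \<notin> V" "{a<..<b} \<subseteq> V" by blast
      then have "(a, b) \<in> J" "t \<in> {a<..<b}" by (auto simp: J_def)
      then show "t \<in> (\<Union>p\<in>J. {fst p<..<snd p})" by force
    qed
  qed auto
  define eJ where "eJ p = (\<integral>t. indicator {fst p<..<snd p} t * G t \<partial>lborel)" for p :: "real \<times> real"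
  define Q where "Q = (\<integral>t. norm (u t) powr (2 * s - 2) \<partial>lborel)"
  have local: "eJ p \<ge> 0 \<and> (\<forall>t. fst p < t \<and> t < snd p \<longrightarrow>
      norm (u t) powr s \<le> (3 * s + 2) * (sqrt (eJ p) * sqrt Q))" if pF: "p \<in> F" for p
  proof -
    obtain a b where p: "p = (a, b)" by (cases p)
    have abJ: "a < b" "a \<notin> V" "b \<notin> V" "{a<..<b} \<subseteq> V"
      using subsetD[OF F(2) pF] by (simp_all add: J_def p)
    define m where "m = (a + b) / 2"
    have m: "a < m" "m < b" using abJ by (auto simp: m_def)
    have aK: "a \<notin> K" "b \<notin> K" using abJ V by auto
    have "\<exists>\<alpha> \<beta>. a < \<alpha> \<and> \<alpha> \<le> m \<and> m \<le> \<beta> \<and> \<beta> < b \<and> (\<forall>t\<in>K \<inter> {a..b}. \<alpha> < t \<and> t < \<beta>)"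
    proof (cases "K \<inter> {a..b} = {}")
      case True
      then show ?thesis using m by (intro exI[of _ m]) auto
    next
      case False
      have cK: "compact (K \<inter> {a..b})" using K(1) by (intro compact_Int) auto
      obtain c where c: "c \<in> K \<inter> {a..b}" "\<And>t. t \<in> K \<inter> {a..b} \<Longrightarrow> c \<le> t"
        using compact_attains_inf[OF cK False] by blast
      obtain d where d: "d \<in> K \<inter> {a..b}" "\<And>t. t \<in> K \<inter> {a..b} \<Longrightarrow> t \<le> d"
        using compact_attains_sup[OF cK False] by blast
      have "a < c" "d < b" using c(1) d(1) aK by (auto simp: order_less_le)
      then have "a < (a + min c m) / 2 \<and> (a + min c m) / 2 \<le> m \<and> m \<le> (b + max d m) / 2
          \<and> (b + max d m) / 2 < b" "(a + min c m) / 2 < c" "d < (b + max d m) / 2"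
        using m by (auto simp: min_def max_def)
      then show ?thesis
        using c(2) d(2) by (intro exI[of _ "(a + min c m) / 2"] exI[of _ "(b + max d m) / 2"])
          (meson less_le_trans le_less_trans)
    qed
    then obtain \<alpha> \<beta> where ab: "a < \<alpha>" "\<alpha> \<le> m" "m \<le> \<beta>" "\<beta> < b"
      and Kab: "\<And>t. t \<in> K \<Longrightarrow> a \<le> t \<Longrightarrow> t \<le> b \<Longrightarrow> \<alpha> < t \<and> t < \<beta>"
      by auto
    have ub0: "u \<alpha> = 0" "u \<beta> = 0"
      using Kab[of \<alpha>] Kab[of \<beta>] ab by (auto intro!: u0)
    have si: "set_integrable lborel {\<alpha>..\<beta>} G"
      unfolding set_integrable_def using Gint by (intro integrable_mult_indicator) auto
    have eJ: "eJ p = integral {\<alpha>..\<beta>} G"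
    proof -
      have "eJ p = (LINT t:{\<alpha>..\<beta>}|lborel. G t)"
        unfolding eJ_def set_lebesgue_integral_def p
      proof (intro Bochner_Integration.integral_cong refl)
        fix t show "indicator {fst (a, b)<..<snd (a, b)} t * G t = indicator {\<alpha>..\<beta>} t *\<^sub>R G t"
          using Kab[of t] ab by (cases "t \<in> K") (force simp: indicator_def G0)+
      qed
      then show ?thesis using set_borel_integral_eq_integral(2)[OF si] by simp
    qed
    have Gi: "G integrable_on {\<alpha>..\<beta>}"
      using set_borel_integral_eq_integral(1)[OF si] .
    have Wb: "W t \<le> 1 / \<delta>\<^sup>2" if "t \<in> K" "\<delta> > 0" "ball t \<delta> \<subseteq> {a<..<b}" for t \<delta>
      using that abJ V by (intro W_le) auto
    have Gl: "(norm (u' t))\<^sup>2 - (norm (u t))\<^sup>2 / (4 * (t - a)\<^sup>2) \<le> G t" if "t \<in> {\<alpha>..m}" for t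
    proof (cases "t \<in> K")
      case True
      have "W t \<le> 1 / (t - a)\<^sup>2"
        using that ab by (intro Wb True) (auto simp: dist_real_def m_def field_simps)
      then have "(norm (u t))\<^sup>2 * W t \<le> (norm (u t))\<^sup>2 * (1 / (t - a)\<^sup>2)"
        by (intro mult_left_mono) auto
      then show ?thesis by (simp add: G_def)
    qed (simp add: G0 u0 u'0)
    have Gr: "(norm (u' t))\<^sup>2 - (norm (u t))\<^sup>2 / (4 * (b - t)\<^sup>2) \<le> G t" if "t \<in> {m..\<beta>}" for t
    proof (cases "t \<in> K")
      case True
      have "W t \<le> 1 / (b - t)\<^sup>2"
        using that ab by (intro Wb True) (auto simp: dist_real_def m_def field_simps)
      then have "(norm (u t))\<^sup>2 * W t \<le> (norm (u t))\<^sup>2 * (1 / (b - t)\<^sup>2)"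
        by (intro mult_left_mono) auto
      then show ?thesis by (simp add: G_def)
    qed (simp add: G0 u0 u'0)
    note ihs = interval_hardy_sobolev[OF s ab(1) ab(2,3)[unfolded m_def] ab(4) u u' ub0 Gi,
        folded m_def eJ]
    have H: "eJ p \<ge> 0" "\<And>t. t \<in> {\<alpha>..\<beta>} \<Longrightarrow> norm (u t) powr s \<le>
        (3 * s + 2) * (sqrt (eJ p) * sqrt (integral {\<alpha>..\<beta>} (\<lambda>t. norm (u t) powr (2 * s - 2))))"
      using ihs Gl Gr by blast+
    have qs: "set_integrable lborel {\<alpha>..\<beta>} (\<lambda>t. norm (u t) powr (2 * s - 2))"
      unfolding set_integrable_def using Qint by (intro integrable_mult_indicator) auto
    have Qle: "integral {\<alpha>..\<beta>} (\<lambda>t. norm (u t) powr (2 * s - 2)) \<le> Q"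
      unfolding set_borel_integral_eq_integral(2)[OF qs, symmetric] Q_def set_lebesgue_integral_def
      using qs unfolding set_integrable_def
      by (intro integral_mono Qint) (auto simp: indicator_def)
    have "norm (u t) powr s \<le> (3 * s + 2) * (sqrt (eJ p) * sqrt Q)" if "a < t" "t < b" for t
    proof (cases "t \<in> {\<alpha>..\<beta>}")
      case True
      have "norm (u t) powr s \<le> (3 * s + 2) *
          (sqrt (eJ p) * sqrt (integral {\<alpha>..\<beta>} (\<lambda>t. norm (u t) powr (2 * s - 2))))"
        by (rule H(2)[OF True])
      also have "\<dots> \<le> (3 * s + 2) * (sqrt (eJ p) * sqrt Q)"
        using Qle s H(1) by (intro mult_left_mono) auto
      finally show ?thesis .
    next
      case False
      then have "t \<notin> K" using Kab[of t] that by auto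
      then show ?thesis
        using u0 s H(1) by (auto simp: Q_def intro!: mult_nonneg_nonneg)
    qed
    then show ?thesis using H(1) by (auto simp: p)
  qed
  have eq: "(\<integral>t. G t \<partial>lborel) = (\<Sum>p\<in>F. eJ p)"
  proof -
    have "G t = (\<Sum>p\<in>F. indicator {fst p<..<snd p} t * G t)" for t
    proof (cases "t \<in> K")
      case True
      then obtain p where p: "p \<in> F" "t \<in> {fst p<..<snd p}" using F(3) by auto
      have "(\<Sum>q\<in>F. indicator {fst q<..<snd q} t * G t) =
          (\<Sum>q\<in>F. if q = p then G t else 0)"
      proof (intro sum.cong refl)
        fix q assume q: "q \<in> F"
        show "indicator {fst q<..<snd q} t * G t = (if q = p then G t else 0)"
        proof (cases "q = p")
          case False
          then have "t \<notin> {fst q<..<snd q}"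
            using disj[of "fst p" "snd p" "fst q" "snd q"] p q F(2)
            by (metis disjoint_iff prod.collapse subsetD)
          then show ?thesis using False by simp
        qed (use p in simp)
      qed
      then show ?thesis using p F(1) by simp
    qed (simp add: G0)
    then have "(\<integral>t. G t \<partial>lborel) = (\<integral>t. (\<Sum>p\<in>F. indicator {fst p<..<snd p} t * G t) \<partial>lborel)"
      by presburger
    also have "\<dots> = (\<Sum>p\<in>F. eJ p)"
      unfolding eJ_def using integrable_mult_indicator[OF _ Gint]
      by (intro Bochner_Integration.integral_sum) auto
    finally show ?thesis .
  qed
  show nn: "(\<integral>t. G t \<partial>lborel) \<ge> 0"
    unfolding eq using local by (intro sum_nonneg) auto
  show "norm (u t) powr s \<le> (3 * s + 2) *
      (sqrt (\<integral>t. G t \<partial>lborel) * sqrt (\<integral>t. norm (u t) powr (2 * s - 2) \<partial>lborel))"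
  proof (cases "t \<in> K")
    case True
    then obtain p where p: "p \<in> F" "t \<in> {fst p<..<snd p}" using F(3) by auto
    have "norm (u t) powr s \<le> (3 * s + 2) * (sqrt (eJ p) * sqrt Q)"
      using local[OF p(1)] p(2) by auto
    also have "\<dots> \<le> (3 * s + 2) * (sqrt (\<Sum>p\<in>F. eJ p) * sqrt Q)"
      using member_le_sum[of p F eJ] p F(1) local s
      by (intro mult_left_mono mult_right_mono real_sqrt_le_mono) (auto simp: Q_def)
    finally show ?thesis unfolding eq Q_def .
  next
    case False
    then show ?thesis
      using u0 s nn by (auto intro!: mult_nonneg_nonneg)
  qed
qed

section \<open>The Hoelder and Loomis--Whitney inequalities\<close>

text \<open>Real powers of extended nonnegative numbers, for positive exponents. With values in
  \<^typ>\<open>ennreal\<close> the inequalities of this section hold without integrability hypotheses, and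
  \<open>0 * \<infinity> = 0\<close> makes powers multiplicative without exception.\<close>
definition ennpow :: "ennreal \<Rightarrow> real \<Rightarrow> ennreal" where
  "ennpow x p = (if x = \<infinity> then \<infinity> else ennreal (enn2real x powr p))"

lemma ennpow_top [simp]: "ennpow top p = top"
  by (simp add: ennpow_def)

lemma ennpow_ennreal: "0 \<le> x \<Longrightarrow> ennpow (ennreal x) p = ennreal (x powr p)"
  by (simp add: ennpow_def)

lemma ennpow_0 [simp]: "ennpow 0 p = 0"
  by (simp add: ennpow_def)

lemma ennpow_1 [simp]: "ennpow x 1 = x"
  by (cases x) (auto simp: ennpow_ennreal)

lemma ennpow_one [simp]: "ennpow 1 p = 1"
  by (simp add: ennpow_def)

lemma ennpow_eq_0_iff: "ennpow x p = 0 \<longleftrightarrow> x = 0"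
  by (cases x) (auto simp: ennpow_ennreal)

lemma ennpow_mult: "ennpow (x * y) p = ennpow x p * ennpow y p"
  by (cases x; cases y)
    (auto simp: ennpow_ennreal ennreal_mult_top ennreal_top_mult powr_mult
      simp flip: ennreal_mult)

lemma ennpow_prod: "ennpow (\<Prod>i\<in>I. f i) p = (\<Prod>i\<in>I. ennpow (f i) p)"
  by (induction I rule: infinite_finite_induct) (auto simp: ennpow_mult)

lemma ennpow_ennpow: "ennpow (ennpow x p) q = ennpow x (p * q)"
  by (cases x) (auto simp: ennpow_ennreal powr_powr)

lemma ennpow_mono: "0 \<le> p \<Longrightarrow> x \<le> y \<Longrightarrow> ennpow x p \<le> ennpow y p"
  by (cases x; cases y) (auto simp: ennpow_ennreal top_unique intro!: ennreal_leI powr_mono2)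

lemma borel_measurable_ennpow [measurable]:
  assumes [measurable]: "f \<in> borel_measurable M"
  shows "(\<lambda>x. ennpow (f x) p) \<in> borel_measurable M"
  unfolding ennpow_def by measurable

lemma ennpow_weighted_am_gm:
  assumes I: "finite I" and p: "\<And>i. i \<in> I \<Longrightarrow> p i > 0" "(\<Sum>i\<in>I. p i) = 1"
  shows "(\<Prod>i\<in>I. ennpow (x i) (p i)) \<le> (\<Sum>i\<in>I. ennreal (p i) * x i)"
proof (cases "\<exists>i\<in>I. x i = 0")
  case True
  then have "(\<Prod>i\<in>I. ennpow (x i) (p i)) = 0"
    using I by (auto simp: ennpow_eq_0_iff)
  then show ?thesis by (simp only: zero_le)
next
  case nz: False
  show ?thesis
  proof (cases "\<exists>i\<in>I. x i = \<infinity>")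
    case True
    then obtain i where i: "i \<in> I" "x i = \<infinity>" by auto
    have "ennreal (p i) * x i \<le> (\<Sum>i\<in>I. ennreal (p i) * x i)"
      using i I by (intro member_le_sum) auto
    moreover have "ennreal (p i) * x i = \<infinity>"
      using i p(1)[OF i(1)] by (simp add: ennreal_mult_top)
    ultimately show ?thesis by (simp add: top_unique)
  next
    case False
    define y where "y i = enn2real (x i)" for i
    have xy: "x i = ennreal (y i)" "y i > 0" if "i \<in> I" for i
      using that nz False by (auto simp: y_def enn2real_positive_iff less_top zero_less_iff_neq_zero)
    have "I \<noteq> {}" using p(2) by auto
    have "(\<Sum>i\<in>I. p i * ln (y i)) \<le> ln (\<Sum>i\<in>I. p i *\<^sub>R y i)"
      using I p xy \<open>I \<noteq> {}\<close> by (intro concave_on_sum[OF _ _ ln_concave]) (auto simp: less_imp_le)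
    moreover have pos: "(\<Sum>i\<in>I. p i *\<^sub>R y i) > 0"
      using I \<open>I \<noteq> {}\<close> p xy by (intro sum_pos) auto
    ultimately have "exp (\<Sum>i\<in>I. p i * ln (y i)) \<le> (\<Sum>i\<in>I. p i *\<^sub>R y i)"
      using ln_ge_iff by blast
    moreover have "exp (\<Sum>i\<in>I. p i * ln (y i)) = (\<Prod>i\<in>I. y i powr p i)"
      using I xy(2) by (force simp: exp_sum powr_def intro!: prod.cong)
    ultimately have "ennreal (\<Prod>i\<in>I. y i powr p i) \<le> ennreal (\<Sum>i\<in>I. p i * y i)"
      by (intro ennreal_leI) simp
    moreover have "(\<Prod>i\<in>I. ennpow (x i) (p i)) = ennreal (\<Prod>i\<in>I. y i powr p i)"
      using xy by (subst prod_ennreal[symmetric]) (auto intro!: prod.cong simp: ennpow_ennreal less_imp_le)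
    moreover have "(\<Sum>i\<in>I. ennreal (p i) * x i) = ennreal (\<Sum>i\<in>I. p i * y i)"
      using xy p by (subst sum_ennreal[symmetric])
        (auto intro!: sum.cong mult_nonneg_nonneg simp: ennreal_mult less_imp_le)
    ultimately show ?thesis by simp
  qed
qed

text \<open>After normalising all integrals to \<open>1\<close>, this is the integrated weighted mean inequality. If an
  integral is \<open>0\<close>, the left-hand side vanishes; if one is infinite and none is \<open>0\<close>, the right-hand
  side is infinite.\<close>
lemma nn_integral_Holder:
  assumes I: "finite I" and p: "\<And>i. i \<in> I \<Longrightarrow> p i > 0" "(\<Sum>i\<in>I. p i) = 1"
    and g: "\<And>i. i \<in> I \<Longrightarrow> g i \<in> borel_measurable M"
  shows "(\<integral>\<^sup>+ x. (\<Prod>i\<in>I. ennpow (g i x) (p i)) \<partial>M) \<le> (\<Prod>i\<in>I. ennpow (\<integral>\<^sup>+ x. g i x \<partial>M) (p i))"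
proof (cases "\<exists>i\<in>I. (\<integral>\<^sup>+ x. g i x \<partial>M) = 0")
  case True
  then obtain i where i: "i \<in> I" "(\<integral>\<^sup>+ x. g i x \<partial>M) = 0" by auto
  then have "AE x in M. g i x = 0"
    using g by (simp add: nn_integral_0_iff_AE)
  then have "AE x in M. (\<Prod>i\<in>I. ennpow (g i x) (p i)) = 0"
    by eventually_elim (use i I in \<open>auto simp: ennpow_eq_0_iff\<close>)
  then have "(\<integral>\<^sup>+ x. (\<Prod>i\<in>I. ennpow (g i x) (p i)) \<partial>M) = (\<integral>\<^sup>+ x. 0 \<partial>M)"
    by (rule nn_integral_cong_AE)
  then show ?thesis by simp
next
  case nz: False
  show ?thesis
  proof (cases "\<exists>i\<in>I. (\<integral>\<^sup>+ x. g i x \<partial>M) = \<infinity>")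
    case True
    then obtain i where i: "i \<in> I" "(\<integral>\<^sup>+ x. g i x \<partial>M) = \<infinity>" by auto
    have "(\<Prod>i\<in>I. ennpow (\<integral>\<^sup>+ x. g i x \<partial>M) (p i)) =
        ennpow (\<integral>\<^sup>+ x. g i x \<partial>M) (p i) * (\<Prod>i\<in>I - {i}. ennpow (\<integral>\<^sup>+ x. g i x \<partial>M) (p i))"
      using I i by (subst prod.remove) auto
    moreover have "(\<Prod>i\<in>I - {i}. ennpow (\<integral>\<^sup>+ x. g i x \<partial>M) (p i)) \<noteq> 0"
      using nz I by (auto simp: ennpow_eq_0_iff)
    ultimately have "(\<Prod>i\<in>I. ennpow (\<integral>\<^sup>+ x. g i x \<partial>M) (p i)) = top"
      using i by (simp add: ennreal_top_mult)
    then show ?thesis by simp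
  next
    case False
    define c where "c i = enn2real (\<integral>\<^sup>+ x. g i x \<partial>M)" for i
    have c: "(\<integral>\<^sup>+ x. g i x \<partial>M) = ennreal (c i)" "c i > 0" if "i \<in> I" for i
      using that nz False by (auto simp: c_def enn2real_positive_iff less_top zero_less_iff_neq_zero)
    have gh: "g i x = ennreal (c i) * (ennreal (1 / c i) * g i x)" if "i \<in> I" for i x
      using c(2)[OF that] by (simp add: mult.assoc[symmetric] ennreal_mult[symmetric])
    have "(\<integral>\<^sup>+ x. (\<Prod>i\<in>I. ennpow (g i x) (p i)) \<partial>M) =
        (\<integral>\<^sup>+ x. (\<Prod>i\<in>I. ennpow (ennreal (c i)) (p i)) * (\<Prod>i\<in>I. ennpow (ennreal (1 / c i) * g i x) (p i)) \<partial>M)"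
      by (intro nn_integral_cong, subst prod.distrib[symmetric], intro prod.cong refl)
        (metis ennpow_mult gh)
    also have "\<dots> = (\<Prod>i\<in>I. ennpow (ennreal (c i)) (p i)) *
        (\<integral>\<^sup>+ x. (\<Prod>i\<in>I. ennpow (ennreal (1 / c i) * g i x) (p i)) \<partial>M)"
      using g by (intro nn_integral_cmult) measurable
    also have "(\<integral>\<^sup>+ x. (\<Prod>i\<in>I. ennpow (ennreal (1 / c i) * g i x) (p i)) \<partial>M) \<le>
        (\<integral>\<^sup>+ x. (\<Sum>i\<in>I. ennreal (p i) * (ennreal (1 / c i) * g i x)) \<partial>M)"
      by (intro nn_integral_mono ennpow_weighted_am_gm I p)
    also have "\<dots> = (\<Sum>i\<in>I. ennreal (p i) * (ennreal (1 / c i) * (\<integral>\<^sup>+ x. g i x \<partial>M)))"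
      using g by (simp add: nn_integral_sum nn_integral_cmult)
    also have "\<dots> = (\<Sum>i\<in>I. ennreal (p i))"
    proof (intro sum.cong refl)
      fix i assume i: "i \<in> I"
      have "ennreal (1 / c i) * ennreal (c i) = 1"
        using c(2)[OF i] by (subst ennreal_mult[symmetric]) auto
      then show "ennreal (p i) * (ennreal (1 / c i) * (\<integral>\<^sup>+ x. g i x \<partial>M)) = ennreal (p i)"
        by (simp add: c(1)[OF i])
    qed
    also have "\<dots> = 1"
      using p by (simp add: sum_ennreal less_imp_le)
    finally show ?thesis
      using c by (simp add: mult_left_mono)
  qed
qed

lemma nn_integral_Holder2:
  assumes p: "0 < p" "p < 1" and f: "f \<in> borel_measurable M" and g: "g \<in> borel_measurable M"
  shows "(\<integral>\<^sup>+ x. ennpow (f x) p * ennpow (g x) (1 - p) \<partial>M) \<le>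
    ennpow (\<integral>\<^sup>+ x. f x \<partial>M) p * ennpow (\<integral>\<^sup>+ x. g x \<partial>M) (1 - p)"
  using nn_integral_Holder[of UNIV "\<lambda>b. if b then p else 1 - p" "\<lambda>b. if b then f else g" M] p f g
  by (simp add: UNIV_bool mult.commute)

text \<open>The inner integral in the induction step for the Loomis--Whitney inequality: the new coordinate
  is frozen, \<open>f\<close> does not depend on it, and Hoelder's inequality with exponents \<open>n\<close> and
  \<open>n / (n - 1)\<close> separates \<open>f\<close> from the remaining factors, to which the induction hypothesis
  applies. For a single coordinate the second exponent degenerates, but then the remaining factor is
  constant.\<close>

lemma (in product_sigma_finite) loomis_whitney_step:
  assumes I: "finite I" "card I \<ge> 1"
    and IH: "card I \<ge> 2 \<Longrightarrow>
      (\<integral>\<^sup>+ x. (\<Prod>i\<in>I. ennpow (g i (restrict x (I - {i}))) (1 / (real (card I) - 1))) \<partial>PiM I M)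
      \<le> (\<Prod>i\<in>I. ennpow (\<integral>\<^sup>+ x. g i x \<partial>PiM (I - {i}) M) (1 / (real (card I) - 1)))"
    and f: "f \<in> borel_measurable (PiM I M)"
    and g: "\<And>i. i \<in> I \<Longrightarrow> g i \<in> borel_measurable (PiM (I - {i}) M)"
  defines "n \<equiv> real (card I)"
  shows "(\<integral>\<^sup>+ x. ennpow (f x) (1 / n) * (\<Prod>i\<in>I. ennpow (g i (restrict x (I - {i}))) (1 / n)) \<partial>PiM I M)
    \<le> ennpow (\<integral>\<^sup>+ x. f x \<partial>PiM I M) (1 / n) *
      (\<Prod>i\<in>I. ennpow (\<integral>\<^sup>+ x. g i x \<partial>PiM (I - {i}) M) (1 / n))"
proof (cases "card I = 1")
  case True
  then obtain k where k: "I = {k}" using card_1_singletonE by blast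
  have "(\<integral>\<^sup>+ x. ennpow (f x) (1 / n) * (\<Prod>i\<in>I. ennpow (g i (restrict x (I - {i}))) (1 / n)) \<partial>PiM I M)
      = (\<integral>\<^sup>+ x. f x * g k (\<lambda>_. undefined) \<partial>PiM I M)"
    using True by (simp add: n_def k restrict_def)
  also have "\<dots> = (\<integral>\<^sup>+ x. f x \<partial>PiM I M) * g k (\<lambda>_. undefined)"
    using f by (rule nn_integral_multc)
  finally show ?thesis
    using True by (simp add: n_def k nn_integral_empty)
next
  case False
  then have n: "card I \<ge> 2" "n \<ge> 2" using I by (auto simp: n_def)
  define H where "H x = (\<Prod>i\<in>I. ennpow (g i (restrict x (I - {i}))) (1 / (n - 1)))" for x
  have rm: "(\<lambda>x. g i (restrict x (I - {i}))) \<in> borel_measurable (PiM I M)" if "i \<in> I" for i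
    by (rule measurable_compose[OF measurable_restrict_subset g[OF that]]) auto
  have Hm: "H \<in> borel_measurable (PiM I M)"
    unfolding H_def using rm by measurable
  have e: "1 / (n - 1) * (1 - 1 / n) = 1 / n"
    using n by (simp add: field_simps)
  have Hp: "ennpow (H x) (1 - 1 / n) = (\<Prod>i\<in>I. ennpow (g i (restrict x (I - {i}))) (1 / n))" for x
    by (simp only: H_def ennpow_prod ennpow_ennpow e)
  have "(\<integral>\<^sup>+ x. ennpow (f x) (1 / n) * ennpow (H x) (1 - 1 / n) \<partial>PiM I M)
      \<le> ennpow (\<integral>\<^sup>+ x. f x \<partial>PiM I M) (1 / n) * ennpow (\<integral>\<^sup>+ x. H x \<partial>PiM I M) (1 - 1 / n)"
    using n by (intro nn_integral_Holder2 f Hm) (auto simp: field_simps)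
  also have "\<dots> \<le> ennpow (\<integral>\<^sup>+ x. f x \<partial>PiM I M) (1 / n) *
      ennpow (\<Prod>i\<in>I. ennpow (\<integral>\<^sup>+ x. g i x \<partial>PiM (I - {i}) M) (1 / (n - 1))) (1 - 1 / n)"
    using IH[OF n(1)] n unfolding H_def n_def
    by (intro mult_left_mono ennpow_mono) (auto simp: field_simps)
  also have "ennpow (\<Prod>i\<in>I. ennpow (\<integral>\<^sup>+ x. g i x \<partial>PiM (I - {i}) M) (1 / (n - 1))) (1 - 1 / n) =
      (\<Prod>i\<in>I. ennpow (\<integral>\<^sup>+ x. g i x \<partial>PiM (I - {i}) M) (1 / n))"
    by (simp only: ennpow_prod ennpow_ennpow e)
  finally show ?thesis unfolding Hp .
qed

text \<open>Induction on the number of coordinates. After integrating over the old coordinates, the step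
  ends with Hoelder's inequality in the new coordinate for \<open>n\<close> functions with equal exponents.\<close>
lemma (in product_sigma_finite) loomis_whitney:
  assumes "finite I" "card I \<ge> 2"
    and "\<And>i. i \<in> I \<Longrightarrow> f i \<in> borel_measurable (PiM (I - {i}) M)"
  shows "(\<integral>\<^sup>+ x. (\<Prod>i\<in>I. ennpow (f i (restrict x (I - {i}))) (1 / (real (card I) - 1))) \<partial>PiM I M)
    \<le> (\<Prod>i\<in>I. ennpow (\<integral>\<^sup>+ x. f i x \<partial>PiM (I - {i}) M) (1 / (real (card I) - 1)))"
  using assms
proof (induction I arbitrary: f rule: finite_induct)
  case (insert j I)
  define n where "n = real (card I)"
  have cI: "card I \<ge> 1" "I \<noteq> {}" using insert by auto
  then have n1: "n \<ge> 1" by (simp add: n_def)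
  have nn: "real (card (insert j I)) - 1 = n" using insert by (simp add: n_def)
  have fj[measurable]: "f j \<in> borel_measurable (PiM I M)"
    using insert.prems(2)[of j] insert.hyps by simp
  have ins: "insert j I - {i} = insert j (I - {i})" if "i \<in> I" for i
    using that insert.hyps by auto
  have fi: "f i \<in> borel_measurable (PiM (insert j (I - {i})) M)" if "i \<in> I" for i
    using insert.prems(2)[of i] that ins by simp
  have rm: "(\<lambda>x. f i (restrict x (insert j I - {i}))) \<in> borel_measurable (PiM (insert j I) M)"
    if "i \<in> insert j I" for i
    by (rule measurable_compose[OF measurable_restrict_subset insert.prems(2)[OF that]]) auto
  define g where "g y i x = f i (x(j := y))" for y i x
  have gm: "g y i \<in> borel_measurable (PiM (I - {i}) M)" if "i \<in> I" "y \<in> space (M j)" for y i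
    unfolding g_def
    by (rule measurable_compose[OF _ fi[OF that(1)]],
        rule measurable_fun_upd[where J="I - {i}"]) (use that in auto)
  have G2: "(\<integral>\<^sup>+ y. \<integral>\<^sup>+ x. g y i x \<partial>PiM (I - {i}) M \<partial>M j) = (\<integral>\<^sup>+ x. f i x \<partial>PiM (insert j I - {i}) M)"
    if "i \<in> I" for i
    unfolding g_def ins[OF that] using insert.hyps that
    by (subst product_nn_integral_insert_rev[OF _ _ fi[OF that]]) auto
  have Gm: "(\<lambda>y. \<integral>\<^sup>+ x. g y i x \<partial>PiM (I - {i}) M) \<in> borel_measurable (M j)" if "i \<in> I" for i
  proof -
    interpret P: sigma_finite_measure "PiM (I - {i}) M"
      using insert.hyps by (intro sigma_finite) auto
    have "(\<lambda>(y, x). x(j := y)) \<in> M j \<Otimes>\<^sub>M PiM (I - {i}) M \<rightarrow>\<^sub>M PiM (insert j (I - {i})) M"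
      unfolding split_beta
      by (rule measurable_fun_upd[where J="I - {i}"]) auto
    from measurable_compose[OF this fi[OF that]]
    have "(\<lambda>(y, x). g y i x) \<in> borel_measurable (M j \<Otimes>\<^sub>M PiM (I - {i}) M)"
      by (simp add: g_def split_beta)
    then show ?thesis
      using P.borel_measurable_nn_integral by simp
  qed
  have "(\<integral>\<^sup>+ x. (\<Prod>i\<in>insert j I. ennpow (f i (restrict x (insert j I - {i}))) (1 / n)) \<partial>PiM (insert j I) M)
      = (\<integral>\<^sup>+ y. \<integral>\<^sup>+ x. (\<Prod>i\<in>insert j I. ennpow (f i (restrict (x(j := y)) (insert j I - {i}))) (1 / n))
          \<partial>PiM I M \<partial>M j)"
    using insert.hyps rm by (intro product_nn_integral_insert_rev borel_measurable_prod borel_measurable_ennpow) auto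
  also have "\<dots> = (\<integral>\<^sup>+ y. \<integral>\<^sup>+ x. ennpow (f j x) (1 / n) *
      (\<Prod>i\<in>I. ennpow (g y i (restrict x (I - {i}))) (1 / n)) \<partial>PiM I M \<partial>M j)"
  proof (intro nn_integral_cong)
    fix y x assume x: "x \<in> space (PiM I M)"
    have 1: "restrict (x(j := y)) (insert j I - {j}) = x"
      using x insert.hyps by (auto simp: space_PiM PiE_def extensional_def fun_eq_iff)
    have 2: "restrict (x(j := y)) (insert j I - {i}) = (restrict x (I - {i}))(j := y)" if "i \<in> I" for i
      using that insert.hyps by (auto simp: fun_eq_iff)
    show "(\<Prod>i\<in>insert j I. ennpow (f i (restrict (x(j := y)) (insert j I - {i}))) (1 / n)) =
      ennpow (f j x) (1 / n) * (\<Prod>i\<in>I. ennpow (g y i (restrict x (I - {i}))) (1 / n))"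
      unfolding prod.insert[OF insert.hyps] 1 g_def
      by (intro arg_cong2[where f="(*)"] refl prod.cong) (simp only: 2)
  qed
  also have "\<dots> \<le> (\<integral>\<^sup>+ y. ennpow (\<integral>\<^sup>+ x. f j x \<partial>PiM I M) (1 / n) *
      (\<Prod>i\<in>I. ennpow (\<integral>\<^sup>+ x. g y i x \<partial>PiM (I - {i}) M) (1 / n)) \<partial>M j)"
    unfolding n_def using insert.hyps cI fj gm
    by (intro nn_integral_mono loomis_whitney_step insert.IH) auto
  also have "\<dots> = ennpow (\<integral>\<^sup>+ x. f j x \<partial>PiM I M) (1 / n) *
      (\<integral>\<^sup>+ y. (\<Prod>i\<in>I. ennpow (\<integral>\<^sup>+ x. g y i x \<partial>PiM (I - {i}) M) (1 / n)) \<partial>M j)"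
    using Gm by (intro nn_integral_cmult borel_measurable_prod borel_measurable_ennpow) auto
  also have "\<dots> \<le> ennpow (\<integral>\<^sup>+ x. f j x \<partial>PiM I M) (1 / n) *
      (\<Prod>i\<in>I. ennpow (\<integral>\<^sup>+ y. \<integral>\<^sup>+ x. g y i x \<partial>PiM (I - {i}) M \<partial>M j) (1 / n))"
    using insert.hyps n1 Gm by (intro mult_left_mono nn_integral_Holder) (auto simp: n_def)
  also have "\<dots> = (\<Prod>i\<in>insert j I. ennpow (\<integral>\<^sup>+ x. f i x \<partial>PiM (insert j I - {i}) M) (1 / n))"
    using insert.hyps G2 by simp
  finally show ?case unfolding nn .
qed simp

section \<open>Product measure, linear maps and Lebesgue measure\<close>

lemma (in product_sigma_finite) product_integrable_insert:
  fixes f :: "_ \<Rightarrow> real"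
  assumes I: "finite I" "i \<notin> I" and f: "integrable (PiM (insert i I) M) f"
  shows "integrable (PiM I M) (\<lambda>x. \<integral>y. f (x(i := y)) \<partial>M i)"
proof -
  interpret I: sigma_finite_measure "PiM I M" using I by (intro sigma_finite)
  interpret P: pair_sigma_finite "PiM I M" "M i" ..
  have fm: "f \<in> borel_measurable (PiM (insert i I) M)" using f by auto
  have m: "(\<lambda>(x, y). f (x(i := y))) \<in> borel_measurable (PiM I M \<Otimes>\<^sub>M M i)"
    unfolding split_beta
    by (rule measurable_compose[OF _ fm], rule measurable_fun_upd[where J=I]) auto
  have "(\<integral>\<^sup>+ p. norm (case p of (x, y) \<Rightarrow> f (x(i := y))) \<partial>(PiM I M \<Otimes>\<^sub>M M i)) =
      (\<integral>\<^sup>+ x. \<integral>\<^sup>+ y. norm (f (x(i := y))) \<partial>M i \<partial>PiM I M)"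
    using m by (subst sigma_finite_measure.nn_integral_fst[OF sigma_finite_measures, symmetric]) (auto simp: split_beta)
  also have "\<dots> = (\<integral>\<^sup>+ x. norm (f x) \<partial>PiM (insert i I) M)"
    using fm I by (subst product_nn_integral_insert) auto
  also have "\<dots> < \<infinity>"
    using f by (simp add: integrable_iff_bounded)
  finally have "integrable (PiM I M \<Otimes>\<^sub>M M i) (\<lambda>(x, y). f (x(i := y)))"
    using m by (intro integrableI_bounded) auto
  from P.integrable_fst[OF this] show ?thesis .
qed

interpretation lborel_product: product_sigma_finite "\<lambda>_. lborel :: real measure"
  by standard

lemma sum_axis_expansion: "(\<Sum>i\<in>UNIV. x $ i *\<^sub>R axis i 1) = (x :: real ^ 'n)"
  by (auto simp: vec_eq_iff axis_def if_distrib sum.delta cong: if_cong)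

lemma measurable_vec_lambda_PiM:
  "vec_lambda \<in> PiM UNIV (\<lambda>_::'n::finite. lborel) \<rightarrow>\<^sub>M (borel :: (real ^ 'n) measure)"
proof -
  have "(\<lambda>y. \<Sum>i\<in>UNIV. y i *\<^sub>R axis i 1) \<in> PiM UNIV (\<lambda>_::'n. lborel) \<rightarrow>\<^sub>M (borel :: (real ^ 'n) measure)"
    by measurable
  moreover have "(\<lambda>y::'n \<Rightarrow> real. \<Sum>i\<in>UNIV. y i *\<^sub>R axis i 1) = vec_lambda"
  proof
    show "(\<Sum>i\<in>UNIV. y i *\<^sub>R axis i 1) = (vec_lambda y :: real ^ 'n)" for y
      using sum_axis_expansion[of "vec_lambda y"] by simp
  qed
  ultimately show ?thesis by simp
qed

lemma distr_PiM_lborel_vec: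
  "distr (PiM UNIV (\<lambda>_::'n::finite. lborel)) borel vec_lambda = (lborel :: (real ^ 'n) measure)"
proof (rule lborel_eqI[symmetric])
  fix l u :: "real ^ 'n"
  assume "\<And>b. b \<in> Basis \<Longrightarrow> l \<bullet> b \<le> u \<bullet> b"
  then have lu: "l $ i \<le> u $ i" for i
    by (metis axis_in_Basis_iff cart_eq_inner_axis insertI1 Basis_real_def)
  have "emeasure (distr (PiM UNIV (\<lambda>_::'n. lborel)) borel vec_lambda) (box l u) =
      emeasure (PiM UNIV (\<lambda>_::'n. lborel)) (\<Pi>\<^sub>E i\<in>UNIV. {l $ i<..<u $ i})"
    using measurable_vec_lambda_PiM by (subst emeasure_distr)
      (auto simp: mem_box_cart space_PiM PiE_def Pi_def vimage_def intro!: arg_cong2[where f=emeasure])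
  also have "\<dots> = (\<Prod>i\<in>UNIV. emeasure lborel {l $ i<..<u $ i})"
    by (intro lborel_product.emeasure_PiM) auto
  also have "\<dots> = ennreal (\<Prod>i\<in>UNIV. (u - l) $ i)"
    using lu by (simp add: prod_ennreal)
  also have "(\<Prod>i\<in>UNIV. (u - l) $ i) = (\<Prod>b\<in>Basis. (u - l) \<bullet> b)"
    by (simp add: Basis_vec_def UNION_singleton_eq_range prod.reindex inj_on_def axis_eq_axis
        inner_axis)
  finally show "emeasure (distr (PiM UNIV (\<lambda>_::'n. lborel)) borel vec_lambda) (box l u) =
      ennreal (\<Prod>b\<in>Basis. (u - l) \<bullet> b)" .
qed simp

text \<open>Uniqueness of translation invariant measures. The double integral of \<open>1\<^sub>A(x) 1\<^sub>B(x + y)\<close>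
  factors when the variable \<open>y\<close> is integrated first; after the substitution \<open>x \<mapsto> x - y\<close> it factors
  again with the measures exchanged. The set \<open>A\<close> is a ball because it has to be symmetric.\<close>

lemma translation_invariant_eq_density:
  fixes \<nu> :: "'a::euclidean_space measure"
  assumes sets: "sets \<nu> = sets borel" and fin: "\<And>r. emeasure \<nu> (ball 0 r) < \<infinity>"
    and inv: "\<And>x. distr \<nu> borel ((+) x) = \<nu>"
  shows "\<nu> = density lborel (\<lambda>_. ennreal (measure \<nu> (ball 0 1) / measure lborel (ball 0 1 :: 'a set)))"
proof -
  define A where "A = (ball 0 1 :: 'a set)"
  have A_sets[measurable]: "A \<in> sets borel" and A_sym: "- x \<in> A \<longleftrightarrow> x \<in> A" for x
    by (auto simp: A_def)
  have [measurable_cong]: "sets \<nu> = sets borel" by fact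
  have sp: "space \<nu> = UNIV" using sets_eq_imp_space_eq[OF sets] by simp
  interpret nu: sigma_finite_measure \<nu>
  proof
    show "\<exists>A. countable A \<and> A \<subseteq> sets \<nu> \<and> \<Union>A = space \<nu> \<and> (\<forall>a\<in>A. emeasure \<nu> a \<noteq> \<infinity>)"
    proof (intro exI[of _ "range (\<lambda>n::nat. ball 0 (real n))"] conjI ballI)
      show "\<Union>(range (\<lambda>n::nat. ball (0::'a) (real n))) = space \<nu>"
        using sp reals_Archimedean2 by auto
    qed (use fin sets in \<open>auto simp: less_top\<close>)
  qed
  interpret P: pair_sigma_finite lborel \<nu> ..
  have mA: "emeasure lborel A = ennreal (measure lborel A)" "measure lborel A > 0"
    using emeasure_bounded_finite[OF bounded_ball, of "0::'a" 1]
    by (auto simp: A_def content_ball_pos less_top intro!: emeasure_eq_ennreal_measure)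
  have nA: "emeasure \<nu> A = ennreal (measure \<nu> A)"
    using fin[of 1] unfolding A_def by (intro emeasure_eq_ennreal_measure) auto
  have key: "emeasure lborel A * emeasure \<nu> B = emeasure \<nu> A * emeasure lborel B"
    if [measurable]: "B \<in> sets borel" for B
  proof -
    have i1: "(\<integral>\<^sup>+ y. indicator B (x + y) \<partial>\<nu>) = emeasure \<nu> B" for x
    proof -
      have "emeasure \<nu> B = (\<integral>\<^sup>+ y. indicator B y \<partial>distr \<nu> borel ((+) x))"
        using sets by (simp add: inv)
      also have "\<dots> = (\<integral>\<^sup>+ y. indicator B (x + y) \<partial>\<nu>)"
        by (rule nn_integral_distr) measurable
      finally show ?thesis ..
    qed
    have i2: "(\<integral>\<^sup>+ x. indicator A x * indicator B (x + y) \<partial>lborel) =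
        (\<integral>\<^sup>+ x. indicator A (x - y) * indicator B x \<partial>lborel)" for y
    proof -
      have "(\<integral>\<^sup>+ x. indicator A x * indicator B (x + y) \<partial>lborel) =
          (\<integral>\<^sup>+ x. indicator A x * indicator B (x + y) \<partial>distr lborel borel ((+) (- y)))"
        by (simp add: lborel_distr_plus)
      also have "\<dots> = (\<integral>\<^sup>+ x. indicator A (- y + x) * indicator B ((- y + x) + y) \<partial>lborel)"
        by (rule nn_integral_distr) measurable
      finally show ?thesis by (simp add: algebra_simps)
    qed
    have i3: "(\<integral>\<^sup>+ y. indicator A (x - y) \<partial>\<nu>) = emeasure \<nu> A" for x
    proof -
      have "emeasure \<nu> A = (\<integral>\<^sup>+ y. indicator A y \<partial>distr \<nu> borel ((+) (- x)))"
        using sets by (simp add: inv)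
      also have "\<dots> = (\<integral>\<^sup>+ y. indicator A (- x + y) \<partial>\<nu>)"
        by (rule nn_integral_distr) measurable
      also have "\<dots> = (\<integral>\<^sup>+ y. indicator A (x - y) \<partial>\<nu>)"
        by (intro nn_integral_cong) (use A_sym in \<open>force simp: indicator_def\<close>)
      finally show ?thesis ..
    qed
    have "emeasure lborel A * emeasure \<nu> B = (\<integral>\<^sup>+ x. indicator A x * emeasure \<nu> B \<partial>lborel)"
      by (simp add: nn_integral_multc)
    also have "\<dots> = (\<integral>\<^sup>+ x. \<integral>\<^sup>+ y. indicator A x * indicator B (x + y) \<partial>\<nu> \<partial>lborel)"
      by (intro nn_integral_cong) (subst nn_integral_cmult, measurable, simp add: i1)
    also have "\<dots> = (\<integral>\<^sup>+ y. \<integral>\<^sup>+ x. indicator A x * indicator B (x + y) \<partial>lborel \<partial>\<nu>)"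
      by (rule P.Fubini'[symmetric]) measurable
    also have "\<dots> = (\<integral>\<^sup>+ y. \<integral>\<^sup>+ x. indicator A (x - y) * indicator B x \<partial>lborel \<partial>\<nu>)"
      by (simp only: i2)
    also have "\<dots> = (\<integral>\<^sup>+ x. \<integral>\<^sup>+ y. indicator A (x - y) * indicator B x \<partial>\<nu> \<partial>lborel)"
      by (rule P.Fubini') measurable
    also have "\<dots> = (\<integral>\<^sup>+ x. emeasure \<nu> A * indicator B x \<partial>lborel)"
      by (intro nn_integral_cong) (subst nn_integral_multc, measurable, simp only: i3)
    also have "\<dots> = emeasure \<nu> A * emeasure lborel B"
      by (simp add: nn_integral_cmult)
    finally show ?thesis .
  qed
  show ?thesis
    unfolding A_def[symmetric]
  proof (rule measure_eqI)
    fix B assume "B \<in> sets \<nu>"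
    then have B: "B \<in> sets borel" using sets by simp
    have c: "ennreal (measure lborel A) * ennreal (1 / measure lborel A) = 1"
      using mA(2) by (subst ennreal_mult[symmetric]) auto
    have "emeasure \<nu> B = ennreal (1 / measure lborel A) * (emeasure lborel A * emeasure \<nu> B)"
      by (metis c mA(1) mult.assoc mult.commute mult_1)
    also have "\<dots> = ennreal (1 / measure lborel A) * ennreal (measure \<nu> A) * emeasure lborel B"
      unfolding key[OF B] nA by (simp add: mult.assoc)
    also have "\<dots> = ennreal (measure \<nu> A / measure lborel A) * emeasure lborel B"
      by (subst ennreal_mult[symmetric]) (auto simp: mult.commute)
    also have "\<dots> = emeasure (density lborel (\<lambda>_. ennreal (measure \<nu> A / measure lborel A))) B"
      using B by (simp add: emeasure_density_const)
    finally show "emeasure \<nu> B = emeasure (density lborel (\<lambda>_. ennreal (measure \<nu> A / measure lborel A))) B" .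
  qed (simp add: sets)
qed

text \<open>The factor is given as a ratio of volumes instead of a determinant; this form makes it
  evident that it is \<open>1\<close> for orthogonal maps and bounded near the identity.\<close>
lemma distr_lborel_linear:
  fixes L :: "'a::euclidean_space \<Rightarrow> 'a"
  assumes L: "linear L" and c: "c > 0" and lower: "\<And>x. c * norm x \<le> norm (L x)"
  shows "distr lborel borel L = density lborel
    (\<lambda>_. ennreal (measure lborel (L -` ball 0 1) / measure lborel (ball 0 1 :: 'a set)))"
proof -
  have inj: "inj L"
  proof -
    have "x = 0" if "L x = 0" for x using lower[of x] that c by (simp add: mult_le_0_iff)
    then show ?thesis using L linear_injective_0 by blast
  qed
  then have surj: "surj L" using L linear_injective_imp_surjective by blast
  have [measurable]: "L \<in> borel_measurable borel"
    using L linear_continuous_on linear_conv_bounded_linear by (auto intro!: borel_measurable_continuous_onI)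
  have pre: "emeasure (distr lborel borel L) (ball 0 r) = emeasure lborel (L -` ball 0 r)" for r
    by (subst emeasure_distr) auto
  have sub: "L -` ball 0 r \<subseteq> ball 0 (r / c)" for r
  proof
    fix x assume "x \<in> L -` ball 0 r"
    then have "c * norm x < r" using lower[of x] by simp
    then show "x \<in> ball 0 (r / c)" using c by (simp add: field_simps)
  qed
  have "distr lborel borel L = density lborel
    (\<lambda>_. ennreal (measure (distr lborel borel L) (ball 0 1) / measure lborel (ball 0 1 :: 'a set)))"
  proof (rule translation_invariant_eq_density)
    show "emeasure (distr lborel borel L) (ball 0 r) < \<infinity>" for r
      unfolding pre using sub by (intro emeasure_bounded_finite bounded_subset[OF bounded_ball])
    show "distr (distr lborel borel L) borel ((+) v) = distr lborel borel L" for v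
    proof -
      obtain w where w: "v = L w" using surj by blast
      have "distr (distr lborel borel L) borel ((+) v) = distr lborel borel (\<lambda>x. L (w + x))"
        by (subst distr_distr) (auto simp: o_def w linear_add[OF L])
      also have "\<dots> = distr (distr lborel borel ((+) w)) borel L"
        by (subst distr_distr) (auto simp: o_def)
      finally show ?thesis by (simp add: lborel_distr_plus)
    qed
  qed simp
  moreover have "measure (distr lborel borel L) (ball 0 1) = measure lborel (L -` ball 0 1)"
    by (simp add: measure_def pre)
  ultimately show ?thesis by simp
qed

lemma distr_lborel_orthogonal:
  fixes L :: "'a::euclidean_space \<Rightarrow> 'a"
  assumes L: "orthogonal_transformation L"
  shows "distr lborel borel L = lborel"
proof -
  have n: "norm (L x) = norm x" for x using L by (simp add: orthogonal_transformation_norm)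
  then have "L -` ball 0 1 = ball 0 1" by auto
  then show ?thesis
    using distr_lborel_linear[of L 1] L n content_ball_pos[of 1 "0::'a"]
    by (simp add: orthogonal_transformation_linear density_1)
qed

text \<open>The linear map that sends the standard basis to \<open>e\<close> differs from the identity by at most half
  the norm, so the preimage of the unit ball lies between the balls of radius \<open>1/2\<close> and \<open>2\<close>.\<close>
lemma distr_PiM_lborel_near_identity:
  fixes e :: "'n::finite \<Rightarrow> real ^ 'n"
  assumes e: "\<And>i. norm (e i - axis i 1) \<le> 1 / (2 * real CARD('n))"
  defines "T \<equiv> \<lambda>y::'n \<Rightarrow> real. \<Sum>i\<in>UNIV. y i *\<^sub>R e i"
  shows "\<exists>\<kappa>>0. \<kappa> \<le> 2 ^ CARD('n) \<and>
    distr (PiM UNIV (\<lambda>_. lborel)) borel T = density lborel (\<lambda>_. ennreal \<kappa>)"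
proof -
  define L where "L x = (\<Sum>i\<in>UNIV. x $ i *\<^sub>R e i)" for x :: "real ^ 'n"
  have L: "linear L"
    by (rule linearI) (simp_all add: L_def scaleR_add_left sum.distrib scaleR_sum_right)
  have Lm[measurable]: "L \<in> borel_measurable borel"
    using L linear_continuous_on linear_conv_bounded_linear by (auto intro!: borel_measurable_continuous_onI)
  have near: "norm (L x - x) \<le> norm x / 2" for x
  proof -
    have "L x - x = L x - (\<Sum>i\<in>UNIV. x $ i *\<^sub>R axis i 1)"
      by (simp only: sum_axis_expansion)
    also have "\<dots> = (\<Sum>i\<in>UNIV. x $ i *\<^sub>R (e i - axis i 1))"
      by (simp add: L_def scaleR_diff_right sum_subtractf)
    also have "norm \<dots> \<le> (\<Sum>i\<in>(UNIV::'n set). norm x * (1 / (2 * real CARD('n))))"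
      using e by (intro sum_norm_le) (auto intro!: mult_mono component_le_norm_cart simp del: times_divide_eq_right)
    finally show ?thesis by simp
  qed
  have lower: "1 / 2 * norm x \<le> norm (L x)" for x
    using near[of x] norm_triangle_ineq2[of x "x - L x"] by (simp add: norm_minus_commute)
  define \<kappa> where "\<kappa> = measure lborel (L -` ball 0 1) / measure lborel (ball 0 1 :: (real ^ 'n) set)"
  have pos: "measure lborel (ball 0 1 :: (real ^ 'n) set) > 0"
    by (simp add: content_ball_pos)
  have sub2: "L -` ball 0 1 \<subseteq> ball 0 2"
  proof
    fix x assume "x \<in> L -` ball 0 1"
    then show "x \<in> ball 0 2" using lower[of x] by simp
  qed
  have upper: "norm (L x) \<le> 2 * norm x" for x
    using near[of x] norm_triangle_sub[of "L x" x] norm_ge_zero[of x] by linarith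
  have sub1: "ball 0 (1/2) \<subseteq> L -` ball 0 1"
  proof
    fix x :: "real ^ 'n" assume "x \<in> ball 0 (1/2)"
    then show "x \<in> L -` ball 0 1" using upper[of x] by simp
  qed
  have Lb: "L -` ball 0 1 \<in> sets lborel"
    using measurable_sets[OF Lm, of "ball 0 1"] by simp
  have fin: "emeasure lborel (L -` ball 0 1) \<noteq> \<infinity>"
    using emeasure_bounded_finite[OF bounded_subset[OF bounded_ball sub2]] by simp
  have "measure lborel (ball 0 (1/2) :: (real ^ 'n) set) \<le> measure lborel (L -` ball 0 1)"
    using sub1 Lb fin by (intro measure_mono_fmeasurable) (auto simp: fmeasurable_def less_top)
  moreover have "measure lborel (ball 0 (1/2) :: (real ^ 'n) set) > 0"
    by (rule content_ball_pos) simp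
  ultimately have k0: "\<kappa> > 0"
    using pos unfolding \<kappa>_def by (intro divide_pos_pos) linarith+
  have "measure lborel (L -` ball 0 1) \<le> measure lborel (ball 0 2 :: (real ^ 'n) set)"
    using sub2 Lb emeasure_bounded_finite[OF bounded_ball, of "0 :: real ^ 'n" 2]
    by (intro measure_mono_fmeasurable) (auto simp: fmeasurable_def)
  also have "\<dots> = 2 ^ CARD('n) * measure lborel (ball 0 1 :: (real ^ 'n) set)"
    by (simp add: content_ball)
  finally have k1: "\<kappa> \<le> 2 ^ CARD('n)"
    using pos by (simp add: \<kappa>_def field_simps)
  have "distr (PiM UNIV (\<lambda>_. lborel)) borel T =
      distr (distr (PiM UNIV (\<lambda>_. lborel)) borel vec_lambda) borel L"
  proof -
    show ?thesis
      using measurable_vec_lambda_PiM by (subst distr_distr) (auto simp: o_def T_def L_def intro!: distr_cong)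
  qed
  also have "\<dots> = distr lborel borel L" by (simp add: distr_PiM_lborel_vec)
  also have "\<dots> = density lborel (\<lambda>_. ennreal \<kappa>)"
    unfolding \<kappa>_def using L lower by (intro distr_lborel_linear[of _ "1/2"]) auto
  finally show ?thesis using k0 k1 by blast
qed

section \<open>Directional distance and energy density\<close>

lemma dir_dist_less_iff:
  "dir_dist \<Omega> e x < a \<longleftrightarrow> (\<exists>t. ennreal \<bar>t\<bar> < a \<and> x + t *\<^sub>R e \<notin> \<Omega>)"
  unfolding dir_dist_def by (auto simp: Inf_less_iff)

lemma dir_dist_ge:
  assumes "\<And>t. \<bar>t\<bar> < \<delta> \<Longrightarrow> x + t *\<^sub>R e \<in> \<Omega>"
  shows "ennreal \<delta> \<le> dir_dist \<Omega> e x"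
proof (rule ccontr)
  assume "\<not> ?thesis"
  then have "dir_dist \<Omega> e x < ennreal \<delta>" by simp
  then obtain t where "ennreal \<bar>t\<bar> < ennreal \<delta>" "x + t *\<^sub>R e \<notin> \<Omega>"
    by (auto simp: dir_dist_less_iff)
  then show False using assms[of t] by (simp add: ennreal_less_iff)
qed

text \<open>Joint measurability in point and direction. The set of pairs for which the line leaves \<open>\<Omega>\<close> at
  some \<open>t\<close> with \<open>|t| \<le> c\<close> is the projection of a closed set along a compact interval, hence closed, and
  countably many values of \<open>c\<close> suffice.\<close>
lemma borel_measurable_dir_dist:
  fixes \<Omega> :: "(real ^ 'n) set"
  assumes "open \<Omega>"
  shows "(\<lambda>p. dir_dist \<Omega> (snd p) (fst p)) \<in> borel_measurable borel"
proof (rule borel_measurableI_less)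
  fix a :: ennreal
  define C where "C c = {p. \<exists>t. t \<in> {-c..c} \<and> fst p + t *\<^sub>R snd p \<in> - \<Omega>}" for c :: real
  have "closed (C c)" for c
  proof -
    have "closed {z :: real \<times> (real ^ 'n) \<times> (real ^ 'n). fst (snd z) + fst z *\<^sub>R snd (snd z) \<in> - \<Omega>}"
    proof -
      have "continuous_on UNIV (\<lambda>z :: real \<times> (real ^ 'n) \<times> (real ^ 'n). fst (snd z) + fst z *\<^sub>R snd (snd z))"
        by (intro continuous_intros)
      from closed_vimage[OF closed_Compl[OF assms] this] show ?thesis by (simp add: vimage_def)
    qed
    then have "closed ({z :: real \<times> (real ^ 'n) \<times> (real ^ 'n). fst (snd z) + fst z *\<^sub>R snd (snd z) \<in> - \<Omega>}
        \<inter> {-c..c} \<times> UNIV)"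
      by (intro closed_Int closed_Times) auto
    from closed_compact_projection[OF compact_Icc this, of "-c" c] show ?thesis
      by (rule back_subst[where P=closed]) (auto simp: C_def)
  qed
  then have Cb: "C c \<in> sets borel" for c by (rule borel_closed)
  have "{p \<in> space borel. dir_dist \<Omega> (snd p) (fst p) < a} = (\<Union>c\<in>{c \<in> \<rat>. ennreal c < a}. C c)"
  proof (intro set_eqI iffI)
    fix p assume "p \<in> {p \<in> space borel. dir_dist \<Omega> (snd p) (fst p) < a}"
    then obtain t where t: "ennreal \<bar>t\<bar> < a" "fst p + t *\<^sub>R snd p \<notin> \<Omega>"
      by (auto simp: dir_dist_less_iff)
    obtain c where c: "c \<in> \<rat>" "\<bar>t\<bar> \<le> c" "ennreal c < a"
    proof (cases a)
      case (real r)
      then have "\<bar>t\<bar> < r" using t by (simp add: ennreal_less_iff)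
      from Rats_dense_in_real[OF this] obtain c where "c \<in> \<rat>" "\<bar>t\<bar> < c" "c < r" by auto
      then show ?thesis using real by (intro that[of c]) (auto simp: ennreal_less_iff)
    next
      case top
      obtain c where "c \<in> \<rat>" "\<bar>t\<bar> < c" "c < \<bar>t\<bar> + 1" using Rats_dense_in_real[of "\<bar>t\<bar>" "\<bar>t\<bar> + 1"] by auto
      then show ?thesis using top by (intro that[of c]) auto
    qed
    then have "p \<in> C c"
      using t by (auto simp: C_def abs_le_iff intro!: exI[of _ t])
    then show "p \<in> (\<Union>c\<in>{c \<in> \<rat>. ennreal c < a}. C c)"
      using c by blast
  next
    fix p assume "p \<in> (\<Union>c\<in>{c \<in> \<rat>. ennreal c < a}. C c)"
    then obtain c t where "ennreal c < a" "t \<in> {-c..c}" "fst p + t *\<^sub>R snd p \<notin> \<Omega>"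
      by (auto simp: C_def)
    moreover from this have "\<bar>t\<bar> \<le> c" by (simp add: abs_le_iff)
    ultimately have "ennreal \<bar>t\<bar> < a" "fst p + t *\<^sub>R snd p \<notin> \<Omega>"
      using le_less_trans[OF ennreal_leI] by blast+
    then show "p \<in> {p \<in> space borel. dir_dist \<Omega> (snd p) (fst p) < a}"
      by (auto simp: dir_dist_less_iff)
  qed
  moreover have "(\<Union>c\<in>{c \<in> \<rat>. ennreal c < a}. C c) \<in> sets borel"
    using Cb by (intro sets.countable_UN'' countable_subset[OF _ countable_rat]) auto
  ultimately show "{p \<in> space borel. dir_dist \<Omega> (snd p) (fst p) < a} \<in> sets borel" by simp
qed

text \<open>On the support of a test function \<open>dir_dist\<close> is bounded below, so no information is lost by
  passing to real values there.\<close>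
definition dir_weight :: "(real ^ 'n) set \<Rightarrow> real ^ 'n \<Rightarrow> real ^ 'n \<Rightarrow> real" where
  "dir_weight \<Omega> e x = enn2real (inverse ((dir_dist \<Omega> e x)\<^sup>2))"

lemma dir_weight_nonneg: "dir_weight \<Omega> e x \<ge> 0"
  by (simp add: dir_weight_def)

lemma ennreal_inverse_antimono:
  fixes a b :: ennreal
  assumes "a \<le> b" shows "inverse b \<le> inverse a"
proof (cases "a = 0 \<or> b = top")
  case False
  then obtain r r' where "a = ennreal r" "b = ennreal r'" "0 < r" "0 \<le> r'"
    using assms by (cases a; cases b) (auto simp: top_unique)
  then show ?thesis
    using assms by (simp add: inverse_ennreal le_imp_inverse_le)
qed auto

lemma inverse_dir_dist_le:
  assumes d: "\<delta> > 0" and "\<And>t. \<bar>t\<bar> < \<delta> \<Longrightarrow> x + t *\<^sub>R e \<in> \<Omega>"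
  shows "inverse ((dir_dist \<Omega> e x)\<^sup>2) \<le> ennreal (1 / \<delta>\<^sup>2)"
proof -
  have "ennreal (\<delta>\<^sup>2) \<le> (dir_dist \<Omega> e x)\<^sup>2"
    using power_mono[OF dir_dist_ge[OF assms(2)], of \<delta> 2] d by (simp add: ennreal_power)
  then have "inverse ((dir_dist \<Omega> e x)\<^sup>2) \<le> inverse (ennreal (\<delta>\<^sup>2))"
    by (rule ennreal_inverse_antimono)
  also have "\<dots> = ennreal (1 / \<delta>\<^sup>2)" using d by (simp add: inverse_ennreal divide_inverse)
  finally show ?thesis .
qed

lemma dir_weight_le:
  assumes "\<delta> > 0" and "\<And>t. \<bar>t\<bar> < \<delta> \<Longrightarrow> x + t *\<^sub>R e \<in> \<Omega>"
  shows "dir_weight \<Omega> e x \<le> 1 / \<delta>\<^sup>2"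
  unfolding dir_weight_def using enn2real_mono[OF inverse_dir_dist_le[OF assms]] assms(1) by simp

lemma borel_measurable_dir_weight:
  fixes \<Omega> :: "(real ^ 'n) set"
  assumes "open \<Omega>"
  shows "(\<lambda>p. dir_weight \<Omega> (snd p) (fst p)) \<in> borel_measurable borel"
  unfolding dir_weight_def using borel_measurable_dir_dist[OF assms] by measurable

lemma borel_measurable_dir_weight_fixed [measurable]:
  fixes \<Omega> :: "(real ^ 'n) set"
  assumes "open \<Omega>"
  shows "dir_weight \<Omega> e \<in> borel_measurable borel"
proof -
  have "(\<lambda>x. (x, e)) \<in> borel \<rightarrow>\<^sub>M borel" by (intro borel_measurable_continuous_onI continuous_intros)
  from measurable_compose[OF this borel_measurable_dir_weight[OF assms]] show ?thesis by simp
qed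

lemma test_function_differentiable: "u \<in> test_functions \<Omega> \<Longrightarrow> u differentiable (at x)"
proof -
  assume "u \<in> test_functions \<Omega>"
  then have "C_k (Suc 0) u" unfolding test_functions_def by blast
  then show ?thesis by simp
qed

lemma test_function_has_derivative:
  "u \<in> test_functions \<Omega> \<Longrightarrow> (u has_derivative frechet_derivative u (at x)) (at x)"
  by (simp add: test_function_differentiable frechet_derivative_works[symmetric])

lemma test_function_continuous: "u \<in> test_functions \<Omega> \<Longrightarrow> continuous_on S u"
  by (intro continuous_at_imp_continuous_on ballI has_derivative_continuous[OF test_function_has_derivative])

lemma test_function_derivative_continuous:
  assumes "u \<in> test_functions \<Omega>" shows "continuous_on S (\<lambda>x. frechet_derivative u (at x) v)"
proof -
  have "C_k (Suc 0) u" using assms unfolding test_functions_def by blast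
  then show ?thesis by (simp add: continuous_on_subset[OF _ subset_UNIV])
qed

lemma test_function_linear: "u \<in> test_functions \<Omega> \<Longrightarrow> linear (frechet_derivative u (at x))"
  by (rule has_derivative_linear[OF test_function_has_derivative])

lemma test_function_derivative_sum:
  fixes u :: "real ^ 'n \<Rightarrow> complex"
  assumes "u \<in> test_functions \<Omega>"
  shows "frechet_derivative u (at x) v = (\<Sum>i\<in>UNIV. of_real (v $ i) * gradient u x $ i)"
proof -
  have "frechet_derivative u (at x) v = frechet_derivative u (at x) (\<Sum>i\<in>UNIV. v $ i *\<^sub>R axis i 1)"
    by (simp only: sum_axis_expansion)
  also have "\<dots> = (\<Sum>i\<in>UNIV. v $ i *\<^sub>R frechet_derivative u (at x) (axis i 1))"
    using test_function_linear[OF assms] by (simp add: linear_sum linear_scale)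
  finally show ?thesis by (simp add: gradient_def scaleR_conv_of_real)
qed

lemma test_function_derivative_joint_continuous:
  fixes u :: "real ^ 'n \<Rightarrow> complex"
  assumes "u \<in> test_functions \<Omega>"
  shows "continuous_on UNIV (\<lambda>p. frechet_derivative u (at (fst p)) (snd p))"
proof -
  have eq: "frechet_derivative u (at (fst p)) (snd p) =
      (\<Sum>i\<in>UNIV. of_real (snd p $ i) * frechet_derivative u (at (fst p)) (axis i 1))" for p
    by (subst test_function_derivative_sum[OF assms]) (simp add: gradient_def)
  have "continuous_on UNIV (\<lambda>p. \<Sum>i\<in>UNIV. of_real (snd p $ i) * frechet_derivative u (at (fst p)) (axis i 1))"
    by (intro continuous_intros
      continuous_on_compose2[OF test_function_derivative_continuous[OF assms, of UNIV]]) auto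
  then show ?thesis by (simp only: eq[symmetric])
qed

definition supp :: "(real ^ 'n \<Rightarrow> complex) \<Rightarrow> (real ^ 'n) set" where
  "supp u = closure {x. u x \<noteq> 0}"

lemma test_function_supp:
  assumes "u \<in> test_functions \<Omega>"
  shows "compact (supp u)" "supp u \<subseteq> \<Omega>" "x \<notin> supp u \<Longrightarrow> u x = 0"
  using assms closure_subset[of "{x. u x \<noteq> 0}"] by (auto simp: test_functions_def supp_def)

lemma test_function_derivative_off_supp:
  assumes u: "u \<in> test_functions \<Omega>" and x: "x \<notin> supp u"
  shows "frechet_derivative u (at x) v = 0"
proof -
  have op: "open (- supp u)" by (simp add: supp_def open_Compl)
  have "(u has_derivative (\<lambda>_. 0)) (at x)"
  proof (rule has_derivative_transform_within_open[OF has_derivative_const op])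
    show "x \<in> - supp u" using x by simp
    show "0 = u y" if "y \<in> - supp u" for y
      using test_function_supp(3)[OF u, of y] that by simp
  qed
  from has_derivative_unique[OF test_function_has_derivative[OF u] this]
  show ?thesis by simp
qed

lemma test_function_line_derivative:
  assumes "u \<in> test_functions \<Omega>"
  shows "((\<lambda>t. u (x + t *\<^sub>R v)) has_vector_derivative frechet_derivative u (at (x + t *\<^sub>R v)) v) (at t)"
proof -
  have "((\<lambda>t. x + t *\<^sub>R v) has_derivative (\<lambda>h. h *\<^sub>R v)) (at t)"
    by (auto intro!: derivative_eq_intros)
  from has_derivative_compose[OF this test_function_has_derivative[OF assms]]
  show ?thesis
    by (simp add: has_vector_derivative_def linear_scale[OF test_function_linear[OF assms]])
qed

definition hardy_density :: "(real ^ 'n) set \<Rightarrow> (real ^ 'n \<Rightarrow> complex) \<Rightarrow> real ^ 'n \<Rightarrow> real ^ 'n \<Rightarrow> real" where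
  "hardy_density \<Omega> u e x =
    (cmod (frechet_derivative u (at x) e))\<^sup>2 - (cmod (u x))\<^sup>2 * dir_weight \<Omega> e x / 4"

lemma hardy_density_off_supp:
  "u \<in> test_functions \<Omega> \<Longrightarrow> x \<notin> supp u \<Longrightarrow> hardy_density \<Omega> u e x = 0"
  by (simp add: hardy_density_def test_function_derivative_off_supp test_function_supp(3))

lemma borel_measurable_hardy_density:
  fixes u :: "real ^ 'n \<Rightarrow> complex"
  assumes "open \<Omega>" "u \<in> test_functions \<Omega>"
  shows "(\<lambda>p. hardy_density \<Omega> u (snd p) (fst p)) \<in> borel_measurable borel"
proof -
  have [measurable]: "(\<lambda>p. dir_weight \<Omega> (snd p) (fst p)) \<in> borel_measurable borel"
    by (rule borel_measurable_dir_weight[OF assms(1)])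
  have [measurable]: "(\<lambda>p. frechet_derivative u (at (fst p)) (snd p)) \<in> borel_measurable borel"
    by (rule borel_measurable_continuous_onI[OF test_function_derivative_joint_continuous[OF assms(2)]])
  have [measurable]: "(\<lambda>p::(real^'n) \<times> (real^'n). u (fst p)) \<in> borel_measurable borel"
    by (intro borel_measurable_continuous_onI continuous_on_compose2[OF test_function_continuous[OF assms(2), of UNIV]]
        continuous_intros) auto
  show ?thesis unfolding hardy_density_def by measurable
qed

lemma borel_measurable_hardy_density_fixed:
  fixes u :: "real ^ 'n \<Rightarrow> complex"
  assumes "open \<Omega>" "u \<in> test_functions \<Omega>"
  shows "hardy_density \<Omega> u e \<in> borel_measurable borel"
proof -
  have "(\<lambda>x. (x, e)) \<in> borel \<rightarrow>\<^sub>M borel" by (intro borel_measurable_continuous_onI continuous_intros)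
  from measurable_compose[OF this borel_measurable_hardy_density[OF assms]] show ?thesis by simp
qed

text \<open>A margin that serves all directions of norm at most \<open>2\<close> at once: it bounds the Hardy weight
  uniformly, which makes the energy density bounded and integrable.\<close>
lemma test_function_supp_distance:
  fixes u :: "real ^ 'n \<Rightarrow> complex"
  assumes "open \<Omega>" "u \<in> test_functions \<Omega>"
  obtains \<delta> where "\<delta> > 0" "\<And>x e t. x \<in> supp u \<Longrightarrow> norm e \<le> 2 \<Longrightarrow> \<bar>t\<bar> < \<delta> \<Longrightarrow> x + t *\<^sub>R e \<in> \<Omega>"
proof -
  obtain d where d: "d > 0" "(\<Union>x\<in>supp u. ball x d) \<subseteq> \<Omega>"
    using compact_subset_open_imp_ball_epsilon_subset[OF _ assms(1)] test_function_supp[OF assms(2)]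
    by metis
  show ?thesis
  proof (rule that[of "d / 2"])
    fix x e :: "real ^ 'n" and t :: real
    assume x: "x \<in> supp u" and e: "norm e \<le> 2" and t: "\<bar>t\<bar> < d / 2"
    have "\<bar>t\<bar> * norm e \<le> \<bar>t\<bar> * 2" using e by (intro mult_left_mono) auto
    then have "norm (t *\<^sub>R e) < d" using t by simp
    then have "x + t *\<^sub>R e \<in> ball x d" by (simp add: dist_norm)
    then show "x + t *\<^sub>R e \<in> \<Omega>" using d(2) x by blast
  qed (use d in auto)
qed

lemma hardy_density_bounded:
  fixes u :: "real ^ 'n \<Rightarrow> complex"
  assumes "open \<Omega>" "u \<in> test_functions \<Omega>"
  obtains B where "\<And>x e. norm e \<le> 2 \<Longrightarrow> \<bar>hardy_density \<Omega> u e x\<bar> \<le> B"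
proof -
  obtain \<delta> where \<delta>: "\<delta> > 0" "\<And>x e t. x \<in> supp u \<Longrightarrow> norm e \<le> 2 \<Longrightarrow> \<bar>t\<bar> < \<delta> \<Longrightarrow> x + t *\<^sub>R e \<in> \<Omega>"
    using test_function_supp_distance[OF assms] by metis
  note K = test_function_supp(1)[OF assms(2)]
  obtain B where B: "\<And>x. x \<in> supp u \<Longrightarrow> cmod (u x) \<le> B"
    using compact_imp_bounded[OF compact_continuous_image[OF test_function_continuous[OF assms(2)] K]]
    by (auto simp: bounded_iff)
  have "compact (supp u \<times> cball (0::real^'n) 2)" using K by (intro compact_Times) auto
  from compact_imp_bounded[OF compact_continuous_image[OF
        continuous_on_subset[OF test_function_derivative_joint_continuous[OF assms(2)]] this]]
  obtain B' where "\<forall>x\<in>supp u. \<forall>e\<in>cball 0 2. cmod (frechet_derivative u (at x) e) \<le> B'"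
    by (auto simp: bounded_iff)
  then have B': "cmod (frechet_derivative u (at x) e) \<le> B'" if "x \<in> supp u" "norm e \<le> 2" for x e
    using that by simp
  show ?thesis
  proof (rule that[of "B'\<^sup>2 + B\<^sup>2 * (1 / \<delta>\<^sup>2) / 4"])
    fix x e :: "real ^ 'n" assume e: "norm e \<le> 2"
    show "\<bar>hardy_density \<Omega> u e x\<bar> \<le> B'\<^sup>2 + B\<^sup>2 * (1 / \<delta>\<^sup>2) / 4"
    proof (cases "x \<in> supp u")
      case x: True
      have "\<bar>hardy_density \<Omega> u e x\<bar> \<le>
          (cmod (frechet_derivative u (at x) e))\<^sup>2 + (cmod (u x))\<^sup>2 * dir_weight \<Omega> e x / 4"
        unfolding hardy_density_def using dir_weight_nonneg[of \<Omega> e x] by (simp add: abs_le_iff)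
      also have "\<dots> \<le> B'\<^sup>2 + B\<^sup>2 * (1 / \<delta>\<^sup>2) / 4"
        using dir_weight_nonneg[of \<Omega> e x] dir_weight_le[OF \<delta>(1) \<delta>(2)[OF x e]] B[OF x] B'[OF x e]
        by (intro add_mono divide_right_mono mult_mono power_mono) auto
      finally show ?thesis .
    qed (simp add: hardy_density_off_supp[OF assms(2)])
  qed
qed

lemma integrable_hardy_density:
  fixes u :: "real ^ 'n \<Rightarrow> complex"
  assumes "open \<Omega>" "u \<in> test_functions \<Omega>" and e: "norm e \<le> 2"
  shows "integrable lborel (hardy_density \<Omega> u e)"
proof -
  obtain B where B: "\<And>x e. norm e \<le> 2 \<Longrightarrow> \<bar>hardy_density \<Omega> u e x\<bar> \<le> B"
    using hardy_density_bounded[OF assms(1,2)] by metis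
  note K = test_function_supp(1)[OF assms(2)]
  show ?thesis
    by (rule integrableI_bounded_set[of "supp u" _ _ B])
      (use emeasure_bounded_finite[OF compact_imp_bounded[OF K]] borel_compact[OF K] B e
        borel_measurable_hardy_density_fixed[OF assms(1,2)] hardy_density_off_supp[OF assms(2)] in auto)
qed

lemma integrable_test_function_powr:
  fixes u :: "real ^ 'n \<Rightarrow> complex"
  assumes "u \<in> test_functions \<Omega>" and q: "q > 0"
  shows "integrable lborel (\<lambda>x. cmod (u x) powr q)"
proof -
  note K = test_function_supp(1)[OF assms(1)]
  have c: "continuous_on S (\<lambda>x. cmod (u x) powr q)" for S
    using q by (intro continuous_on_powr' continuous_intros test_function_continuous[OF assms(1)]) auto
  obtain B where B: "\<And>x. x \<in> supp u \<Longrightarrow> norm (cmod (u x) powr q) \<le> B"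
    using compact_imp_bounded[OF compact_continuous_image[OF c K]] by (auto simp: bounded_iff)
  show ?thesis
    by (rule integrableI_bounded_set[of "supp u" _ _ B])
      (use emeasure_bounded_finite[OF compact_imp_bounded[OF K]] borel_compact[OF K] B
        borel_measurable_continuous_onI[OF c] test_function_supp(3)[OF assms(1)] in auto)
qed

text \<open>The slices of \<open>\<Omega>\<close> and of the support along a line are an open and a compact subset of the real
  line, and \<open>dir_weight\<close> is dominated by the one-dimensional Hardy weight of the slice of \<open>\<Omega>\<close>.\<close>
lemma line_hardy_sobolev:
  fixes u :: "real ^ 'n \<Rightarrow> complex"
  assumes \<Omega>: "open \<Omega>" and u: "u \<in> test_functions \<Omega>" and e: "e \<noteq> 0" and s: "s \<ge> 2"
  shows "integrable lborel (\<lambda>t. hardy_density \<Omega> u e (x + t *\<^sub>R e))"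
    and "(\<integral>t. hardy_density \<Omega> u e (x + t *\<^sub>R e) \<partial>lborel) \<ge> 0"
    and "cmod (u (x + t *\<^sub>R e)) powr s \<le> (3 * s + 2) *
      (sqrt (\<integral>t. hardy_density \<Omega> u e (x + t *\<^sub>R e) \<partial>lborel) *
       sqrt (\<integral>t. cmod (u (x + t *\<^sub>R e)) powr (2 * s - 2) \<partial>lborel))"
proof -
  define f where "f t = x + t *\<^sub>R e" for t :: real
  have fc: "continuous_on S f" for S unfolding f_def by (intro continuous_intros)
  have fm: "f \<in> borel_measurable borel" by (rule borel_measurable_continuous_onI[OF fc])
  have 1: "open (f -` \<Omega>)" using \<Omega> fc[of UNIV] continuous_open_vimage continuous_on_eq_continuous_at by blast
  have cl: "closed (f -` supp u)"
    using fc[of UNIV] compact_imp_closed[OF test_function_supp(1)[OF u]]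
    by (simp add: continuous_closed_vimage continuous_on_eq_continuous_at)
  obtain M where M: "\<And>y. y \<in> supp u \<Longrightarrow> norm y \<le> M"
    using compact_imp_bounded[OF test_function_supp(1)[OF u]] by (auto simp: bounded_iff)
  have "\<bar>t\<bar> \<le> (M + norm x) / norm e" if "t \<in> f -` supp u" for t
  proof -
    have "norm (t *\<^sub>R e) \<le> norm (f t) + norm x"
      using norm_triangle_ineq4[of "f t" x] by (simp add: f_def)
    also have "\<dots> \<le> M + norm x" using M that by auto
    finally show ?thesis using e by (simp add: field_simps)
  qed
  then have "bounded (f -` supp u)" by (auto simp: bounded_iff)
  with cl have 2: "compact (f -` supp u)" by (simp add: compact_eq_bounded_closed)
  have 3: "f -` supp u \<subseteq> f -` \<Omega>" using test_function_supp(2)[OF u] by auto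
  have 4: "dir_weight \<Omega> e (f t) \<le> 1 / \<delta>\<^sup>2"
    if "t \<in> f -` supp u" "\<delta> > 0" "ball t \<delta> \<subseteq> f -` \<Omega>" for t \<delta>
  proof (rule dir_weight_le[OF that(2)])
    fix r :: real assume "\<bar>r\<bar> < \<delta>"
    then have "t + r \<in> ball t \<delta>" by (simp add: dist_real_def)
    then have "f (t + r) \<in> \<Omega>" using that(3) by auto
    then show "f t + r *\<^sub>R e \<in> \<Omega>" by (simp add: f_def algebra_simps)
  qed
  note L = open_set_hardy_sobolev[where u="\<lambda>t. u (f t)" and u'="\<lambda>t. frechet_derivative u (at (f t)) e"
      and W="\<lambda>t. dir_weight \<Omega> e (f t)", OF s 1 2 3, folded hardy_density_def]
  have p1: "u (f t) = 0" if "t \<notin> f -` supp u" for t using that test_function_supp(3)[OF u] by auto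
  have p2: "((\<lambda>t. u (f t)) has_vector_derivative frechet_derivative u (at (f t)) e) (at t)" for t
    unfolding f_def by (rule test_function_line_derivative[OF u])
  have p3: "continuous_on UNIV (\<lambda>t. frechet_derivative u (at (f t)) e)"
    by (rule continuous_on_compose2[OF test_function_derivative_continuous[OF u, of UNIV] fc]) simp
  have p4: "(\<lambda>t. dir_weight \<Omega> e (f t)) \<in> borel_measurable borel"
    by (rule measurable_compose[OF fm borel_measurable_dir_weight_fixed[OF \<Omega>]])
  show "integrable lborel (\<lambda>t. hardy_density \<Omega> u e (x + t *\<^sub>R e))"
    unfolding f_def[symmetric]
    by (rule L(1)) (erule p1 | rule p2 p3 p4 dir_weight_nonneg | erule (2) 4)+
  show "(\<integral>t. hardy_density \<Omega> u e (x + t *\<^sub>R e) \<partial>lborel) \<ge> 0"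
    unfolding f_def[symmetric]
    by (rule L(2)) (erule p1 | rule p2 p3 p4 dir_weight_nonneg | erule (2) 4)+
  show "cmod (u (x + t *\<^sub>R e)) powr s \<le> (3 * s + 2) *
      (sqrt (\<integral>t. hardy_density \<Omega> u e (x + t *\<^sub>R e) \<partial>lborel) *
       sqrt (\<integral>t. cmod (u (x + t *\<^sub>R e)) powr (2 * s - 2) \<partial>lborel))"
    unfolding f_def[symmetric]
    by (rule L(3)) (erule p1 | rule p2 p3 p4 dir_weight_nonneg | erule (2) 4)+
qed

section \<open>The Sobolev inequality for a frame of directions\<close>

definition frame_map :: "('n::finite \<Rightarrow> real ^ 'n) \<Rightarrow> ('n \<Rightarrow> real) \<Rightarrow> real ^ 'n" where
  "frame_map e y = (\<Sum>i\<in>UNIV. y i *\<^sub>R e i)"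

text \<open>The vectors \<open>e\<close> form a basis, and \<open>\<kappa>\<close> is the inverse of the absolute value of its
  determinant.\<close>
definition frame_scale :: "('n::finite \<Rightarrow> real ^ 'n) \<Rightarrow> real \<Rightarrow> bool" where
  "frame_scale e \<kappa> \<longleftrightarrow> \<kappa> > 0 \<and>
    distr (PiM UNIV (\<lambda>_. lborel)) borel (frame_map e) = density lborel (\<lambda>_. ennreal \<kappa>)"

lemma measurable_frame_map [measurable]:
  "frame_map e \<in> PiM UNIV (\<lambda>_. lborel) \<rightarrow>\<^sub>M borel"
  unfolding frame_map_def by measurable

lemma frame_map_update:
  "frame_map e (y(i := t)) = frame_map e (y(i := 0)) + t *\<^sub>R e i"
proof -
  have "frame_map e (y(i := t)) = t *\<^sub>R e i + (\<Sum>j\<in>UNIV - {i}. y j *\<^sub>R e j)" for t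
    unfolding frame_map_def by (subst sum.remove[of _ i]) auto
  from this[of t] this[of 0] show ?thesis by simp
qed

lemma frame_integral:
  fixes f :: "real ^ 'n::finite \<Rightarrow> real"
  assumes F: "frame_scale e \<kappa>" and f: "integrable lborel f"
  shows "integrable (PiM UNIV (\<lambda>_. lborel)) (\<lambda>y. f (frame_map e y))"
    and "(\<integral>y. f (frame_map e y) \<partial>PiM UNIV (\<lambda>_. lborel)) = \<kappa> * (\<integral>x. f x \<partial>lborel)"
proof -
  have k: "\<kappa> > 0" and D: "distr (PiM UNIV (\<lambda>_. lborel)) borel (frame_map e) = density lborel (\<lambda>_. ennreal \<kappa>)"
    using F by (auto simp: frame_scale_def)
  have fm: "f \<in> borel_measurable borel" using f by simp
  have "integrable (density lborel (\<lambda>_. ennreal \<kappa>)) f"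
    using f k fm by (subst integrable_density) auto
  then show "integrable (PiM UNIV (\<lambda>_. lborel)) (\<lambda>y. f (frame_map e y))"
    unfolding D[symmetric] by (rule integrable_distr[OF measurable_frame_map])
  have "(\<integral>y. f (frame_map e y) \<partial>PiM UNIV (\<lambda>_. lborel)) =
      (\<integral>x. f x \<partial>density lborel (\<lambda>_. ennreal \<kappa>))"
    unfolding D[symmetric] by (rule integral_distr[symmetric, OF measurable_frame_map fm])
  also have "\<dots> = (\<integral>x. \<kappa> *\<^sub>R f x \<partial>lborel)"
    using k fm by (intro integral_density) auto
  finally show "(\<integral>y. f (frame_map e y) \<partial>PiM UNIV (\<lambda>_. lborel)) = \<kappa> * (\<integral>x. f x \<partial>lborel)"
    by simp
qed

lemma frame_slice_integral:
  fixes f :: "real ^ 'n::finite \<Rightarrow> real"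
  assumes F: "frame_scale e \<kappa>" and f: "integrable lborel f"
  shows "integrable (PiM (UNIV - {i}) (\<lambda>_. lborel)) (\<lambda>y. \<integral>t. f (frame_map e (y(i := 0)) + t *\<^sub>R e i) \<partial>lborel)"
    and "(\<integral>y. \<integral>t. f (frame_map e (y(i := 0)) + t *\<^sub>R e i) \<partial>lborel \<partial>PiM (UNIV - {i}) (\<lambda>_. lborel)) =
      \<kappa> * (\<integral>x. f x \<partial>lborel)"
proof -
  have U: "insert i (UNIV - {i}) = UNIV" by auto
  have int: "integrable (PiM (insert i (UNIV - {i})) (\<lambda>_. lborel)) (\<lambda>y. f (frame_map e y))"
    unfolding U by (rule frame_integral(1)[OF F f])
  show "integrable (PiM (UNIV - {i}) (\<lambda>_. lborel)) (\<lambda>y. \<integral>t. f (frame_map e (y(i := 0)) + t *\<^sub>R e i) \<partial>lborel)"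
    using lborel_product.product_integrable_insert[OF _ _ int]
    by (simp add: frame_map_update[symmetric])
  show "(\<integral>y. \<integral>t. f (frame_map e (y(i := 0)) + t *\<^sub>R e i) \<partial>lborel \<partial>PiM (UNIV - {i}) (\<lambda>_. lborel)) =
      \<kappa> * (\<integral>x. f x \<partial>lborel)"
    using lborel_product.product_integral_insert[OF _ _ int] frame_integral(2)[OF F f]
    unfolding U by (simp add: frame_map_update[symmetric])
qed

text \<open>The energy in direction \<open>e i\<close> is an integral of the one-dimensional energies of the lines in
  this direction.\<close>
lemma frame_hardy_nonneg:
  fixes u :: "real ^ 'n::finite \<Rightarrow> complex"
  assumes \<Omega>: "open \<Omega>" and u: "u \<in> test_functions \<Omega>"
    and F: "frame_scale e \<kappa>" and e: "e i \<noteq> 0" "norm (e i) \<le> 2"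
  shows "(\<integral>x. hardy_density \<Omega> u (e i) x \<partial>lborel) \<ge> 0"
proof -
  have k: "\<kappa> > 0" using F by (simp add: frame_scale_def)
  have "0 \<le> (\<integral>y. \<integral>t. hardy_density \<Omega> u (e i) (frame_map e (y(i := 0)) + t *\<^sub>R e i) \<partial>lborel
      \<partial>PiM (UNIV - {i}) (\<lambda>_. lborel))"
    by (intro Bochner_Integration.integral_nonneg line_hardy_sobolev(2)[OF \<Omega> u e(1), of 2]) simp
  also have "\<dots> = \<kappa> * (\<integral>x. hardy_density \<Omega> u (e i) x \<partial>lborel)"
    by (rule frame_slice_integral(2)[OF F integrable_hardy_density[OF \<Omega> u e(2)]])
  finally show ?thesis using k by (simp add: zero_le_mult_iff)
qed

lemma frame_scale_orthogonal:
  fixes R :: "real ^ 'n::finite \<Rightarrow> real ^ 'n"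
  assumes R: "orthogonal_transformation R"
  shows "frame_scale (\<lambda>i. R (axis i 1)) 1"
proof -
  have lin: "linear R" using R by (rule orthogonal_transformation_linear)
  have Rm: "R \<in> borel_measurable borel"
    using lin linear_continuous_on linear_conv_bounded_linear by (auto intro!: borel_measurable_continuous_onI)
  have "frame_map (\<lambda>i. R (axis i 1)) y = R (vec_lambda y)" for y
  proof -
    have "vec_lambda y = (\<Sum>i\<in>UNIV. y i *\<^sub>R axis i (1::real))"
      using sum_axis_expansion[of "vec_lambda y"] by simp
    then have "R (vec_lambda y) = R (\<Sum>i\<in>UNIV. y i *\<^sub>R axis i 1)" by simp
    then show ?thesis
      by (simp add: frame_map_def linear_sum[OF lin] linear_scale[OF lin])
  qed
  then have "distr (PiM UNIV (\<lambda>_. lborel)) borel (frame_map (\<lambda>i. R (axis i 1))) =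
      distr (distr (PiM UNIV (\<lambda>_. lborel)) borel vec_lambda) borel R"
    using measurable_vec_lambda_PiM Rm by (subst distr_distr) (auto simp: o_def intro!: distr_cong)
  also have "\<dots> = lborel"
    by (simp add: distr_PiM_lborel_vec distr_lborel_orthogonal[OF R])
  finally show ?thesis by (simp add: frame_scale_def density_1)
qed

lemma hardy_energy_nonneg:
  fixes u :: "real ^ 'n::finite \<Rightarrow> complex"
  assumes \<Omega>: "open \<Omega>" and u: "u \<in> test_functions \<Omega>" and e: "norm e = 1"
  shows "(\<integral>x. hardy_density \<Omega> u e x \<partial>lborel) \<ge> 0"
proof -
  obtain i :: 'n where True by simp
  have n: "norm (axis i 1 :: real ^ 'n) = norm e" using e by simp
  obtain R :: "real ^ 'n \<Rightarrow> real ^ 'n" where R: "orthogonal_transformation R" "R (axis i 1) = e"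
    by (rule orthogonal_transformation_exists[OF n])
  show ?thesis
    by (rule frame_hardy_nonneg[OF \<Omega> u frame_scale_orthogonal[OF R(1)], of i, unfolded R(2)])
      (use e in auto)
qed

lemma ennreal_prod_mono:
  fixes f g :: "'i \<Rightarrow> ennreal"
  assumes "\<And>i. i \<in> A \<Longrightarrow> f i \<le> g i"
  shows "prod f A \<le> prod g A"
  using assms by (induction A rule: infinite_finite_induct) (auto intro!: mult_mono)

text \<open>The Gagliardo--Nirenberg argument. For each \<open>i\<close> the one-dimensional inequality bounds
  \<open>|u|\<^sup>s\<close> by \<open>C (a\<^sub>i b\<^sub>i)\<^sup>1\<^sup>/\<^sup>2\<close>, where \<open>a\<^sub>i\<close> (energy) and \<open>b\<^sub>i\<close> (integral of \<open>|u|\<^sup>q\<close>) belong to the line in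
  direction \<open>e i\<close> and so do not depend on the \<open>i\<close>-th coordinate. Loomis--Whitney bounds the integral of
  the product of the \<open>N\<close> bounds to the power \<open>1 / (N - 1)\<close>. As \<open>s N / (N - 1) = q\<close>, the result is
  \<open>X \<le> (C (X Y)\<^sup>1\<^sup>/\<^sup>2) powr (N / (N - 1))\<close> with \<open>X = \<kappa> Q\<close>, \<open>Y = \<kappa> E\<close>. Both sides contain \<open>X\<close>; the
  power on the right is smaller than \<open>1\<close> because \<open>N > 2\<close>, and cancelling leaves
  \<open>X powr ((N - 2) / N)\<close>.\<close>
lemma frame_sobolev:
  fixes u :: "real ^ 'n::finite \<Rightarrow> complex" and e :: "'n \<Rightarrow> real ^ 'n"
  defines "N \<equiv> real CARD('n)"
  defines "s \<equiv> 2 * (N - 1) / (N - 2)"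
  assumes n3: "CARD('n) \<ge> 3" and \<Omega>: "open \<Omega>" and u: "u \<in> test_functions \<Omega>"
    and F: "frame_scale e \<kappa>" and e: "\<And>i. e i \<noteq> 0" "\<And>i. norm (e i) \<le> 2"
    and E: "\<And>i. (\<integral>x. hardy_density \<Omega> u (e i) x \<partial>lborel) \<le> E"
  defines "Q \<equiv> (\<integral>x. cmod (u x) powr (2 * N / (N - 2)) \<partial>lborel)"
  shows "(\<kappa> * Q) powr ((N - 2) / N) \<le> (3 * s + 2)\<^sup>2 * (\<kappa> * E)"
proof -
  have N3: "N \<ge> 3" using n3 by (simp add: N_def)
  have s2: "s \<ge> 2" using N3 by (simp add: s_def field_simps)
  have q: "2 * s - 2 = 2 * N / (N - 2)" using N3 by (simp add: s_def field_simps)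
  have qpos: "2 * N / (N - 2) > 0" using N3 by simp
  have sq: "s * (N / (N - 1)) = 2 * N / (N - 2)"
  proof -
    have "s * (N / (N - 1)) = (2 * N * (N - 1)) / ((N - 2) * (N - 1))"
      by (simp add: s_def mult_ac)
    then show ?thesis using N3 by simp
  qed
  define C where "C = 3 * s + 2"
  have C: "C > 0" using s2 by (simp add: C_def)
  have k: "\<kappa> > 0" using F by (simp add: frame_scale_def)
  let ?P = "\<lambda>I :: 'n set. PiM I (\<lambda>_. lborel :: real measure)"
  define a where "a i y = (\<integral>t. hardy_density \<Omega> u (e i) (frame_map e (y(i := 0)) + t *\<^sub>R e i) \<partial>lborel)" for i y
  define b where "b i y = (\<integral>t. cmod (u (frame_map e (y(i := 0)) + t *\<^sub>R e i)) powr (2 * N / (N - 2)) \<partial>lborel)" for i y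
  note Qint = integrable_test_function_powr[OF u qpos]
  have a: "integrable (?P (UNIV - {i})) (a i)" "a i y \<ge> 0"
    "(\<integral>y. a i y \<partial>?P (UNIV - {i})) \<le> \<kappa> * E" for i y
  proof -
    note S = frame_slice_integral[OF F integrable_hardy_density[OF \<Omega> u e(2)], of i i]
    show "integrable (?P (UNIV - {i})) (a i)"
      using S(1) by (simp add: a_def[abs_def])
    show "a i y \<ge> 0"
      unfolding a_def by (rule line_hardy_sobolev(2)[OF \<Omega> u e(1) s2])
    show "(\<integral>y. a i y \<partial>?P (UNIV - {i})) \<le> \<kappa> * E"
      using S(2) E[of i] k by (simp add: a_def[abs_def])
  qed
  have b: "integrable (?P (UNIV - {i})) (b i)" "b i y \<ge> 0"
    "(\<integral>y. b i y \<partial>?P (UNIV - {i})) = \<kappa> * Q" for i y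
  proof -
    note S = frame_slice_integral[OF F Qint, of i]
    show "integrable (?P (UNIV - {i})) (b i)"
      using S(1) by (simp add: b_def[abs_def])
    show "b i y \<ge> 0"
      unfolding b_def by simp
    show "(\<integral>y. b i y \<partial>?P (UNIV - {i})) = \<kappa> * Q"
      using S(2) by (simp add: b_def[abs_def] Q_def)
  qed
  have E0: "\<kappa> * E \<ge> 0"
    using order_trans[OF Bochner_Integration.integral_nonneg a(3)] a(2) by blast
  have Q0: "\<kappa> * Q \<ge> 0" using k by (simp add: Q_def)
  define f where "f i y = ennreal C * (ennpow (ennreal (a i y)) (1/2) * ennpow (ennreal (b i y)) (1 - 1/2))" for i y
  have [measurable]: "a i \<in> borel_measurable (?P (UNIV - {i}))" "b i \<in> borel_measurable (?P (UNIV - {i}))" for i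
    using a(1)[of i] b(1)[of i] by simp_all
  have fm: "f i \<in> borel_measurable (?P (UNIV - {i}))" for i
    unfolding f_def by measurable
  have fint: "(\<integral>\<^sup>+ y. f i y \<partial>?P (UNIV - {i})) \<le> ennreal (C * (sqrt (\<kappa> * E) * sqrt (\<kappa> * Q)))" for i
  proof -
    have "(\<integral>\<^sup>+ y. f i y \<partial>?P (UNIV - {i})) = ennreal C *
      (\<integral>\<^sup>+ y. ennpow (ennreal (a i y)) (1/2) * ennpow (ennreal (b i y)) (1 - 1/2) \<partial>?P (UNIV - {i}))"
      unfolding f_def by (rule nn_integral_cmult) measurable
    also have "\<dots> \<le> ennreal C * (ennpow (\<integral>\<^sup>+ y. ennreal (a i y) \<partial>?P (UNIV - {i})) (1/2) *
        ennpow (\<integral>\<^sup>+ y. ennreal (b i y) \<partial>?P (UNIV - {i})) (1 - 1/2))"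
      by (intro mult_left_mono nn_integral_Holder2) auto
    also have "(\<integral>\<^sup>+ y. ennreal (a i y) \<partial>?P (UNIV - {i})) = ennreal (\<integral>y. a i y \<partial>?P (UNIV - {i}))"
      using a by (intro nn_integral_eq_integral) auto
    also have "(\<integral>\<^sup>+ y. ennreal (b i y) \<partial>?P (UNIV - {i})) = ennreal (\<kappa> * Q)"
      using b by (subst nn_integral_eq_integral) auto
    also have "ennreal C * (ennpow (ennreal (\<integral>y. a i y \<partial>?P (UNIV - {i}))) (1/2) * ennpow (ennreal (\<kappa> * Q)) (1 - 1/2))
        \<le> ennreal C * (ennpow (ennreal (\<kappa> * E)) (1/2) * ennpow (ennreal (\<kappa> * Q)) (1 - 1/2))"
      using a(3)[of i] by (intro mult_left_mono mult_right_mono ennpow_mono ennreal_leI) auto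
    also have "\<dots> = ennreal (C * (sqrt (\<kappa> * E) * sqrt (\<kappa> * Q)))"
      using E0 Q0 C by (simp add: ennpow_ennreal powr_half_sqrt ennreal_mult)
    finally show ?thesis .
  qed
  have pw: "ennreal (cmod (u (frame_map e y)) powr s) \<le> f i (restrict y (UNIV - {i}))" for i y
  proof -
    have y: "(restrict y (UNIV - {i}))(i := 0) = y(i := 0)" by auto
    have "frame_map e y = frame_map e (y(i := 0)) + y i *\<^sub>R e i"
      using frame_map_update[of e y i "y i"] by simp
    then have "cmod (u (frame_map e y)) powr s \<le> C * (sqrt (a i y) * sqrt (b i y))"
      using line_hardy_sobolev(3)[OF \<Omega> u e(1) s2, where x="frame_map e (y(i := 0))" and t="y i"]
      by (simp add: a_def b_def C_def q)
    moreover have "f i (restrict y (UNIV - {i})) = ennreal (C * (sqrt (a i y) * sqrt (b i y)))"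
    proof -
      have "a i (restrict y (UNIV - {i})) = a i y" "b i (restrict y (UNIV - {i})) = b i y"
        by (simp_all add: a_def b_def y)
      then show ?thesis
        using a(2) b(2) C by (simp add: f_def ennpow_ennreal powr_half_sqrt ennreal_mult)
    qed
    ultimately show ?thesis by (simp add: ennreal_leI)
  qed
  have cardN: "real (card (UNIV :: 'n set)) - 1 = N - 1" by (simp add: N_def)
  have "ennreal (\<kappa> * Q) = (\<integral>\<^sup>+ y. ennreal (cmod (u (frame_map e y)) powr (2 * N / (N - 2))) \<partial>?P UNIV)"
    using frame_integral[OF F Qint] by (subst nn_integral_eq_integral) (auto simp: Q_def)
  also have "\<dots> \<le> (\<integral>\<^sup>+ y. (\<Prod>i\<in>UNIV. ennpow (f i (restrict y (UNIV - {i}))) (1 / (N - 1))) \<partial>?P UNIV)"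
  proof (rule nn_integral_mono)
    fix y
    have "ennreal (cmod (u (frame_map e y)) powr (2 * N / (N - 2))) =
        (\<Prod>i\<in>(UNIV::'n set). ennpow (ennreal (cmod (u (frame_map e y)) powr s)) (1 / (N - 1)))"
      by (simp add: ennpow_ennreal powr_powr prod_ennreal ennreal_power sq[symmetric]
          powr_realpow'[symmetric] powr_power N_def[symmetric])
    also have "\<dots> \<le> (\<Prod>i\<in>UNIV. ennpow (f i (restrict y (UNIV - {i}))) (1 / (N - 1)))"
      using N3 by (intro ennreal_prod_mono ennpow_mono pw) auto
    finally show "ennreal (cmod (u (frame_map e y)) powr (2 * N / (N - 2))) \<le>
        (\<Prod>i\<in>UNIV. ennpow (f i (restrict y (UNIV - {i}))) (1 / (N - 1)))" .
  qed
  also have "\<dots> \<le> (\<Prod>i\<in>UNIV. ennpow (\<integral>\<^sup>+ y. f i y \<partial>?P (UNIV - {i})) (1 / (N - 1)))"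
    using lborel_product.loomis_whitney[of "UNIV :: 'n set" f] fm n3 unfolding cardN by simp
  also have "\<dots> \<le> (\<Prod>i\<in>(UNIV::'n set). ennpow (ennreal (C * (sqrt (\<kappa> * E) * sqrt (\<kappa> * Q)))) (1 / (N - 1)))"
    using N3 by (intro ennreal_prod_mono ennpow_mono fint) auto
  also have "\<dots> = ennreal ((C * (sqrt (\<kappa> * E) * sqrt (\<kappa> * Q))) powr (N / (N - 1)))"
  proof -
    define Z where "Z = C * (sqrt (\<kappa> * E) * sqrt (\<kappa> * Q))"
    have Z: "Z \<ge> 0" using C E0 Q0 by (simp add: Z_def)
    have "(Z powr (1 / (N - 1))) ^ CARD('n) = Z powr (1 / (N - 1) * real CARD('n))"
      by (simp add: powr_powr powr_realpow'[symmetric])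
    then show ?thesis
      using Z by (simp add: Z_def[symmetric] ennpow_ennreal ennreal_power N_def[symmetric])
  qed
  finally have main: "\<kappa> * Q \<le> (C * (sqrt (\<kappa> * E) * sqrt (\<kappa> * Q))) powr (N / (N - 1))"
    by (simp add: ennreal_le_iff)
  define X where "X = \<kappa> * Q"
  define Y where "Y = \<kappa> * E"
  have "X powr ((N - 2) / N) \<le> C\<^sup>2 * Y"
  proof (cases "X = 0")
    case True
    then show ?thesis using E0 by (simp add: Y_def)
  next
    case False
    then have X: "X > 0" using Q0 unfolding X_def by linarith
    have e1: "2 * (N - 1) / N = (N - 2) / N + 1" using N3 by (simp add: field_simps)
    have e2: "N / (N - 1) * (2 * (N - 1) / N) = 2" using N3 by (simp add: divide_eq_eq)
    have "X powr (2 * (N - 1) / N) \<le> ((C * (sqrt Y * sqrt X)) powr (N / (N - 1))) powr (2 * (N - 1) / N)"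
      using main N3 X unfolding X_def Y_def by (intro powr_mono2) auto
    also have "\<dots> = (C * (sqrt Y * sqrt X)) powr 2"
      by (simp only: powr_powr e2)
    also have "\<dots> = (C * (sqrt Y * sqrt X))\<^sup>2"
      using C X E0 by (intro powr_numeral) (simp add: Y_def)
    also have "\<dots> = C\<^sup>2 * Y * X"
      using X E0 by (simp add: power_mult_distrib Y_def)
    finally have "X powr (2 * (N - 1) / N) \<le> C\<^sup>2 * Y * X" .
    moreover have "X powr (2 * (N - 1) / N) = X powr ((N - 2) / N) * X"
      using X unfolding e1 powr_add by (simp only: powr_one order_less_imp_le)
    ultimately have "X powr ((N - 2) / N) * X \<le> C\<^sup>2 * Y * X" by (simp only:)
    then show ?thesis by (rule mult_right_le_imp_le[OF _ X])
  qed
  then show ?thesis by (simp add: X_def Y_def C_def)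
qed

text \<open>The two sides of the previous inequality scale differently in \<open>\<kappa>\<close>, and the quotient
  \<open>\<kappa> powr (2 / N)\<close> is at most \<open>4\<close>.\<close>
lemma near_axes_sobolev:
  fixes u :: "real ^ 'n::finite \<Rightarrow> complex" and e :: "'n \<Rightarrow> real ^ 'n"
  defines "N \<equiv> real CARD('n)"
  defines "s \<equiv> 2 * (N - 1) / (N - 2)"
  assumes n3: "CARD('n) \<ge> 3" and \<Omega>: "open \<Omega>" and u: "u \<in> test_functions \<Omega>"
    and e: "\<And>i. norm (e i) = 1" "\<And>i. norm (e i - axis i 1) \<le> 1 / (2 * real CARD('n))"
    and E: "\<And>i. (\<integral>x. hardy_density \<Omega> u (e i) x \<partial>lborel) \<le> E"
  shows "(\<integral>x. cmod (u x) powr (2 * N / (N - 2)) \<partial>lborel) powr ((N - 2) / N) \<le> 4 * (3 * s + 2)\<^sup>2 * E"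
proof -
  have N3: "N \<ge> 3" using n3 by (simp add: N_def)
  define Q where "Q = (\<integral>x. cmod (u x) powr (2 * N / (N - 2)) \<partial>lborel)"
  have Q0: "Q \<ge> 0" by (simp add: Q_def)
  obtain \<kappa> where k: "\<kappa> > 0" "\<kappa> \<le> 2 ^ CARD('n)"
    and D: "distr (PiM UNIV (\<lambda>_. lborel)) borel (\<lambda>y. \<Sum>i\<in>UNIV. y i *\<^sub>R e i) = density lborel (\<lambda>_. ennreal \<kappa>)"
    using distr_PiM_lborel_near_identity[of e] e(2) by auto
  have F: "frame_scale e \<kappa>"
    using k D by (simp add: frame_scale_def frame_map_def[abs_def])
  have e0: "e i \<noteq> 0" "norm (e i) \<le> 2" for i using e(1)[of i] by auto
  have E0: "E \<ge> 0"
    using hardy_energy_nonneg[OF \<Omega> u e(1)] E by (rule order_trans)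
  have "\<kappa> powr ((N - 2) / N) * Q powr ((N - 2) / N) \<le> (3 * s + 2)\<^sup>2 * (\<kappa> * E)"
    using frame_sobolev[OF n3 \<Omega> u F e0 E] k Q0
    unfolding s_def N_def Q_def by (simp add: powr_mult)
  also have "(3 * s + 2)\<^sup>2 * (\<kappa> * E) =
      \<kappa> powr ((N - 2) / N) * ((3 * s + 2)\<^sup>2 * (\<kappa> powr (2 / N) * E))"
  proof -
    have "\<kappa> powr ((N - 2) / N) * \<kappa> powr (2 / N) = \<kappa>"
      using k N3 by (simp add: powr_add[symmetric] add_divide_distrib[symmetric])
    then have "(3 * s + 2)\<^sup>2 * (\<kappa> * E) =
        (3 * s + 2)\<^sup>2 * ((\<kappa> powr ((N - 2) / N) * \<kappa> powr (2 / N)) * E)"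
      by (simp only:)
    then show ?thesis by (simp only: mult_ac)
  qed
  finally have "\<kappa> powr ((N - 2) / N) * Q powr ((N - 2) / N) \<le>
      \<kappa> powr ((N - 2) / N) * ((3 * s + 2)\<^sup>2 * (\<kappa> powr (2 / N) * E))" .
  then have "Q powr ((N - 2) / N) \<le> (3 * s + 2)\<^sup>2 * (\<kappa> powr (2 / N) * E)"
    using k by simp
  also have "\<dots> \<le> (3 * s + 2)\<^sup>2 * (4 * E)"
  proof (intro mult_left_mono mult_right_mono)
    have "\<kappa> powr (2 / N) \<le> (2 powr N) powr (2 / N)"
      using k N3 by (intro powr_mono2) (auto simp: N_def powr_realpow)
    also have "\<dots> = 4" using N3 by (simp add: powr_powr)
    finally show "\<kappa> powr (2 / N) \<le> 4" .
  qed (use E0 in auto)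
  finally show ?thesis by (simp add: Q_def mult_ac)
qed

section \<open>Averages over the sphere\<close>

abbreviation \<sigma> :: "(real ^ 'n) measure" where "\<sigma> \<equiv> surface_measure"

lemma measurable_ident_surface: "(\<lambda>x. x) \<in> \<sigma> \<rightarrow>\<^sub>M borel"
  unfolding surface_measure_def by (simp add: measurable_restrict_space1 measurable_cong_sets[OF sets_scale_measure refl])

lemma borel_measurable_surface: "f \<in> borel_measurable borel \<Longrightarrow> f \<in> borel_measurable \<sigma>"
  using measurable_compose[OF measurable_ident_surface] by auto

lemma nn_integral_surface:
  fixes f :: "real ^ 'n \<Rightarrow> ennreal"
  assumes f: "f \<in> borel_measurable borel"
  shows "(\<integral>\<^sup>+ e. f e \<partial>\<sigma>) =
    of_nat CARD('n) * (\<integral>\<^sup>+ x. f (sgn x) * indicator (ball 0 1 - {0}) x \<partial>lborel)"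
proof -
  let ?R = "restrict_space lborel (ball 0 1 - {0}) :: (real ^ 'n) measure"
  have m: "sgn \<in> ?R \<rightarrow>\<^sub>M restrict_space borel (sphere 0 1)"
    by (intro measurable_restrict_space2 measurable_restrict_space1)
      (auto simp: space_restrict_space norm_sgn)
  have f': "f \<in> borel_measurable (restrict_space borel (sphere 0 1))"
    using f by (rule measurable_restrict_space1)
  have "(\<integral>\<^sup>+ e. f e \<partial>\<sigma>) = of_nat CARD('n) * (\<integral>\<^sup>+ e. f e \<partial>distr ?R (restrict_space borel (sphere 0 1)) sgn)"
    unfolding surface_measure_def using f' by (intro nn_integral_scale_measure) auto
  also have "(\<integral>\<^sup>+ e. f e \<partial>distr ?R (restrict_space borel (sphere 0 1)) sgn) = (\<integral>\<^sup>+ x. f (sgn x) \<partial>?R)"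
    using m f' by (intro nn_integral_distr) (simp_all only: measurable_distr_eq1)
  also have "\<dots> = (\<integral>\<^sup>+ x. f (sgn x) * indicator (ball 0 1 - {0}) x \<partial>lborel)"
    by (rule nn_integral_restrict_space) auto
  finally show ?thesis .
qed

lemma emeasure_surface_space:
  "emeasure \<sigma> (sphere 0 1 :: (real ^ 'n) set) = of_nat CARD('n) * emeasure lborel (ball 0 1 - {0} :: (real ^ 'n) set)"
proof -
  have "{x \<in> ball 0 1 - {0}. sgn x \<in> sphere 0 1} = (ball 0 1 - {0} :: (real ^ 'n) set)"
    by (auto simp: norm_sgn)
  then show ?thesis by (subst emeasure_surface_measure) auto
qed

lemma finite_surface_measure: "finite_measure (\<sigma> :: (real ^ 'n) measure)"
proof
  have "emeasure lborel (ball 0 1 - {0} :: (real ^ 'n) set) < \<infinity>"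
    by (intro emeasure_bounded_finite bounded_subset[OF bounded_ball]) auto
  then show "emeasure \<sigma> (space \<sigma> :: (real ^ 'n) set) \<noteq> \<infinity>"
    unfolding space_surface_measure emeasure_surface_space by (simp add: ennreal_mult_eq_top_iff)
qed

lemma nn_integral_surface_orthogonal:
  fixes f :: "real ^ 'n \<Rightarrow> ennreal" and R :: "real ^ 'n \<Rightarrow> real ^ 'n"
  assumes R: "orthogonal_transformation R" and f: "f \<in> borel_measurable borel"
  shows "(\<integral>\<^sup>+ e. f (R e) \<partial>\<sigma>) = (\<integral>\<^sup>+ e. f e \<partial>\<sigma>)"
proof -
  have lin: "linear R" using R by (rule orthogonal_transformation_linear)
  have Rm[measurable]: "R \<in> borel_measurable borel"
    using lin linear_continuous_on linear_conv_bounded_linear by (auto intro!: borel_measurable_continuous_onI)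
  note f[measurable]
  have n: "norm (R x) = norm x" for x using R by (simp add: orthogonal_transformation_norm)
  have sg: "R (sgn x) = sgn (R x)" for x
    by (simp add: sgn_div_norm n linear_scale[OF lin])
  define A where "A = (ball 0 1 - {0} :: (real ^ 'n) set)"
  have [measurable]: "A \<in> sets borel" by (simp add: A_def)
  have ind: "indicator A x = (indicator A (R x) :: ennreal)" for x
    using n[of x] by (auto simp: A_def indicator_def)
  have "(\<integral>\<^sup>+ x. f (R (sgn x)) * indicator A x \<partial>lborel) =
      (\<integral>\<^sup>+ x. f (sgn (R x)) * indicator A (R x) \<partial>lborel)"
    by (intro nn_integral_cong) (simp only: sg ind[symmetric])
  also have "\<dots> = (\<integral>\<^sup>+ x. f (sgn x) * indicator A x \<partial>distr lborel borel R)"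
    by (rule nn_integral_distr[symmetric]) measurable
  also have "\<dots> = (\<integral>\<^sup>+ x. f (sgn x) * indicator A x \<partial>lborel)"
    by (simp only: distr_lborel_orthogonal[OF R])
  finally show ?thesis
    by (subst (1 2) nn_integral_surface) (simp_all add: A_def)
qed

text \<open>By rotation invariance the integral depends only on the norm of \<open>g\<close>, and for the \<open>N\<close>
  coordinate vectors the integrands add up to \<open>1\<close> on the sphere.\<close>
lemma nn_integral_surface_inner:
  fixes g :: "real ^ 'n"
  shows "(\<integral>\<^sup>+ e. ennreal ((e \<bullet> g)\<^sup>2) \<partial>\<sigma>) =
    ennreal ((norm g)\<^sup>2 * measure \<sigma> (sphere 0 1 :: (real ^ 'n) set) / real CARD('n))"
proof -
  interpret S: finite_measure "\<sigma> :: (real ^ 'n) measure" by (rule finite_surface_measure)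
  define I where "I g = (\<integral>\<^sup>+ e. ennreal ((e \<bullet> g)\<^sup>2) \<partial>\<sigma>)" for g :: "real ^ 'n"
  have mb: "(\<lambda>e. ennreal ((e \<bullet> g)\<^sup>2)) \<in> borel_measurable borel" for g :: "real ^ 'n" by measurable
  have Ieq: "I g = I h" if gh: "norm g = norm h" for g h
  proof -
    obtain R :: "real ^ 'n \<Rightarrow> real ^ 'n" where R: "orthogonal_transformation R" "R g = h"
      by (rule orthogonal_transformation_exists[OF gh])
    have "I h = (\<integral>\<^sup>+ e. ennreal ((R e \<bullet> h)\<^sup>2) \<partial>\<sigma>)"
      unfolding I_def by (rule nn_integral_surface_orthogonal[OF R(1) mb, symmetric])
    also have "\<dots> = I g"
      using R by (simp add: I_def orthogonal_transformation_def R(2)[symmetric])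
    finally show ?thesis ..
  qed
  let ?m = "measure \<sigma> (sphere 0 1 :: (real ^ 'n) set)"
  have unit: "of_nat CARD('n) * I b = ennreal ?m" if "norm b = 1" for b :: "real ^ 'n"
  proof -
    have "of_nat CARD('n) * I b = (\<Sum>k\<in>(UNIV::'n set). I (axis k 1))"
      using Ieq[of b "axis _ 1"] that by simp
    also have "\<dots> = (\<integral>\<^sup>+ e. (\<Sum>k\<in>(UNIV::'n set). ennreal ((e \<bullet> axis k 1)\<^sup>2)) \<partial>\<sigma>)"
      unfolding I_def by (rule nn_integral_sum[symmetric]) (rule borel_measurable_surface[OF mb])
    also have "\<dots> = (\<integral>\<^sup>+ e. 1 \<partial>(\<sigma> :: (real ^ 'n) measure))"
    proof (rule nn_integral_cong)
      fix e :: "real ^ 'n" assume "e \<in> space \<sigma>"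
      then have "norm e = 1" by (simp add: space_surface_measure)
      then have "(\<Sum>k\<in>UNIV. (e $ k)\<^sup>2) = 1"
        by (simp add: norm_vec_def L2_set_def real_sqrt_eq_1_iff)
      then show "(\<Sum>k\<in>(UNIV::'n set). ennreal ((e \<bullet> axis k 1)\<^sup>2)) = 1"
        by (simp add: inner_axis sum_ennreal)
    qed
    also have "\<dots> = ennreal ?m"
      by (simp add: space_surface_measure[symmetric] S.emeasure_eq_measure)
    finally show ?thesis .
  qed
  show ?thesis
  proof (cases "g = 0")
    case True
    then show ?thesis by simp
  next
    case False
    define b where "b = g /\<^sub>R norm g"
    have nb: "norm b = 1" using False by (simp add: b_def)
    have g: "g = norm g *\<^sub>R b" using False by (simp add: b_def)
    have "I g = (\<integral>\<^sup>+ e. ennreal ((norm g)\<^sup>2) * ennreal ((e \<bullet> b)\<^sup>2) \<partial>\<sigma>)"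
      unfolding I_def
      by (intro nn_integral_cong, subst (1) g) (simp add: power_mult_distrib ennreal_mult[symmetric])
    also have "\<dots> = ennreal ((norm g)\<^sup>2) * I b"
      unfolding I_def by (intro nn_integral_cmult borel_measurable_surface[OF mb])
    also have "I b = ennreal (1 / real CARD('n)) * (of_nat CARD('n) * I b)"
    proof -
      have "ennreal (1 / real CARD('n)) * of_nat CARD('n) = 1"
        by (simp add: ennreal_of_nat_eq_real_of_nat ennreal_mult[symmetric])
      then show ?thesis by (simp add: mult.assoc[symmetric])
    qed
    also have "of_nat CARD('n) * I b = ennreal ?m" by (rule unit[OF nb])
    finally show ?thesis
      by (simp add: I_def ennreal_mult[symmetric])
  qed
qed

lemma surface_integral_inner:
  fixes g :: "real ^ 'n"
  shows "integrable \<sigma> (\<lambda>e. (e \<bullet> g)\<^sup>2)"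
    and "(\<integral>e. (e \<bullet> g)\<^sup>2 \<partial>\<sigma>) = (norm g)\<^sup>2 * measure \<sigma> (sphere 0 1 :: (real ^ 'n) set) / real CARD('n)"
proof -
  have m: "(\<lambda>e. (e \<bullet> g)\<^sup>2) \<in> borel_measurable \<sigma>"
    by (rule borel_measurable_surface) measurable
  show "integrable \<sigma> (\<lambda>e. (e \<bullet> g)\<^sup>2)"
    using m by (intro integrableI_nonneg) (auto simp: nn_integral_surface_inner)
  show "(\<integral>e. (e \<bullet> g)\<^sup>2 \<partial>\<sigma>) = (norm g)\<^sup>2 * measure \<sigma> (sphere 0 1 :: (real ^ 'n) set) / real CARD('n)"
    using m by (subst integral_eq_nn_integral) (auto simp: nn_integral_surface_inner)
qed

lemma surface_integral_derivative:
  fixes u :: "real ^ 'n \<Rightarrow> complex"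
  assumes u: "u \<in> test_functions \<Omega>"
  shows "integrable \<sigma> (\<lambda>e. (cmod (frechet_derivative u (at x) e))\<^sup>2)"
    and "(\<integral>e. (cmod (frechet_derivative u (at x) e))\<^sup>2 \<partial>\<sigma>) =
      (norm (gradient u x))\<^sup>2 * measure \<sigma> (sphere 0 1 :: (real ^ 'n) set) / real CARD('n)"
proof -
  define a where "a = (\<chi> i. Re (gradient u x $ i))"
  define b where "b = (\<chi> i. Im (gradient u x $ i))"
  have eq: "(cmod (frechet_derivative u (at x) e))\<^sup>2 = (e \<bullet> a)\<^sup>2 + (e \<bullet> b)\<^sup>2" for e
    unfolding test_function_derivative_sum[OF u] cmod_power2
    by (simp add: a_def b_def inner_vec_def)
  have ab: "(norm (gradient u x))\<^sup>2 = (norm a)\<^sup>2 + (norm b)\<^sup>2"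
    by (simp add: norm_vec_def L2_set_def sum_nonneg a_def b_def cmod_power2 sum.distrib)
  show "integrable \<sigma> (\<lambda>e. (cmod (frechet_derivative u (at x) e))\<^sup>2)"
    unfolding eq by (intro Bochner_Integration.integrable_add surface_integral_inner)
  show "(\<integral>e. (cmod (frechet_derivative u (at x) e))\<^sup>2 \<partial>\<sigma>) =
      (norm (gradient u x))\<^sup>2 * measure \<sigma> (sphere 0 1 :: (real ^ 'n) set) / real CARD('n)"
    unfolding eq ab
    by (subst Bochner_Integration.integral_add)
      (auto simp: surface_integral_inner add_divide_distrib algebra_simps)
qed

lemma surface_pos: "measure \<sigma> (sphere 0 1 :: (real ^ 'n) set) > 0"
proof -
  interpret S: finite_measure "\<sigma> :: (real ^ 'n) measure" by (rule finite_surface_measure)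
  have "emeasure lborel (ball 0 1 - {0} :: (real ^ 'n) set) = emeasure lborel (ball 0 1 :: (real ^ 'n) set)"
    by (subst emeasure_Diff) auto
  then have "emeasure \<sigma> (sphere 0 1 :: (real ^ 'n) set) \<noteq> 0"
    unfolding emeasure_surface_space by (simp add: emeasure_ball ennreal_eq_0_iff not_le unit_ball_vol_pos)
  then show ?thesis
    by (simp add: S.emeasure_eq_measure zero_less_measure_iff)
qed

text \<open>The defining integral of \<open>D_weight\<close> is finite on the support of a test function, so the
  conversions from \<^typ>\<open>ennreal\<close> to real numbers are exact there.\<close>
lemma weight_eq_average:
  fixes u :: "real ^ 'n \<Rightarrow> complex"
  assumes \<Omega>: "open \<Omega>" and u: "u \<in> test_functions \<Omega>" and x: "x \<in> supp u"
  shows "integrable \<sigma> (\<lambda>e. dir_weight \<Omega> e x)"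
    and "enn2real (1 / (4 * (D_weight \<Omega> x)\<^sup>2)) =
      real CARD('n) / measure \<sigma> (sphere 0 1 :: (real ^ 'n) set) * (\<integral>e. dir_weight \<Omega> e x \<partial>\<sigma>) / 4"
proof -
  interpret S: finite_measure "\<sigma> :: (real ^ 'n) measure" by (rule finite_surface_measure)
  let ?m = "measure \<sigma> (sphere 0 1 :: (real ^ 'n) set)"
  obtain \<delta> where \<delta>: "\<delta> > 0" "\<And>x e t. x \<in> supp u \<Longrightarrow> norm e \<le> 2 \<Longrightarrow> \<bar>t\<bar> < \<delta> \<Longrightarrow> x + t *\<^sub>R e \<in> \<Omega>"
    using test_function_supp_distance[OF \<Omega> u] by metis
  have wm: "(\<lambda>e. dir_weight \<Omega> e x) \<in> borel_measurable \<sigma>"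
  proof (rule borel_measurable_surface)
    have "(\<lambda>e. (x, e)) \<in> borel \<rightarrow>\<^sub>M borel" by (intro borel_measurable_continuous_onI continuous_intros)
    from measurable_compose[OF this borel_measurable_dir_weight[OF \<Omega>]]
    show "(\<lambda>e. dir_weight \<Omega> e x) \<in> borel_measurable borel" by simp
  qed
  have sp: "norm e = 1" if "e \<in> space \<sigma>" for e :: "real ^ 'n"
    using that by (simp add: space_surface_measure)
  have le: "dir_weight \<Omega> e x \<le> 1 / \<delta>\<^sup>2" "inverse ((dir_dist \<Omega> e x)\<^sup>2) \<le> ennreal (1 / \<delta>\<^sup>2)" if "norm e = 1" for e
    using that \<delta> x by (auto intro!: dir_weight_le inverse_dir_dist_le)
  show int: "integrable \<sigma> (\<lambda>e. dir_weight \<Omega> e x)"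
    using le(1) sp dir_weight_nonneg[of \<Omega> _ x]
    by (intro S.integrable_const_bound[of _ "1 / \<delta>\<^sup>2"] AE_I2 wm) auto
  have "(\<integral>\<^sup>+ e. inverse ((dir_dist \<Omega> e x)\<^sup>2) \<partial>\<sigma>) = (\<integral>\<^sup>+ e. ennreal (dir_weight \<Omega> e x) \<partial>\<sigma>)"
  proof (rule nn_integral_cong)
    fix e :: "real ^ 'n" assume "e \<in> space \<sigma>"
    then have "inverse ((dir_dist \<Omega> e x)\<^sup>2) < top"
      using le(2)[OF sp] le_less_trans ennreal_less_top by blast
    then show "inverse ((dir_dist \<Omega> e x)\<^sup>2) = ennreal (dir_weight \<Omega> e x)"
      by (simp add: dir_weight_def)
  qed
  also have "\<dots> = ennreal (\<integral>e. dir_weight \<Omega> e x \<partial>\<sigma>)"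
    using int dir_weight_nonneg by (intro nn_integral_eq_integral) auto
  finally have I: "(\<integral>\<^sup>+ e. inverse ((dir_dist \<Omega> e x)\<^sup>2) \<partial>\<sigma>) = ennreal (\<integral>e. dir_weight \<Omega> e x \<partial>\<sigma>)" .
  have quarter: "1 / (4 * a) = ennreal (1 / 4) * inverse a" for a :: ennreal
  proof (cases a)
    case (real r)
    have 4: "(4 :: ennreal) = ennreal 4" by simp
    show ?thesis
    proof (cases "r = 0")
      case False
      then have "1 / (4 * a) = inverse (ennreal (4 * r))"
        using real by (simp add: divide_ennreal_def 4 ennreal_mult del: ennreal_numeral)
      also have "\<dots> = ennreal (1 / 4) * inverse a"
        using False real by (simp add: inverse_ennreal ennreal_mult[symmetric] del: ennreal_numeral)
      finally show ?thesis .
    qed (use real in \<open>simp add: divide_ennreal_def ennreal_mult_top\<close>)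
  qed (simp add: divide_ennreal_def ennreal_mult_top)
  have "inverse (emeasure \<sigma> (sphere 0 1 :: (real ^ 'n) set)) = ennreal (1 / ?m)"
    using surface_pos[where 'n='n] by (simp add: S.emeasure_eq_measure inverse_ennreal divide_inverse)
  then have "1 / (4 * (D_weight \<Omega> x)\<^sup>2) =
      ennreal (1 / 4) * (ennreal (real CARD('n)) * ennreal (1 / ?m) * ennreal (\<integral>e. dir_weight \<Omega> e x \<partial>\<sigma>))"
    unfolding quarter inverse_D_weight_power2 I by (simp add: ennreal_of_nat_eq_real_of_nat)
  also have "\<dots> = ennreal (real CARD('n) / ?m * (\<integral>e. dir_weight \<Omega> e x \<partial>\<sigma>) / 4)"
    using dir_weight_nonneg[of \<Omega> _ x] by (simp add: ennreal_mult[symmetric] Bochner_Integration.integral_nonneg)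
  finally show "enn2real (1 / (4 * (D_weight \<Omega> x)\<^sup>2)) =
      real CARD('n) / ?m * (\<integral>e. dir_weight \<Omega> e x \<partial>\<sigma>) / 4"
    using dir_weight_nonneg[of \<Omega> _ x] by (simp add: Bochner_Integration.integral_nonneg)
qed

text \<open>Off the support both sides vanish, whatever the value of \<open>D_weight\<close>.\<close>
lemma energy_density_eq_average:
  fixes u :: "real ^ 'n \<Rightarrow> complex"
  assumes \<Omega>: "open \<Omega>" and u: "u \<in> test_functions \<Omega>"
  shows "(norm (gradient u x))\<^sup>2 - (cmod (u x))\<^sup>2 * enn2real (1 / (4 * (D_weight \<Omega> x)\<^sup>2)) =
    real CARD('n) / measure \<sigma> (sphere 0 1 :: (real ^ 'n) set) * (\<integral>e. hardy_density \<Omega> u e x \<partial>\<sigma>)"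
proof (cases "x \<in> supp u")
  case True
  let ?m = "measure \<sigma> (sphere 0 1 :: (real ^ 'n) set)"
  note w = weight_eq_average[OF \<Omega> u True]
  note d = surface_integral_derivative[OF u, of x]
  have "(\<integral>e. hardy_density \<Omega> u e x \<partial>\<sigma>) = (\<integral>e. (cmod (frechet_derivative u (at x) e))\<^sup>2 \<partial>\<sigma>)
      - (\<integral>e. (cmod (u x))\<^sup>2 / 4 * dir_weight \<Omega> e x \<partial>\<sigma>)"
    unfolding hardy_density_def using d(1) w(1)
    by (subst Bochner_Integration.integral_diff[symmetric]) auto
  also have "(\<integral>e. (cmod (u x))\<^sup>2 / 4 * dir_weight \<Omega> e x \<partial>\<sigma>) =
      (cmod (u x))\<^sup>2 / 4 * (\<integral>e. dir_weight \<Omega> e x \<partial>\<sigma>)"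
    by (rule integral_mult_right_zero)
  finally have av: "(\<integral>e. hardy_density \<Omega> u e x \<partial>\<sigma>) =
      (\<integral>e. (cmod (frechet_derivative u (at x) e))\<^sup>2 \<partial>\<sigma>)
      - (cmod (u x))\<^sup>2 / 4 * (\<integral>e. dir_weight \<Omega> e x \<partial>\<sigma>)" .
  show ?thesis
    unfolding w(2) av d(2) using surface_pos[where 'n='n] by (simp add: field_simps)
next
  case False
  then show ?thesis
    by (simp add: hardy_density_off_supp[OF u] test_function_supp(3)[OF u] gradient_def
        test_function_derivative_off_supp[OF u] norm_vec_def L2_set_def)
qed

lemma energy_eq_average:
  fixes u :: "real ^ 'n \<Rightarrow> complex"
  assumes \<Omega>: "open \<Omega>" and u: "u \<in> test_functions \<Omega>"
  shows "integrable \<sigma> (\<lambda>e. \<integral>x. hardy_density \<Omega> u e x \<partial>lborel)"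
    and "(LINT x:\<Omega>|lborel. (norm (gradient u x))\<^sup>2 - (cmod (u x))\<^sup>2 * enn2real (1 / (4 * (D_weight \<Omega> x)\<^sup>2)))
    = real CARD('n) / measure \<sigma> (sphere 0 1 :: (real ^ 'n) set) *
      (\<integral>e. \<integral>x. hardy_density \<Omega> u e x \<partial>lborel \<partial>\<sigma>)"
proof -
  interpret S: finite_measure "\<sigma> :: (real ^ 'n) measure" by (rule finite_surface_measure)
  interpret P: pair_sigma_finite "lborel :: (real ^ 'n) measure" "\<sigma> :: (real ^ 'n) measure" ..
  let ?c = "real CARD('n) / measure \<sigma> (sphere 0 1 :: (real ^ 'n) set)"
  note K = test_function_supp(1)[OF u]
  obtain B where B: "\<And>x e. norm e \<le> 2 \<Longrightarrow> \<bar>hardy_density \<Omega> u e x\<bar> \<le> B"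
    using hardy_density_bounded[OF \<Omega> u] by metis
  have m: "(\<lambda>(x, e). hardy_density \<Omega> u e x) \<in> borel_measurable (lborel \<Otimes>\<^sub>M \<sigma>)"
  proof -
    have "(\<lambda>p. (fst p, snd p)) \<in> lborel \<Otimes>\<^sub>M (\<sigma> :: (real ^ 'n) measure) \<rightarrow>\<^sub>M borel \<Otimes>\<^sub>M borel"
      by (intro measurable_Pair measurable_compose[OF measurable_snd measurable_ident_surface]) simp
    then have "(\<lambda>p. (fst p, snd p)) \<in> lborel \<Otimes>\<^sub>M (\<sigma> :: (real ^ 'n) measure) \<rightarrow>\<^sub>M borel"
      by (simp add: borel_prod)
    from measurable_compose[OF this borel_measurable_hardy_density[OF \<Omega> u]]
    show ?thesis by (simp add: split_beta)
  qed
  let ?S = "\<sigma> :: (real ^ 'n) measure"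
  have int: "integrable (lborel \<Otimes>\<^sub>M ?S) (\<lambda>(x, e). hardy_density \<Omega> u e x)"
  proof (rule integrableI_bounded_set[of "supp u \<times> space ?S" _ _ B])
    show "emeasure (lborel \<Otimes>\<^sub>M ?S) (supp u \<times> space ?S) < \<infinity>"
      using emeasure_bounded_finite[OF compact_imp_bounded[OF K]] borel_compact[OF K]
      by (subst S.emeasure_pair_measure_Times) (auto simp: ennreal_mult_less_top S.emeasure_eq_measure)
    show "AE p in lborel \<Otimes>\<^sub>M ?S. p \<in> supp u \<times> space ?S \<longrightarrow> norm (case p of (x, e) \<Rightarrow> hardy_density \<Omega> u e x) \<le> B"
      using B by (intro AE_I2) (auto simp: space_surface_measure)
    show "AE p in lborel \<Otimes>\<^sub>M ?S. p \<notin> supp u \<times> space ?S \<longrightarrow> (case p of (x, e) \<Rightarrow> hardy_density \<Omega> u e x) = 0"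
      using hardy_density_off_supp[OF u] by (intro AE_I2) (force simp: space_pair_measure)
  qed (use borel_compact[OF K] m in auto)
  show "integrable \<sigma> (\<lambda>e. \<integral>x. hardy_density \<Omega> u e x \<partial>lborel)"
    using P.integrable_snd[OF int] .
  have "(LINT x:\<Omega>|lborel. (norm (gradient u x))\<^sup>2 - (cmod (u x))\<^sup>2 * enn2real (1 / (4 * (D_weight \<Omega> x)\<^sup>2)))
      = (\<integral>x. ?c * (\<integral>e. hardy_density \<Omega> u e x \<partial>\<sigma>) \<partial>lborel)"
    unfolding energy_density_eq_average[OF \<Omega> u] set_lebesgue_integral_def
  proof (intro Bochner_Integration.integral_cong refl)
    fix x
    show "indicator \<Omega> x *\<^sub>R (?c * (\<integral>e. hardy_density \<Omega> u e x \<partial>\<sigma>)) = ?c * (\<integral>e. hardy_density \<Omega> u e x \<partial>\<sigma>)"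
      using test_function_supp(2)[OF u] hardy_density_off_supp[OF u, of x]
      by (cases "x \<in> supp u") (auto simp: indicator_def)
  qed
  also have "\<dots> = ?c * (\<integral>x. \<integral>e. hardy_density \<Omega> u e x \<partial>\<sigma> \<partial>lborel)"
    by (rule integral_mult_right_zero)
  also have "(\<integral>x. \<integral>e. hardy_density \<Omega> u e x \<partial>\<sigma> \<partial>lborel) = (\<integral>e. \<integral>x. hardy_density \<Omega> u e x \<partial>lborel \<partial>\<sigma>)"
    by (rule P.Fubini_integral[OF int, symmetric])
  finally show "(LINT x:\<Omega>|lborel. (norm (gradient u x))\<^sup>2 - (cmod (u x))\<^sup>2 * enn2real (1 / (4 * (D_weight \<Omega> x)\<^sup>2)))
      = ?c * (\<integral>e. \<integral>x. hardy_density \<Omega> u e x \<partial>lborel \<partial>\<sigma>)" .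
qed

section \<open>Choice of directions\<close>

definition cap :: "'n::finite \<Rightarrow> (real ^ 'n) set" where
  "cap i = sphere 0 1 \<inter> cball (axis i 1) (1 / (2 * real CARD('n)))"

lemma cap_sets: "cap i \<in> sets borel" "cap i \<in> sets \<sigma>"
proof -
  have "closed (cap i)"
    unfolding cap_def by (intro closed_Int closed_cball closed_sphere)
  then show b: "cap i \<in> sets borel" by (rule borel_closed)
  have "(\<lambda>x. x) -` cap i \<inter> space \<sigma> = cap i"
    by (auto simp: cap_def space_surface_measure)
  then show "cap i \<in> sets \<sigma>"
    using measurable_sets[OF measurable_ident_surface b] by simp
qed

text \<open>The cone over the cap contains a neighbourhood of \<open>axis i 1 / 2\<close>.\<close>
lemma cap_pos: "measure \<sigma> (cap i :: (real ^ 'n::finite) set) > 0"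
proof -
  interpret S: finite_measure "\<sigma> :: (real ^ 'n) measure" by (rule finite_surface_measure)
  let ?a = "axis i (1::real) :: real ^ 'n"
  define V where "V = (ball 0 1 - {0}) \<inter> sgn -` ball ?a (1 / (2 * real CARD('n)))"
  have "open V"
    unfolding V_def
    by (intro continuous_open_preimage continuous_on_sgn continuous_on_id) auto
  moreover have "(1/2) *\<^sub>R ?a \<in> V"
    by (auto simp: V_def sgn_scaleR sgn_div_norm)
  ultimately obtain r where r: "r > 0" "ball ((1/2) *\<^sub>R ?a) r \<subseteq> V"
    using open_contains_ball by blast
  have V: "V \<subseteq> {x \<in> ball 0 1 - {0}. sgn x \<in> cap i}"
    by (auto simp: V_def cap_def norm_sgn dist_norm norm_minus_commute)
  have "0 < measure lborel (ball ((1/2) *\<^sub>R ?a) r)" using r(1) by (rule content_ball_pos)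
  then have "0 < emeasure lborel (ball ((1/2) *\<^sub>R ?a) r)"
    by (simp add: measure_def enn2real_positive_iff)
  also have "\<dots> \<le> emeasure lborel {x \<in> ball 0 1 - {0}. sgn x \<in> cap i}"
  proof (rule emeasure_mono)
    show "ball ((1/2) *\<^sub>R ?a) r \<subseteq> {x \<in> ball 0 1 - {0}. sgn x \<in> cap i}" using r(2) V by blast
    have "{x \<in> ball 0 1 - {0}. sgn x \<in> cap i} = (ball 0 1 - {0}) \<inter> (sgn -` cap i \<inter> space borel)" by auto
    also have "\<dots> \<in> sets borel"
    proof -
      have "(sgn :: real ^ 'n \<Rightarrow> real ^ 'n) \<in> borel_measurable borel" by measurable
      from measurable_sets[OF this cap_sets(1)] show ?thesis by (intro sets.Int) auto
    qed
    finally show "{x \<in> ball 0 1 - {0}. sgn x \<in> cap i} \<in> sets lborel" by simp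
  qed
  finally have "emeasure \<sigma> (cap i) > 0"
    using emeasure_surface_measure[OF cap_sets(1), of i]
    by (auto simp: cap_def ennreal_zero_less_mult_iff)
  then show ?thesis by (simp add: measure_def enn2real_positive_iff S.emeasure_finite less_top[symmetric])
qed

theorem theorem1p1:
  fixes N :: real
  defines "N \<equiv> real CARD('n::finite)"
  assumes "CARD('n) \<ge> 3"
  shows "\<exists>K::real. K > 0 \<and>
    (\<forall>(\<Omega> :: (real ^ 'n) set) (u :: real ^ 'n \<Rightarrow> complex).
      is_domain \<Omega> \<and> \<Omega> \<subset> UNIV \<and> u \<in> test_functions \<Omega> \<longrightarrow>
        (LINT x:\<Omega>|lborel. (norm (gradient u x))\<^sup>2
            - (cmod (u x))\<^sup>2 * enn2real (1 / (4 * (D_weight \<Omega> x)\<^sup>2)))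
        \<ge> K * (LINT x:\<Omega>|lborel. cmod (u x) powr (2 * N / (N - 2))) powr ((N - 2) / N))"
proof -
  interpret S: finite_measure "\<sigma> :: (real ^ 'n) measure" by (rule finite_surface_measure)
  define C where "C = 4 * (3 * (2 * (N - 1) / (N - 2)) + 2)\<^sup>2"
  define c where "c = N / measure \<sigma> (sphere 0 1 :: (real ^ 'n) set)"
  define m where "m = Min (range (\<lambda>i::'n. measure \<sigma> (cap i)))"
  have N3: "N \<ge> 3" using assms by simp
  have "2 * (N - 1) / (N - 2) > 0" using N3 by simp
  then have "3 * (2 * (N - 1) / (N - 2)) + 2 > 0" by linarith
  then have C: "C > 0" unfolding C_def by (intro mult_pos_pos zero_less_power) auto
  have c: "c > 0" using surface_pos[where 'n='n] N3 by (simp add: c_def)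
  have m: "m > 0" unfolding m_def by (subst Min_gr_iff) (auto simp: cap_pos)
  have m_le: "m \<le> measure \<sigma> (cap i)" for i :: 'n unfolding m_def by (intro Min_le) auto
  show ?thesis
  proof (intro exI[of _ "c * m / C"] conjI allI impI)
    show "c * m / C > 0" using c m C by simp
    fix \<Omega> :: "(real ^ 'n) set" and u :: "real ^ 'n \<Rightarrow> complex"
    assume A: "is_domain \<Omega> \<and> \<Omega> \<subset> UNIV \<and> u \<in> test_functions \<Omega>"
    then have \<Omega>: "open \<Omega>" and u: "u \<in> test_functions \<Omega>" by (auto simp: is_domain_def)
    define E where "E e = (\<integral>x. hardy_density \<Omega> u e x \<partial>lborel)" for e
    define \<Lambda> where "\<Lambda> = (\<integral>e. E e \<partial>\<sigma>)"
    define Q where "Q = (\<integral>x. cmod (u x) powr (2 * N / (N - 2)) \<partial>lborel)"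
    have Ei: "integrable \<sigma> E"
      using energy_eq_average(1)[OF \<Omega> u] by (simp add: E_def[abs_def])
    have E0: "E e \<ge> 0" if "e \<in> space \<sigma>" for e
      using hardy_energy_nonneg[OF \<Omega> u, of e] that by (simp add: E_def space_surface_measure)
    have L0: "\<Lambda> \<ge> 0" unfolding \<Lambda>_def using E0 by (intro Bochner_Integration.integral_nonneg_AE AE_I2) auto
    \<comment> \<open>Markov's inequality in each cap. The margin \<open>\<epsilon>\<close> makes the contradiction strict and disappears
      afterwards.\<close>
    have bound: "Q powr ((N - 2) / N) \<le> C * ((\<Lambda> + \<epsilon>) / m)" if "\<epsilon> > 0" for \<epsilon>
    proof -
      have "\<exists>e \<in> cap i. E e \<le> (\<Lambda> + \<epsilon>) / m" for i
      proof (rule ccontr)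
        assume "\<not> ?thesis"
        then have gt: "E e > (\<Lambda> + \<epsilon>) / m" if "e \<in> cap i" for e using that by force
        have "\<Lambda> + \<epsilon> \<le> (\<Lambda> + \<epsilon>) / m * measure \<sigma> (cap i)"
          using m mult_left_mono[OF m_le[of i], of "\<Lambda> + \<epsilon>"] L0 that by (simp add: pos_le_divide_eq)
        also have "\<dots> = (\<integral>e. (\<Lambda> + \<epsilon>) / m * indicator (cap i) e \<partial>\<sigma>)"
          using cap_sets(2)[of i] sets.sets_into_space[OF cap_sets(2)[of i]] by (simp add: Int_absorb1 Int_absorb2)
        also have "\<dots> \<le> (\<integral>e. E e \<partial>\<sigma>)"
        proof (rule integral_mono)
          show "integrable \<sigma> (\<lambda>e. (\<Lambda> + \<epsilon>) / m * indicator (cap i) e)"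
            using cap_sets(2)[of i] by (intro integrable_mult_right) (auto simp: S.emeasure_finite less_top[symmetric])
          show "(\<Lambda> + \<epsilon>) / m * indicator (cap i) e \<le> E e" if "e \<in> space \<sigma>" for e
            using gt[of e] E0[OF that] by (auto simp: indicator_def less_imp_le)
        qed (rule Ei)
        finally show False using that by (simp add: \<Lambda>_def)
      qed
      then obtain e where e: "\<And>i. e i \<in> cap i" "\<And>i. E (e i) \<le> (\<Lambda> + \<epsilon>) / m" by metis
      then show ?thesis
        unfolding Q_def C_def N_def using assms(2)
        by (intro near_axes_sobolev[OF _ \<Omega> u, of e]) (auto simp: cap_def E_def N_def dist_norm norm_minus_commute)
    qed
    have "Q powr ((N - 2) / N) \<le> C * (\<Lambda> / m)"
    proof (rule field_le_epsilon)
      fix \<epsilon> :: real assume "\<epsilon> > 0"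
      then have "Q powr ((N - 2) / N) \<le> C * ((\<Lambda> + \<epsilon> * m / C) / m)"
        using C m by (intro bound) simp
      also have "\<dots> = C * (\<Lambda> / m) + \<epsilon>"
        using C m by (simp add: field_simps)
      finally show "Q powr ((N - 2) / N) \<le> C * (\<Lambda> / m) + \<epsilon>" .
    qed
    then have "c * m / C * Q powr ((N - 2) / N) \<le> c * m / C * (C * (\<Lambda> / m))"
      using c m C by (intro mult_left_mono) auto
    also have "\<dots> = c * \<Lambda>" using m C by simp
    also have "\<dots> = (LINT x:\<Omega>|lborel. (norm (gradient u x))\<^sup>2
            - (cmod (u x))\<^sup>2 * enn2real (1 / (4 * (D_weight \<Omega> x)\<^sup>2)))"
      unfolding energy_eq_average(2)[OF \<Omega> u] by (simp add: c_def N_def \<Lambda>_def E_def)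
    finally have main: "c * m / C * Q powr ((N - 2) / N) \<le> (LINT x:\<Omega>|lborel. (norm (gradient u x))\<^sup>2
            - (cmod (u x))\<^sup>2 * enn2real (1 / (4 * (D_weight \<Omega> x)\<^sup>2)))" .
    have "(LINT x:\<Omega>|lborel. cmod (u x) powr (2 * N / (N - 2))) = Q"
      unfolding Q_def set_lebesgue_integral_def
    proof (intro Bochner_Integration.integral_cong refl)
      fix x show "indicator \<Omega> x *\<^sub>R cmod (u x) powr (2 * N / (N - 2)) = cmod (u x) powr (2 * N / (N - 2))"
        using test_function_supp(2,3)[OF u] by (cases "x \<in> supp u") (auto simp: indicator_def)
    qed
    then show "(LINT x:\<Omega>|lborel. (norm (gradient u x))\<^sup>2
            - (cmod (u x))\<^sup>2 * enn2real (1 / (4 * (D_weight \<Omega> x)\<^sup>2)))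
        \<ge> c * m / C * (LINT x:\<Omega>|lborel. cmod (u x) powr (2 * N / (N - 2))) powr ((N - 2) / N)"
      using main by (simp only:)
  qed
qed

end
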